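(* Fix an integer $k \ge 2$. There is a randomized algorithm which, on input $\varepsilon>0$, $\delta>0$ and a $\pm$ labeling of the edges of a complete graph $G$ on $n$ vertices, with probability at least $1-\delta$ outputs a $k$-clustering of the vertices whose number of agreements is at least $\mathrm{OPT}-\varepsilon n^2/2$, where $\mathrm{OPT}$ is the maximum number of agreements induced by any $k$-clustering of $G$. The running time of the algorithm is $\frac{n}{\varepsilon}\, k^{O(\varepsilon^{-2}\log k \log(1/(\varepsilon\delta)))}$.
   Context: Let $V$ be a finite set of $n$ vertices and let every unordered pair of distinct vertices (edge of the complete graph on $V$) be labeled either $+$ or $-$. A $k$-clustering is a partition of $V$ into at most $k$ parts (clusters). An edge is an agreement of a clustering if it is a $+$ edge with both endpoints in the same cluster or a $-$ edge with endpoints in different clusters.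
   Formalization: The running time bound is evaluated at min(ε,1/2) and min(δ,1), since the stated formula tends to 0 for large ε and is meaningless when εδ ≥ 1; for ε ≤ 1/2 and δ ≤ 1 it is the stated bound; n ≥ 1 is assumed. *)

theory Defs
  imports "HOL-Probability.Probability"
begin

section \<open>Correlation clustering\<close>

datatype sign = Plus | Minus

text \<open>A labeling assigns a sign to every edge; its values on sets that are not edges are irrelevant.\<close>

type_synonym labeling = "nat set \<Rightarrow> sign"

definition edges :: "nat set \<Rightarrow> nat set set" where
  "edges V = {{u, v} | u v. u \<in> V \<and> v \<in> V \<and> u \<noteq> v}"

definition k_clustering :: "nat \<Rightarrow> nat set \<Rightarrow> nat set set \<Rightarrow> bool" where
  "k_clustering k V P \<longleftrightarrow> partition_on V P \<and> card P \<le> k"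

definition same_cluster :: "nat set set \<Rightarrow> nat \<Rightarrow> nat \<Rightarrow> bool" where
  "same_cluster P u v \<longleftrightarrow> (\<exists>A\<in>P. u \<in> A \<and> v \<in> A)"

definition diff_cluster :: "nat set set \<Rightarrow> nat \<Rightarrow> nat \<Rightarrow> bool" where
  "diff_cluster P u v \<longleftrightarrow> (\<exists>A\<in>P. \<exists>B\<in>P. A \<noteq> B \<and> u \<in> A \<and> v \<in> B)"

definition agreement_edges :: "labeling \<Rightarrow> nat set \<Rightarrow> nat set set \<Rightarrow> nat set set" where
  "agreement_edges lab V P = {{u, v} | u v. {u, v} \<in> edges V \<and>
     (lab {u, v} = Plus \<and> same_cluster P u v \<or> lab {u, v} = Minus \<and> diff_cluster P u v)}"

definition agreements :: "labeling \<Rightarrow> nat set \<Rightarrow> nat set set \<Rightarrow> nat" where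
  "agreements lab V P = card (agreement_edges lab V P)"

definition OPT :: "nat \<Rightarrow> labeling \<Rightarrow> nat set \<Rightarrow> nat" where
  "OPT k lab V = Max {agreements lab V P | P. k_clustering k V P}"


section \<open>Randomized random access programs\<close>

text \<open>
  The machine model is a structured unit-cost RAM. A program uses finitely many integer
  registers, arrays with indirect addressing (unbounded, all entries initially 0) and registers
  holding exact reals, the latter because the parameters of the problem are arbitrary real
  numbers. The only arithmetic is addition and subtraction (truncated on natural numbers):
  unit-cost multiplication of unbounded numbers would make the model unreasonably powerful.
  The labeling is accessed by queries to single edges, since the running time to be
  stated is sublinear in the number of edges. The command \<open>Uniform x y\<close> draws a uniformly
  random element of \<open>{0..<m}\<close>, where \<open>m\<close> is the content of register \<open>y\<close>.
\<close>

datatype test =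
    Less nat nat
  | RLess nat nat

datatype com =
    Skip
  | Const nat nat
  | Move nat nat
  | Add nat nat nat
  | Sub nat nat nat
  | Load nat nat nat
  | Store nat nat nat
  | Query nat nat nat
  | Uniform nat nat
  | RConst nat nat
  | RMove nat nat
  | RAdd nat nat nat
  | RSub nat nat nat
  | Seq com com
  | Cond test com com
  | While test com

record memory =
  reg :: "nat \<Rightarrow> nat"
  rreg :: "nat \<Rightarrow> real"
  arr :: "nat \<Rightarrow> nat \<Rightarrow> nat"

fun test_val :: "test \<Rightarrow> memory \<Rightarrow> bool" where
  "test_val (Less x y) s \<longleftrightarrow> reg s x < reg s y"
| "test_val (RLess x y) s \<longleftrightarrow> rreg s x < rreg s y"

definition set_reg :: "nat \<Rightarrow> nat \<Rightarrow> memory \<Rightarrow> memory" where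
  "set_reg x a s = s\<lparr>reg := (reg s)(x := a)\<rparr>"

definition set_rreg :: "nat \<Rightarrow> real \<Rightarrow> memory \<Rightarrow> memory" where
  "set_rreg x a s = s\<lparr>rreg := (rreg s)(x := a)\<rparr>"

definition set_arr :: "nat \<Rightarrow> nat \<Rightarrow> nat \<Rightarrow> memory \<Rightarrow> memory" where
  "set_arr b i a s = s\<lparr>arr := (arr s)(b := (arr s b)(i := a))\<rparr>"

definition query :: "nat \<Rightarrow> labeling \<Rightarrow> nat \<Rightarrow> nat \<Rightarrow> nat" where
  "query n lab u v = (if {u, v} \<in> edges {..<n} \<and> lab {u, v} = Plus then 1 else 0)"

definition uniform_below :: "nat \<Rightarrow> nat pmf" where
  "uniform_below m = (if m = 0 then return_pmf 0 else pmf_of_set {..<m})"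

text \<open>
  A configuration consists of the remaining program and the memory; it is final iff
  the remaining program is \<open>Skip\<close>. Every transition takes one unit of time.
\<close>

primrec step :: "nat \<Rightarrow> labeling \<Rightarrow> com \<Rightarrow> memory \<Rightarrow> (com \<times> memory) pmf" where
  "step n lab Skip s = return_pmf (Skip, s)"
| "step n lab (Const x a) s = return_pmf (Skip, set_reg x a s)"
| "step n lab (Move x y) s = return_pmf (Skip, set_reg x (reg s y) s)"
| "step n lab (Add x y z) s = return_pmf (Skip, set_reg x (reg s y + reg s z) s)"
| "step n lab (Sub x y z) s = return_pmf (Skip, set_reg x (reg s y - reg s z) s)"
| "step n lab (Load x b i) s = return_pmf (Skip, set_reg x (arr s b (reg s i)) s)"
| "step n lab (Store b i y) s = return_pmf (Skip, set_arr b (reg s i) (reg s y) s)"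
| "step n lab (Query x u v) s = return_pmf (Skip, set_reg x (query n lab (reg s u) (reg s v)) s)"
| "step n lab (Uniform x y) s = map_pmf (\<lambda>a. (Skip, set_reg x a s)) (uniform_below (reg s y))"
| "step n lab (RConst x a) s = return_pmf (Skip, set_rreg x (real a) s)"
| "step n lab (RMove x y) s = return_pmf (Skip, set_rreg x (rreg s y) s)"
| "step n lab (RAdd x y z) s = return_pmf (Skip, set_rreg x (rreg s y + rreg s z) s)"
| "step n lab (RSub x y z) s = return_pmf (Skip, set_rreg x (rreg s y - rreg s z) s)"
| "step n lab (Seq c1 c2) s =
     (if c1 = Skip then return_pmf (c2, s)
      else map_pmf (\<lambda>(c, s'). (Seq c c2, s')) (step n lab c1 s))"
| "step n lab (Cond b c1 c2) s = return_pmf (if test_val b s then c1 else c2, s)"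
| "step n lab (While b c) s =
     return_pmf (if test_val b s then Seq c (While b c) else Skip, s)"

primrec run :: "nat \<Rightarrow> labeling \<Rightarrow> nat \<Rightarrow> com \<times> memory \<Rightarrow> (com \<times> memory) pmf" where
  "run n lab 0 cfg = return_pmf cfg"
| "run n lab (Suc t) cfg = bind_pmf (step n lab (fst cfg) (snd cfg)) (run n lab t)"

definition init_memory :: "nat \<Rightarrow> real \<Rightarrow> real \<Rightarrow> memory" where
  "init_memory n \<epsilon> \<delta> =
     \<lparr>reg = (\<lambda>_. 0)(0 := n), rreg = (\<lambda>_. 0)(0 := \<epsilon>, 1 := \<delta>), arr = (\<lambda>_ _. 0)\<rparr>"

definition run_on_input ::
  "com \<Rightarrow> nat \<Rightarrow> labeling \<Rightarrow> real \<Rightarrow> real \<Rightarrow> nat \<Rightarrow> (com \<times> memory) pmf" where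
  "run_on_input prog n lab \<epsilon> \<delta> t = run n lab t (prog, init_memory n \<epsilon> \<delta>)"

text \<open>The output is read off array 0, whose entry at \<open>v\<close> is a name of the cluster of vertex \<open>v\<close>.\<close>

definition output_clustering :: "nat \<Rightarrow> memory \<Rightarrow> nat set set" where
  "output_clustering n s = (\<lambda>v. {u \<in> {..<n}. arr s 0 u = arr s 0 v}) ` {..<n}"

text \<open>A running time bound is worst case, that is, it holds for all outcomes of the random choices.\<close>

definition halts_within :: "com \<Rightarrow> nat \<Rightarrow> labeling \<Rightarrow> real \<Rightarrow> real \<Rightarrow> nat \<Rightarrow> bool" where
  "halts_within prog n lab \<epsilon> \<delta> t \<longleftrightarrow>
     (\<forall>cfg \<in> set_pmf (run_on_input prog n lab \<epsilon> \<delta> t). fst cfg = Skip)"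

text \<open>The constant \<open>C\<close> is the one hidden in the \<open>O\<close> in the exponent.\<close>

definition time_bound :: "real \<Rightarrow> nat \<Rightarrow> nat \<Rightarrow> real \<Rightarrow> real \<Rightarrow> real" where
  "time_bound C k n \<epsilon> \<delta> =
     real n / \<epsilon> * real k powr (C * (1 / \<epsilon>\<^sup>2 * ln (real k) * ln (1 / (\<epsilon> * \<delta>))))"

end

theory Submission
  imports Defs
begin

text \<open>
  Guess the optimal labels of one random sample of \<open>q = O(a\<^sup>2 L)\<close> vertices, where \<open>a\<close> is about \<open>1 / \<epsilon>\<close> and
  \<open>L\<close> about \<open>log (k / (\<epsilon> \<delta>))\<close>, and place the vertices one after another, each in the cluster that looks best.
  What placing \<open>v\<close> in a cluster contributes depends on the labels of the later vertices, which are taken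
  from the optimum and are estimated from the guessed sample, and on those of the earlier vertices,
  which are known and are estimated from a fresh sample for \<open>v\<close>. Only the first sample has to be
  guessed, so there are just \<open>k ^ q\<close> guesses. Replacing the optimal labels by the computed ones one vertex
  at a time, a vertex costs \<open>O(n / a)\<close> agreements if its estimates are accurate and \<open>O(n)\<close> otherwise; by
  Hoeffding's and Markov's inequalities few vertices are of the second kind. The labelings obtained
  from all the guesses are compared on a further sample of pairs, which is large enough for a union
  bound over the guesses.
\<close>

section \<open>Reasoning about programs\<close>

text \<open>Since \<open>k ^ q\<close> guesses are tried, \<open>q\<close> must not depend on
  \<open>n\<close>. A union bound over all vertices would need \<open>q\<close> of order log
  \<open>n\<close>; tolerating a few inaccurate vertices avoids it, however strongly these are
  correlated through the first sample. The optimal labels \<open>x\<close> are fixed before anything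
  is drawn, so only the guess that equals \<open>x\<close> on the sample has to be analysed; of the
  other guesses it is only claimed that the test judges them correctly. Computed labels, in
  contrast, depend on the samples used so far, hence the fresh ones. Error budget in ordered pairs,
  where the goal allows \<open>\<epsilon> * n^2\<close>, which is at least \<open>n^2 / a\<close>:
  inaccurate vertices lose at most \<open>2 * n^2 / (5 * a)\<close>, accurate ones as much again,
  and the comparison of the guesses \<open>n^2 / (5 * a)\<close>.\<close>

primrec regs_of :: "com \<Rightarrow> nat set" where
  "regs_of Skip = {}"
| "regs_of (Const x a) = {x}"
| "regs_of (Move x y) = {x}"
| "regs_of (Add x y z) = {x}"
| "regs_of (Sub x y z) = {x}"
| "regs_of (Load x b i) = {x}"
| "regs_of (Store b i y) = {}"
| "regs_of (Query x u v) = {x}"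
| "regs_of (Uniform x y) = {x}"
| "regs_of (RConst x a) = {}"
| "regs_of (RMove x y) = {}"
| "regs_of (RAdd x y z) = {}"
| "regs_of (RSub x y z) = {}"
| "regs_of (Seq c1 c2) = regs_of c1 \<union> regs_of c2"
| "regs_of (Cond b c1 c2) = regs_of c1 \<union> regs_of c2"
| "regs_of (While b c) = regs_of c"

primrec arrs_of :: "com \<Rightarrow> nat set" where
  "arrs_of Skip = {}"
| "arrs_of (Const x a) = {}"
| "arrs_of (Move x y) = {}"
| "arrs_of (Add x y z) = {}"
| "arrs_of (Sub x y z) = {}"
| "arrs_of (Load x b i) = {}"
| "arrs_of (Store b i y) = {b}"
| "arrs_of (Query x u v) = {}"
| "arrs_of (Uniform x y) = {}"
| "arrs_of (RConst x a) = {}"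
| "arrs_of (RMove x y) = {}"
| "arrs_of (RAdd x y z) = {}"
| "arrs_of (RSub x y z) = {}"
| "arrs_of (Seq c1 c2) = arrs_of c1 \<union> arrs_of c2"
| "arrs_of (Cond b c1 c2) = arrs_of c1 \<union> arrs_of c2"
| "arrs_of (While b c) = arrs_of c"

text \<open>Real registers are left out because only the initial phase \<open>prec_com\<close>
  touches them, and it is verified by direct computation.\<close>

definition frame :: "nat set \<Rightarrow> nat set \<Rightarrow> memory \<Rightarrow> memory \<Rightarrow> bool" where
  "frame R A s s' \<longleftrightarrow> (\<forall>x. x \<notin> R \<longrightarrow> reg s' x = reg s x) \<and> (\<forall>b. b \<notin> A \<longrightarrow> arr s' b = arr s b)"

lemma frame_refl: "frame R A s s"
  by (simp add: frame_def)

lemma frame_trans: "frame R A s s' \<Longrightarrow> frame R A s' s'' \<Longrightarrow> frame R A s s''"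
  by (simp add: frame_def)

lemma frame_mono: "frame R A s s' \<Longrightarrow> R \<subseteq> R' \<Longrightarrow> A \<subseteq> A' \<Longrightarrow> frame R' A' s s'"
  by (auto simp: frame_def)

lemma frame_reg: "frame R A s s' \<Longrightarrow> x \<notin> R \<Longrightarrow> reg s' x = reg s x"
  by (simp add: frame_def)

lemma frame_arr: "frame R A s s' \<Longrightarrow> b \<notin> A \<Longrightarrow> arr s' b = arr s b"
  by (simp add: frame_def)

text \<open>\<open>Uniform\<close> is excluded as well: what remains is deterministic, so its final
  memory can be computed by simplification with \<open>exec\<close>, and \<open>cost\<close> bounds
  its time.\<close>

primrec loop_free :: "com \<Rightarrow> bool" where
  "loop_free Skip = True"
| "loop_free (Const x a) = True"
| "loop_free (Move x y) = True"
| "loop_free (Add x y z) = True"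
| "loop_free (Sub x y z) = True"
| "loop_free (Load x b i) = True"
| "loop_free (Store b i y) = True"
| "loop_free (Query x u v) = True"
| "loop_free (Uniform x y) = False"
| "loop_free (RConst x a) = True"
| "loop_free (RMove x y) = True"
| "loop_free (RAdd x y z) = True"
| "loop_free (RSub x y z) = True"
| "loop_free (Seq c1 c2) = (loop_free c1 \<and> loop_free c2)"
| "loop_free (Cond b c1 c2) = (loop_free c1 \<and> loop_free c2)"
| "loop_free (While b c) = False"

primrec cost :: "com \<Rightarrow> nat" where
  "cost Skip = 1"
| "cost (Const x a) = 1"
| "cost (Move x y) = 1"
| "cost (Add x y z) = 1"
| "cost (Sub x y z) = 1"
| "cost (Load x b i) = 1"
| "cost (Store b i y) = 1"
| "cost (Query x u v) = 1"
| "cost (Uniform x y) = 1"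
| "cost (RConst x a) = 1"
| "cost (RMove x y) = 1"
| "cost (RAdd x y z) = 1"
| "cost (RSub x y z) = 1"
| "cost (Seq c1 c2) = cost c1 + 1 + cost c2"
| "cost (Cond b c1 c2) = 1 + max (cost c1) (cost c2)"
| "cost (While b c) = 0"

text \<open>Register 1 always holds the constant 1 once the program has started.\<close>

definition For :: "nat \<Rightarrow> nat \<Rightarrow> com \<Rightarrow> com" where
  "For i z c = Seq (Const i 0) (While (Less i z) (Seq c (Add i i 1)))"

lemma regs_of_For [simp]: "regs_of (For i z c) = insert i (regs_of c)"
  by (auto simp: For_def)

lemma arrs_of_For [simp]: "arrs_of (For i z c) = arrs_of c"
  by (auto simp: For_def)

section \<open>Rules for executions that certainly halt within a given time\<close>

context
  fixes n :: nat and lab :: labeling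
begin

text \<open>Since \<open>step\<close> leaves a halted configuration alone, fixing the time
  \<open>t\<close> yields an upper bound on the running time, valid for every outcome of the random
  choices as \<open>halts_within\<close> demands.\<close>

definition runs :: "com \<Rightarrow> memory \<Rightarrow> nat \<Rightarrow> memory pmf \<Rightarrow> bool" where
  "runs c s t D \<longleftrightarrow> run n lab t (c, s) = map_pmf (Pair Skip) D"

lemma run_Skip: "run n lab t (Skip, s) = return_pmf (Skip, s)"
  by (induction t) (simp_all add: bind_return_pmf)

lemma run_add: "run n lab (t + t') cfg = bind_pmf (run n lab t cfg) (run n lab t')"
  by (induction t arbitrary: cfg) (auto simp: bind_return_pmf bind_assoc_pmf intro!: bind_pmf_cong)

lemma runs_mono:
  assumes "runs c s t D" "t \<le> t'"
  shows "runs c s t' D"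
proof -
  obtain u where "t' = t + u" using assms(2) le_Suc_ex by blast
  then show ?thesis using assms(1)
    by (simp add: runs_def run_add bind_map_pmf run_Skip) (simp add: map_pmf_def)
qed

lemma runs_Skip: "runs Skip s t (return_pmf s)"
  by (simp add: runs_def run_Skip)

lemma runs_step:
  assumes "step n lab c s = return_pmf (c', s')" "runs c' s' t D"
  shows "runs c s (Suc t) D"
  using assms by (simp add: runs_def bind_return_pmf)

lemma runs_atomic:
  assumes "step n lab c s = map_pmf (Pair Skip) D"
  shows "runs c s (Suc 0) D"
  using assms bind_return_pmf'[of "map_pmf (Pair Skip) D"]
  by (simp add: runs_def run.simps(1)[abs_def])

text \<open>The extra unit of time is the transition that discards the finished \<open>Skip\<close>.
  Random branches of \<open>c1\<close> may finish at different times; induction on \<open>t1\<close>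
  follows each of them, and one that finishes early is padded by \<open>runs_mono\<close>.\<close>

lemma runs_Seq:
  assumes "runs c1 s t1 D1" "\<And>s'. s' \<in> set_pmf D1 \<Longrightarrow> runs c2 s' t2 (D2 s')"
  shows "runs (Seq c1 c2) s (t1 + 1 + t2) (bind_pmf D1 D2)"
  using assms
proof (induction t1 arbitrary: c1 s D1)
  case 0
  then have eq: "return_pmf (c1, s) = map_pmf (Pair Skip) D1"
    by (simp add: runs_def)
  then have "Pair Skip ` set_pmf D1 = {(c1, s)}"
    by (metis set_map_pmf set_return_pmf)
  then have "c1 = Skip" and D: "set_pmf D1 \<subseteq> {s}"
    by (auto simp: image_iff set_eq_iff)
  then have D1: "D1 = return_pmf s"
    by (simp add: set_pmf_subset_singleton)
  have "runs (Seq c1 c2) s (Suc t2) (D2 s)"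
    using \<open>c1 = Skip\<close> 0(2)[of s] D1 by (intro runs_step) auto
  then show ?case by (simp add: D1 bind_return_pmf)
next
  case (Suc t1)
  show ?case
  proof (cases "c1 = Skip")
    case True
    then have "map_pmf (Pair Skip) D1 = return_pmf (Skip, s)"
      using Suc.prems(1) by (simp add: runs_def run_Skip bind_return_pmf)
    then have "map_pmf snd (map_pmf (Pair Skip) D1) = return_pmf s"
      by (metis map_return_pmf snd_conv)
    then have D1: "D1 = return_pmf s"
      by (simp add: pmf.map_comp o_def)
    have "runs (Seq c1 c2) s (Suc t2) (D2 s)"
      using True Suc.prems(2)[of s] D1 by (intro runs_step) auto
    then have "runs (Seq c1 c2) s (Suc t1 + 1 + t2) (D2 s)"
      by (rule runs_mono) simp
    then show ?thesis by (simp add: D1 bind_return_pmf)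
  next
    case False
    \<comment> \<open>\<open>E cfg\<close> is the distribution of the final memory once the first
      step has led to \<open>cfg\<close>. \<open>D1\<close> is the mixture of these; as the mixture
      is supported on halted configurations, so is each component.\<close>
    define E where "E cfg = map_pmf snd (run n lab t1 cfg)" for cfg
    have eq: "bind_pmf (step n lab c1 s) (run n lab t1) = map_pmf (Pair Skip) D1"
      using Suc.prems(1) by (simp add: runs_def)
    have D1: "D1 = bind_pmf (step n lab c1 s) E"
    proof -
      have "D1 = map_pmf snd (map_pmf (Pair Skip) D1)"
        by (simp add: pmf.map_comp o_def)
      also have "\<dots> = bind_pmf (step n lab c1 s) E"
        by (simp only: eq[symmetric] map_bind_pmf E_def[abs_def])
      finally show ?thesis .
    qed
    have E: "runs c' s' t1 (E (c', s'))" if "(c', s') \<in> set_pmf (step n lab c1 s)" for c' s'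
    proof -
      have "set_pmf (run n lab t1 (c', s')) \<subseteq> set_pmf (map_pmf (Pair Skip) D1)"
        using that by (subst eq[symmetric]) auto
      then have "\<forall>cfg\<in>set_pmf (run n lab t1 (c', s')). Pair Skip (snd cfg) = cfg"
        by auto
      then show ?thesis
        unfolding runs_def E_def pmf.map_comp o_def by (simp add: pmf.map_ident_strong)
    qed
    have *: "run n lab (t1 + 1 + t2) (Seq c' c2, s') = map_pmf (Pair Skip) (bind_pmf (E (c', s')) D2)"
      if st: "(c', s') \<in> set_pmf (step n lab c1 s)" for c' s'
      using Suc.IH[OF E[OF st] Suc.prems(2)] st unfolding runs_def D1 by fastforce
    have "run n lab (Suc t1 + 1 + t2) (Seq c1 c2, s) =
        bind_pmf (step n lab c1 s) (\<lambda>(c', s'). run n lab (t1 + 1 + t2) (Seq c' c2, s'))"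
      using False by (simp add: bind_map_pmf case_prod_unfold)
    also have "\<dots> = bind_pmf (step n lab c1 s) (\<lambda>cfg. map_pmf (Pair Skip) (bind_pmf (E cfg) D2))"
      using * by (intro bind_pmf_cong) auto
    also have "\<dots> = map_pmf (Pair Skip) (bind_pmf D1 D2)"
      by (simp add: D1 map_bind_pmf bind_assoc_pmf)
    finally show ?thesis by (simp add: runs_def)
  qed
qed

lemma runs_While_True:
  "test_val b s \<Longrightarrow> runs (Seq c (While b c)) s t D \<Longrightarrow> runs (While b c) s (Suc t) D"
  by (rule runs_step) auto

lemma runs_While_False: "\<not> test_val b s \<Longrightarrow> runs (While b c) s (Suc t) (return_pmf s)"
  by (rule runs_step[OF _ runs_Skip]) auto

lemma runs_Cond:
  "runs (if test_val b s then c1 else c2) s t D \<Longrightarrow> runs (Cond b c1 c2) s (Suc t) D"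
  by (rule runs_step) auto

lemma step_frame:
  "(c', s') \<in> set_pmf (step n lab c s) \<Longrightarrow>
     regs_of c' \<subseteq> regs_of c \<and> arrs_of c' \<subseteq> arrs_of c \<and> frame (regs_of c) (arrs_of c) s s'"
proof (induction c arbitrary: c' s')
  case (Seq c1 c2)
  show ?case
  proof (cases "c1 = Skip")
    case True
    then show ?thesis using Seq.prems by (auto simp: frame_refl)
  next
    case False
    then obtain d where d: "(d, s') \<in> set_pmf (step n lab c1 s)" "c' = Seq d c2"
      using Seq.prems by auto
    show ?thesis using Seq.IH(1)[OF d(1)] d(2) by (auto intro: frame_mono)
  qed
qed (auto simp: frame_def set_reg_def set_rreg_def set_arr_def split: if_splits)

lemma run_frame:
  "cfg \<in> set_pmf (run n lab t (c, s)) \<Longrightarrow> frame (regs_of c) (arrs_of c) s (snd cfg)"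
proof (induction t arbitrary: c s)
  case 0
  then show ?case by (simp add: frame_refl)
next
  case (Suc t)
  then obtain c' s' where cs: "(c', s') \<in> set_pmf (step n lab c s)"
    "cfg \<in> set_pmf (run n lab t (c', s'))"
    by auto
  show ?case
    using step_frame[OF cs(1)] Suc.IH[OF cs(2)] by (meson frame_mono frame_trans)
qed

lemma runs_frame: "runs c s t D \<Longrightarrow> s' \<in> set_pmf D \<Longrightarrow> frame (regs_of c) (arrs_of c) s s'"
  using run_frame[of "(Skip, s')" t c s] by (simp add: runs_def)

text \<open>Probabilities matter only for the drawing of the samples; the other phases are verified
  with this qualitative postcondition.\<close>

definition ends :: "com \<Rightarrow> memory \<Rightarrow> nat \<Rightarrow> (memory \<Rightarrow> bool) \<Rightarrow> bool" where
  "ends c s t Q \<longleftrightarrow> (\<exists>D. runs c s t D \<and> (\<forall>s'\<in>set_pmf D. Q s'))"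

lemma ends_mono: "ends c s t Q \<Longrightarrow> t \<le> t' \<Longrightarrow> ends c s t' Q"
  unfolding ends_def using runs_mono by blast

lemma ends_weaken:
  assumes "ends c s t Q" "t \<le> t'"
    "\<And>s'. Q s' \<Longrightarrow> frame (regs_of c) (arrs_of c) s s' \<Longrightarrow> Q' s'"
  shows "ends c s t' Q'"
  using assms runs_mono runs_frame unfolding ends_def by metis

lemma ends_Seq:
  assumes "ends c1 s t1 (\<lambda>s'. ends c2 s' t2 Q)" "t1 + 1 + t2 \<le> t"
  shows "ends (Seq c1 c2) s t Q"
proof -
  obtain D1 where D1: "runs c1 s t1 D1" "\<forall>s'\<in>set_pmf D1. ends c2 s' t2 Q"
    using assms by (auto simp: ends_def)
  then obtain D2 where D2:
    "\<And>s'. s' \<in> set_pmf D1 \<Longrightarrow> runs c2 s' t2 (D2 s') \<and> (\<forall>s''\<in>set_pmf (D2 s'). Q s'')"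
    unfolding ends_def by metis
  have "runs (Seq c1 c2) s (t1 + 1 + t2) (bind_pmf D1 D2)"
    using D1 D2 by (intro runs_Seq) auto
  then have "ends (Seq c1 c2) s (t1 + 1 + t2) Q"
    unfolding ends_def using D2 by (intro exI[of _ "bind_pmf D1 D2"]) auto
  then show ?thesis using ends_mono assms(2) by blast
qed

lemma ends_While:
  assumes "I 0 s" "\<And>j s'. j < m \<Longrightarrow> I j s' \<Longrightarrow> test_val b s' \<and> ends c s' tb (I (Suc j))"
    "\<And>s'. I m s' \<Longrightarrow> \<not> test_val b s'" "m * (tb + 2) + 1 \<le> t"
  shows "ends (While b c) s t (I m)"
proof -
  \<comment> \<open>The time left when \<open>j\<close> rounds are done: a round costs
    \<open>tb\<close>, one transition for the test and one for the discarded \<open>Skip\<close>,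
    and there is one final test.\<close>
  define B where "B j = (m - j) * (tb + 2) + 1" for j
  have B: "tb + 1 + B (Suc j) + 1 \<le> B j" if "j < m" for j
    using that by (simp add: B_def Suc_diff_Suc[symmetric])
  have "ends (While b c) s' (B j) (I m)" if "j \<le> m" "I j s'" for j s'
    using that
  proof (induction j arbitrary: s' rule: inc_induct)
    case base
    then have "runs (While b c) s' (Suc 0) (return_pmf s')"
      using assms(3) by (intro runs_While_False) auto
    then show ?case using base by (auto simp: ends_def B_def)
  next
    case (step j)
    have *: "test_val b s'" "ends c s' tb (I (Suc j))"
      using assms(2)[OF step.hyps(2) step.prems] by auto
    have "ends c s' tb (\<lambda>s''. ends (While b c) s'' (B (Suc j)) (I m))"
      using *(2) by (rule ends_weaken) (use step.IH in auto)
    then have "ends (Seq c (While b c)) s' (tb + 1 + B (Suc j)) (I m)"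
      by (rule ends_Seq) simp
    then have "ends (While b c) s' (Suc (tb + 1 + B (Suc j))) (I m)"
      using runs_While_True[OF *(1)] unfolding ends_def by blast
    then show ?case using B[OF step.hyps(2)] by (elim ends_mono) simp
  qed
  from this[of 0 s] assms(1,4) show ?thesis by (auto simp: B_def intro: ends_mono)
qed

primrec exec :: "com \<Rightarrow> memory \<Rightarrow> memory" where
  "exec Skip s = s"
| "exec (Const x a) s = set_reg x a s"
| "exec (Move x y) s = set_reg x (reg s y) s"
| "exec (Add x y z) s = set_reg x (reg s y + reg s z) s"
| "exec (Sub x y z) s = set_reg x (reg s y - reg s z) s"
| "exec (Load x b i) s = set_reg x (arr s b (reg s i)) s"
| "exec (Store b i y) s = set_arr b (reg s i) (reg s y) s"
| "exec (Query x u v) s = set_reg x (query n lab (reg s u) (reg s v)) s"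
| "exec (Uniform x y) s = s"
| "exec (RConst x a) s = set_rreg x (real a) s"
| "exec (RMove x y) s = set_rreg x (rreg s y) s"
| "exec (RAdd x y z) s = set_rreg x (rreg s y + rreg s z) s"
| "exec (RSub x y z) s = set_rreg x (rreg s y - rreg s z) s"
| "exec (Seq c1 c2) s = exec c2 (exec c1 s)"
| "exec (Cond b c1 c2) s = (if test_val b s then exec c1 s else exec c2 s)"
| "exec (While b c) s = s"

lemma runs_loop_free: "loop_free c \<Longrightarrow> runs c s (cost c) (return_pmf (exec c s))"
proof (induction c arbitrary: s)
  case (Seq c1 c2)
  have "runs (Seq c1 c2) s (cost c1 + 1 + cost c2)
      (bind_pmf (return_pmf (exec c1 s)) (\<lambda>s'. return_pmf (exec c2 s')))"
    using Seq by (intro runs_Seq) auto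
  then show ?case by (simp add: bind_return_pmf)
next
  case (Cond b c1 c2)
  have "runs (Cond b c1 c2) s (Suc (max (cost c1) (cost c2)))
      (return_pmf (exec (Cond b c1 c2) s))"
    using Cond by (intro runs_Cond) (auto intro: runs_mono[OF Cond.IH(1)] runs_mono[OF Cond.IH(2)])
  then show ?case by simp
qed (auto intro!: runs_atomic)

lemma ends_loop_free: "loop_free c \<Longrightarrow> Q (exec c s) \<Longrightarrow> cost c \<le> t \<Longrightarrow> ends c s t Q"
  unfolding ends_def using runs_mono[OF runs_loop_free]
  by (intro exI[of _ "return_pmf (exec c s)"]) auto

lemma ends_Seq_loop_free:
  "loop_free c1 \<Longrightarrow> ends c2 (exec c1 s) t2 Q \<Longrightarrow> cost c1 + 1 + t2 \<le> t \<Longrightarrow> ends (Seq c1 c2) s t Q"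
  by (rule ends_Seq[where ?t1.0 = "cost c1"])
    (auto intro: ends_loop_free[where Q = "\<lambda>s. ends c2 s t2 Q"])

lemma ends_Cond:
  "ends (if test_val b s then c1 else c2) s t Q \<Longrightarrow> Suc t \<le> t' \<Longrightarrow> ends (Cond b c1 c2) s t' Q"
  using runs_Cond ends_mono unfolding ends_def by metis

text \<open>\<open>indep\<close> forbids the invariant to mention the counter, which is incremented
  after the body; \<open>body\<close> is told its value instead. The frame relative to the memory
  \<open>s\<close> before the loop spares the invariants everything that the loop never writes. The
  4 units per round are the test, the increment and two discarded \<open>Skip\<close>s.\<close>

lemma ends_For:
  assumes nm: "i \<notin> insert z (insert 1 (regs_of c))" "z \<notin> regs_of c" "1 \<notin> regs_of c"
    and s: "reg s 1 = 1" "reg s z = m"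
    and init: "I 0 s"
    and body: "\<And>j s'. j < m \<Longrightarrow> I j s' \<Longrightarrow> reg s' i = j \<Longrightarrow>
                  frame (insert i (regs_of c)) (arrs_of c) s s' \<Longrightarrow> ends c s' tb (I (Suc j))"
    and indep: "\<And>j s' x. I j s' \<Longrightarrow> I j (set_reg i x s')"
    and post: "\<And>s'. I m s' \<Longrightarrow> frame (insert i (regs_of c)) (arrs_of c) s s' \<Longrightarrow> Q s'"
    and t: "m * (tb + 4) + 3 \<le> t"
  shows "ends (For i z c) s t Q"
proof -
  let ?F = "frame (insert i (regs_of c)) (arrs_of c) s"
  let ?J = "\<lambda>j s'. I j s' \<and> reg s' i = j \<and> ?F s'"
  have F: "reg s' 1 = 1 \<and> reg s' z = m" if "?F s'" for s'
    using frame_reg[OF that, of 1] frame_reg[OF that, of z] nm s by auto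
  have "ends (While (Less i z) (Seq c (Add i i 1))) (set_reg i 0 s) (m * ((tb + 2) + 2) + 1) (?J m)"
  proof (rule ends_While[where I = ?J and tb = "tb + 2"])
    show "?J 0 (set_reg i 0 s)"
      using init indep by (auto simp: set_reg_def frame_def)
    show "\<not> test_val (Less i z) s'" if "?J m s'" for s' using F[of s'] that by auto
  next
    fix j s' assume j: "j < m" and J: "?J j s'"
    have "ends c s' tb (I (Suc j))" using body j J by blast
    then have 1: "ends c s' tb (\<lambda>s'. ends (Add i i 1) s' 1 (?J (Suc j)))"
    proof (rule ends_weaken)
      fix s'' assume I: "I (Suc j) s''" and fr: "frame (regs_of c) (arrs_of c) s' s''"
      have "frame (insert i (regs_of c)) (arrs_of c) s' s''"
        using fr by (rule frame_mono) auto
      then have fr2: "?F s''" using J frame_trans by blast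
      have "reg s'' i = j" using frame_reg[OF fr, of i] nm J by auto
      moreover have "?F (set_reg i x s'')" for x
        using fr2 by (auto simp: frame_def set_reg_def)
      moreover have "reg s'' 1 = 1" using F[OF fr2] by blast
      ultimately show "ends (Add i i 1) s'' 1 (?J (Suc j))"
        using indep[OF I] by (intro ends_loop_free) (auto simp: set_reg_def)
    qed simp
    have "ends (Seq c (Add i i 1)) s' (tb + 2) (?J (Suc j))"
      by (rule ends_Seq[OF 1]) simp
    then show "test_val (Less i z) s' \<and> ends (Seq c (Add i i 1)) s' (tb + 2) (?J (Suc j))"
      using F[of s'] J j by auto
  qed simp
  then have "ends (For i z c) s (m * (tb + 4) + 3) (?J m)"
    unfolding For_def by (intro ends_Seq_loop_free[where ?t2.0 = "m * ((tb + 2) + 2) + 1"]) (auto simp: algebra_simps)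
  then show ?thesis by (rule ends_weaken[OF _ t]) (use post in auto)
qed

end

section \<open>Exhaustive search over the labels of a sample\<close>

text \<open>
  Entries \<open>0, \<dots>, q - 1\<close> of the sample sequence \<open>W\<close> are the vertices whose labels are guessed, entries
  \<open>(v + 1) * q + h\<close> with \<open>h < q\<close> are private to vertex \<open>v\<close>, and the entries from \<open>(n + 1) * q\<close> on, together
  with those of \<open>W'\<close>, are the pairs on which a labeling is tested.
\<close>

definition sgn_edge :: "nat \<Rightarrow> labeling \<Rightarrow> nat \<Rightarrow> nat \<Rightarrow> int" where
  "sgn_edge n lab v u = (if query n lab v u = 1 then 1 else - 1)"

definition agree :: "nat \<Rightarrow> labeling \<Rightarrow> (nat \<Rightarrow> nat) \<Rightarrow> nat \<Rightarrow> nat \<Rightarrow> bool" where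
  "agree n lab y u w \<longleftrightarrow> (query n lab u w = 1 \<longleftrightarrow> y u = y w)"

definition late_term :: "nat \<Rightarrow> labeling \<Rightarrow> nat \<Rightarrow> nat \<Rightarrow> nat \<Rightarrow> nat \<Rightarrow> int" where
  "late_term n lab v j c u = (if v < u \<and> c = j then sgn_edge n lab v u else 0)"

definition early_term :: "nat \<Rightarrow> labeling \<Rightarrow> nat \<Rightarrow> nat \<Rightarrow> (nat \<Rightarrow> nat) \<Rightarrow> nat \<Rightarrow> int" where
  "early_term n lab v j y u = (if u < v \<and> y u = j then sgn_edge n lab v u else 0)"

text \<open>For the right guess, \<open>n / q\<close> times this estimates the \<open>gain\<close>
  of the hybrid labeling with computed labels before \<open>v\<close> and optimal labels after it;
  see \<open>gain_hybrid\<close>.\<close>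

definition score ::
  "nat \<Rightarrow> labeling \<Rightarrow> nat \<Rightarrow> (nat \<Rightarrow> nat) \<Rightarrow> (nat \<Rightarrow> nat) \<Rightarrow> (nat \<Rightarrow> nat) \<Rightarrow> nat \<Rightarrow> nat \<Rightarrow> nat \<Rightarrow> int" where
  "score n lab q W g y v i j =
     (\<Sum>h<i. late_term n lab v j (g h) (W h) + early_term n lab v j y (W ((v + 1) * q + h)))"

lemma abs_score: "\<bar>score n lab q W g y v i j\<bar> \<le> 2 * int i"
  by (induction i) (auto simp: score_def late_term_def early_term_def sgn_edge_def)

primrec amax :: "(nat \<Rightarrow> nat) \<Rightarrow> nat \<Rightarrow> nat \<times> nat" where
  "amax f 0 = (0, 0)"
| "amax f (Suc j) = (if snd (amax f j) < f j then (j, f j) else amax f j)"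

text \<open>Vertices not yet placed carry the dummy label 0, which no score reads, since
  \<open>early_term\<close> looks only at smaller vertices.\<close>

primrec greedy :: "nat \<Rightarrow> labeling \<Rightarrow> nat \<Rightarrow> nat \<Rightarrow> (nat \<Rightarrow> nat) \<Rightarrow> (nat \<Rightarrow> nat) \<Rightarrow> nat \<Rightarrow> nat \<Rightarrow> nat" where
  "greedy n lab k q W g 0 = (\<lambda>_. 0)"
| "greedy n lab k q W g (Suc v) = (greedy n lab k q W g v)
     (v := fst (amax (\<lambda>j. nat (2 * int q + score n lab q W g (greedy n lab k q W g v) v q j)) k))"

definition hits :: "nat \<Rightarrow> labeling \<Rightarrow> nat \<Rightarrow> (nat \<Rightarrow> nat) \<Rightarrow> (nat \<Rightarrow> nat) \<Rightarrow> (nat \<Rightarrow> nat) \<Rightarrow> nat \<Rightarrow> nat" where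
  "hits n lab E W W' y m = (\<Sum>i<m. if agree n lab y (W (E + i)) (W' (E + i)) then 1 else 0)"

definition digits :: "nat \<Rightarrow> nat \<Rightarrow> nat \<Rightarrow> nat" where
  "digits k j i = j div k ^ i mod k"

section \<open>The search as a program\<close>

text \<open>
  Registers: 0 \<open>n\<close>, 1 the constant 1, 7 \<open>q\<close>, 9 \<open>M\<close>, 11 \<open>(n + 1) * q\<close>, 13 \<open>k\<close>, 14 \<open>2 * q\<close>, 15 \<open>k ^ q\<close>,
  39 the constant 0; 20 the guess, 21 the vertex being placed, 22 the innermost loop counter,
  31 and 32 the current and the best number of hits. Arrays: 0 the best labels found, 1 and 2 the samples,
  3 the guess as a sequence of digits, 4 the scores of the clusters, 5 the labels under construction.
  Scores are stored with offset \<open>2 * q\<close>, which keeps the truncated subtraction exact.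
\<close>

definition "upd_score_com =
  Seq (Query 27 21 24) (Seq (Load 28 4 25)
    (Seq (Cond (Less 39 27) (Add 28 28 1) (Sub 28 28 1)) (Store 4 25 28)))"

definition "late_com = Seq (Load 24 1 22) (Seq (Load 25 3 22) (Cond (Less 21 24) upd_score_com Skip))"

definition "early_com =
  Seq (Add 26 23 22) (Seq (Load 24 1 26) (Seq (Load 25 5 24) (Cond (Less 24 21) upd_score_com Skip)))"

definition "scores_com = For 22 7 (Seq late_com early_com)"

definition "clear_com = For 22 13 (Store 4 22 14)"

definition "amax_com = Seq (Const 29 0) (Seq (Const 30 0)
  (For 22 13 (Seq (Load 28 4 22) (Cond (Less 29 28) (Seq (Move 29 28) (Move 30 22)) Skip))))"

definition "place_com = Seq clear_com (Seq scores_com (Seq amax_com (Seq (Store 5 21 30) (Add 23 23 7))))"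

text \<open>Register 23 holds \<open>(v + 1) * q\<close>, the start of the private samples of the
  current vertex. It is advanced by \<open>q\<close> in \<open>place_com\<close>, which avoids a
  multiplication per vertex.\<close>

definition "greedy_com = Seq (Move 23 7) (For 21 0 place_com)"

text \<open>Tests can only compare strictly, so equality takes two comparisons: first between the
  two labels, with the result in register 34, then between this result and the query.\<close>

definition "hit_com =
  Seq (Add 26 11 22) (Seq (Load 24 1 26) (Seq (Load 36 2 26) (Seq (Query 27 24 36)
    (Seq (Load 25 5 24) (Seq (Load 35 5 36) (Seq (Const 34 1)
    (Seq (Cond (Less 25 35) (Const 34 0) Skip) (Seq (Cond (Less 35 25) (Const 34 0) Skip)
    (Cond (Less 27 34) Skip (Cond (Less 34 27) Skip (Add 31 31 1)))))))))))"

definition "hits_com = Seq (Const 31 0) (For 22 9 hit_com)"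

text \<open>A tie overwrites, so the first guess is saved even if it has no hits, the record
  starting at 0.\<close>

definition "save_com = Cond (Less 31 32) Skip
  (Seq (Move 32 31) (For 22 0 (Seq (Load 28 5 22) (Store 0 22 28))))"

text \<open>Register 33 is the carry. Incrementing a digit sequence enumerates the guesses without
  any division.\<close>

definition "carry_com =
  Seq (Load 28 3 22) (Seq (Add 28 28 33)
    (Seq (Cond (Less 28 13) (Const 33 0) (Seq (Const 28 0) (Const 33 1))) (Store 3 22 28)))"

definition "incr_com = Seq (Const 33 1) (For 22 7 carry_com)"

definition "guess_com = Seq greedy_com (Seq hits_com (Seq save_com incr_com))"

definition "search_com = Seq (Const 32 0) (For 20 15 guess_com)"

lemmas com_defs = upd_score_com_def late_com_def early_com_def scores_com_def clear_com_def
  amax_com_def place_com_def greedy_com_def hit_com_def hits_com_def save_com_def carry_com_def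
  incr_com_def guess_com_def search_com_def

lemma regs_of_coms:
  "regs_of late_com = {24, 25, 27, 28}" "regs_of early_com = {24, 25, 26, 27, 28}"
  "regs_of scores_com = {22, 24, 25, 26, 27, 28}" "regs_of clear_com = {22}"
  "regs_of amax_com = {22, 28, 29, 30}"
  "regs_of place_com = {22, 23, 24, 25, 26, 27, 28, 29, 30}"
  "regs_of greedy_com = {21, 22, 23, 24, 25, 26, 27, 28, 29, 30}"
  "regs_of hit_com = {24, 25, 26, 27, 31, 34, 35, 36}"
  "regs_of hits_com = {22, 24, 25, 26, 27, 31, 34, 35, 36}"
  "regs_of save_com = {22, 28, 32}" "regs_of carry_com = {28, 33}"
  "regs_of incr_com = {22, 28, 33}"
  "regs_of guess_com = {21, 22, 23, 24, 25, 26, 27, 28, 29, 30, 31, 32, 33, 34, 35, 36}"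
  by (auto simp: com_defs)

lemma arrs_of_coms:
  "arrs_of late_com = {4}" "arrs_of early_com = {4}" "arrs_of scores_com = {4}"
  "arrs_of clear_com = {4}" "arrs_of amax_com = {}" "arrs_of place_com = {4, 5}"
  "arrs_of greedy_com = {4, 5}" "arrs_of hit_com = {}" "arrs_of hits_com = {}"
  "arrs_of save_com = {0}" "arrs_of carry_com = {3}" "arrs_of incr_com = {3}"
  "arrs_of guess_com = {0, 3, 4, 5}"
  by (auto simp: com_defs)

section \<open>Verification of the search for fixed samples\<close>

lemma fst_amax_less: "k > 0 \<Longrightarrow> fst (amax f k) < k"
proof (induction k)
  case (Suc k)
  then show ?case by (cases "k = 0") auto
qed simp

lemma amax_cong: "(\<And>j. j < k \<Longrightarrow> f j = f' j) \<Longrightarrow> amax f k = amax f' k"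
  by (induction k) auto

text \<open>Once the samples are drawn the search is deterministic, so it is verified for arbitrary
  sequences with entries below \<open>n\<close>; randomness returns only with
  \<open>pends\<close>.\<close>

locale search =
  fixes n :: nat and lab :: labeling and k q M :: nat and W W' :: "nat \<Rightarrow> nat"
  assumes k: "k \<ge> 2" and n: "n \<ge> 1"
    and W: "\<And>i. W i < n" and W': "\<And>i. W' i < n"
begin

abbreviation "E \<equiv> (n + 1) * q"

definition env :: "memory \<Rightarrow> bool" where
  "env s \<longleftrightarrow> reg s 0 = n \<and> reg s 1 = 1 \<and> reg s 7 = q \<and> reg s 9 = M \<and> reg s 11 = E \<and> reg s 13 = k \<and>
     reg s 14 = 2 * q \<and> reg s 15 = k ^ q \<and> reg s 39 = 0 \<and> arr s 1 = W \<and> arr s 2 = W'"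

lemma env_frame:
  assumes "env s" "frame R A s s'" "R \<inter> {0, 1, 7, 9, 11, 13, 14, 15, 39} = {}" "A \<inter> {1, 2} = {}"
  shows "env s'"
proof -
  have r: "reg s' x = reg s x" if "x \<in> {0, 1, 7, 9, 11, 13, 14, 15, 39}" for x
    using assms(2,3) that by (auto simp only: frame_def)
  have a: "arr s' b = arr s b" if "b \<in> {1, 2}" for b
    using assms(2,4) that by (auto simp only: frame_def)
  show ?thesis
    using assms(1) r a by (simp add: env_def)
qed

lemma score_Suc:
  "score n lab q W g y v (Suc i) j = score n lab q W g y v i j +
     late_term n lab v j (g i) (W i) + early_term n lab v j y (W ((v + 1) * q + i))"
  by (simp add: score_def)

lemma query_01: "query n lab u w = 0 \<or> query n lab u w = 1"
  by (simp add: query_def)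

definition inputs :: "(nat \<Rightarrow> nat) \<Rightarrow> (nat \<Rightarrow> nat) \<Rightarrow> nat \<Rightarrow> memory \<Rightarrow> bool" where
  "inputs g y v s \<longleftrightarrow> env s \<and> reg s 21 = v \<and> reg s 23 = (v + 1) * q \<and>
     (\<forall>i<q. arr s 3 i = g i) \<and> (\<forall>u<v. arr s 5 u = y u)"

lemma inputs_frame:
  assumes "inputs g y v s" "frame R A s s'"
    "R \<inter> {0, 1, 7, 9, 11, 13, 14, 15, 21, 23, 39} = {}" "A \<inter> {1, 2, 3, 5} = {}"
  shows "inputs g y v s'"
proof -
  have "env s'"
    using assms by (intro env_frame[of s R A s']) (auto simp: inputs_def)
  moreover have "reg s' 21 = reg s 21" "reg s' 23 = reg s 23"
    using assms(2,3) by (auto simp only: frame_def)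
  moreover have "arr s' 3 = arr s 3" "arr s' 5 = arr s 5"
    using assms(2,4) by (auto simp only: frame_def)
  ultimately show ?thesis
    using assms(1) by (simp add: inputs_def)
qed

text \<open>The bound \<open>f j \<ge> 1\<close> keeps the truncated subtraction of 1 exact.\<close>

lemma exec_upd_score:
  assumes "reg s 1 = 1" "reg s 39 = 0" "c < k"
    and f: "\<And>j. j < k \<Longrightarrow> int (arr s 4 j) = f j" "\<And>j. j < k \<Longrightarrow> f j \<ge> 1"
    and "reg s 21 = v" "reg s 24 = u" "reg s 25 = c" "j < k"
  shows "int (arr (exec n lab upd_score_com s) 4 j) = f j + (if c = j then sgn_edge n lab v u else 0)"
proof -
  have "int (arr s 4 c) = f c" "f c \<ge> 1"
    using f assms(3) by auto
  then show ?thesis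
    using query_01[of v u] assms(1-3,6-) f(1)[of j]
    by (auto simp: upd_score_com_def sgn_edge_def set_reg_def set_arr_def)
qed

lemma ends_late_com:
  assumes s: "inputs g y v s" and i: "reg s 22 = i" "i < q" and g: "g i < k"
    and f: "\<And>j. j < k \<Longrightarrow> int (arr s 4 j) = f j" "\<And>j. j < k \<Longrightarrow> f j \<ge> 1"
  shows "ends n lab late_com s 14 (\<lambda>s'. \<forall>j<k. int (arr s' 4 j) = f j + late_term n lab v j (g i) (W i))"
proof (rule ends_loop_free)
  define s1 where "s1 = exec n lab (Load 25 3 22) (exec n lab (Load 24 1 22) s)"
  have "reg s 21 = v" "arr s 3 i = g i" "reg s 1 = 1" "reg s 39 = 0" "arr s 1 = W"
    using s i by (auto simp: inputs_def env_def)
  then have s1: "reg s1 1 = 1" "reg s1 39 = 0" "reg s1 21 = v" "reg s1 24 = W i" "reg s1 25 = g i"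
    "arr s1 = arr s"
    using i by (simp_all add: s1_def set_reg_def)
  have "exec n lab late_com s = (if v < W i then exec n lab upd_score_com s1 else s1)"
    using s1 by (simp add: late_com_def flip: s1_def[simplified])
  then show "\<forall>j<k. int (arr (exec n lab late_com s) 4 j) = f j + late_term n lab v j (g i) (W i)"
    using exec_upd_score[of s1, OF s1(1,2) g _ f(2) s1(3-5)] f(1) s1(6) by (auto simp: late_term_def)
qed (auto simp: late_com_def upd_score_com_def)

lemma ends_early_com:
  assumes s: "inputs g y v s" and i: "reg s 22 = i" "i < q" and y: "\<And>u. u < v \<Longrightarrow> y u < k"
    and f: "\<And>j. j < k \<Longrightarrow> int (arr s 4 j) = f j" "\<And>j. j < k \<Longrightarrow> f j \<ge> 1"
  shows "ends n lab early_com s 16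
    (\<lambda>s'. \<forall>j<k. int (arr s' 4 j) = f j + early_term n lab v j y (W ((v + 1) * q + i)))"
proof (rule ends_loop_free)
  define s1 where
    "s1 = exec n lab (Load 25 5 24) (exec n lab (Load 24 1 26) (exec n lab (Add 26 23 22) s))"
  define u where "u = W ((v + 1) * q + i)"
  have s0: "reg s 21 = v" "reg s 23 = (v + 1) * q" "reg s 1 = 1" "reg s 39 = 0" "arr s 1 = W"
    using s i by (auto simp: inputs_def env_def)
  then have s1: "reg s1 1 = 1" "reg s1 39 = 0" "reg s1 21 = v" "reg s1 24 = u" "reg s1 25 = arr s 5 u"
    "arr s1 = arr s"
    using i by (simp_all add: s1_def set_reg_def u_def)
  have y': "arr s 5 u = y u \<and> y u < k" if "u < v"
    using s y that by (auto simp: inputs_def)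
  have *: "exec n lab early_com s = (if u < v then exec n lab upd_score_com s1 else s1)"
    using s1 by (simp add: early_com_def flip: s1_def[simplified])
  have "\<forall>j<k. int (arr (exec n lab early_com s) 4 j) = f j + early_term n lab v j y u"
  proof (cases "u < v")
    case True
    then show ?thesis
      using exec_upd_score[of s1 "y u" f v u, OF s1(1,2) _ _ f(2) s1(3,4)] f(1) s1(5,6) y'[OF True] *
      by (simp add: early_term_def)
  qed (use * f s1(6) in \<open>simp add: early_term_def\<close>)
  then show "\<forall>j<k. int (arr (exec n lab early_com s) 4 j) =
      f j + early_term n lab v j y (W ((v + 1) * q + i))"
    by (simp only: u_def)
qed (auto simp: early_com_def upd_score_com_def)

lemma ends_scores_com:
  assumes s: "inputs g y v s" and g: "\<And>i. i < q \<Longrightarrow> g i < k" and y: "\<And>u. u < v \<Longrightarrow> y u < k"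
    and z: "\<forall>j<k. arr s 4 j = 2 * q"
  shows "ends n lab scores_com s (q * 36 + 3)
    (\<lambda>s'. \<forall>j<k. arr s' 4 j = nat (2 * int q + score n lab q W g y v q j))"
  unfolding scores_com_def
proof (rule ends_For[where I = "\<lambda>i s'. \<forall>j<k. int (arr s' 4 j) = 2 * int q + score n lab q W g y v i j"
      and tb = 32 and m = q])
  fix i s' assume i: "i < q" and I: "\<forall>j<k. int (arr s' 4 j) = 2 * int q + score n lab q W g y v i j"
    and r: "reg s' 22 = i"
    and fr: "frame (insert 22 (regs_of (Seq late_com early_com))) (arrs_of (Seq late_com early_com)) s s'"
  have inp: "inputs g y v s'"
    using s fr by (rule inputs_frame) (auto simp: regs_of_coms arrs_of_coms)
  have sc: "score n lab q W g y v i j \<ge> - 2 * int i" for j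
    using abs_score[of n lab q W g y v i j] by linarith
  have "1 \<le> 2 * int q + score n lab q W g y v i j" for j
    using sc[of j] i by linarith
  then have "ends n lab late_com s' 14 (\<lambda>s''. \<forall>j<k. int (arr s'' 4 j) =
      (2 * int q + score n lab q W g y v i j) + late_term n lab v j (g i) (W i))"
    using I by (intro ends_late_com[OF inp r i g[OF i]]) auto
  then have "ends n lab late_com s' 14 (\<lambda>s''. ends n lab early_com s'' 16
      (\<lambda>s'. \<forall>j<k. int (arr s' 4 j) = 2 * int q + score n lab q W g y v (Suc i) j))"
  proof (rule ends_weaken)
    fix s'' assume f: "\<forall>j<k. int (arr s'' 4 j) =
      (2 * int q + score n lab q W g y v i j) + late_term n lab v j (g i) (W i)"
      and fr: "frame (regs_of late_com) (arrs_of late_com) s' s''"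
    have inp: "inputs g y v s''"
      using inp fr by (rule inputs_frame) (auto simp: regs_of_coms arrs_of_coms)
    have r: "reg s'' 22 = i"
      using frame_reg[OF fr, of 22] r by (simp add: regs_of_coms)
    \<comment> \<open>By \<open>abs_score\<close> and \<open>i < q\<close> at least 2 is left before
      the late update, which removes at most 1, so the early update can still subtract.\<close>
    have ge: "(2 * int q + score n lab q W g y v i j) + late_term n lab v j (g i) (W i) \<ge> 1" for j
      using sc[of j] i by (auto simp: late_term_def sgn_edge_def)
    show "ends n lab early_com s'' 16
      (\<lambda>s'. \<forall>j<k. int (arr s' 4 j) = 2 * int q + score n lab q W g y v (Suc i) j)"
      by (rule ends_weaken[OF ends_early_com[OF inp r i y]]) (use f ge in \<open>auto simp: score_Suc\<close>)
  qed simp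
  then show "ends n lab (Seq late_com early_com) s' 32
      (\<lambda>s'. \<forall>j<k. int (arr s' 4 j) = 2 * int q + score n lab q W g y v (Suc i) j)"
    by (rule ends_Seq) simp
qed (use s z in \<open>auto simp: regs_of_coms inputs_def env_def score_def set_reg_def nat_eq_iff2\<close>)

lemma ends_clear_com:
  assumes "env s"
  shows "ends n lab clear_com s (k * 5 + 3) (\<lambda>s'. \<forall>j<k. arr s' 4 j = 2 * q)"
  unfolding clear_com_def
proof (rule ends_For[where I = "\<lambda>i s'. \<forall>j<i. arr s' 4 j = 2 * q" and tb = 1 and m = k])
  fix j s' assume I: "\<forall>i<j. arr s' 4 i = 2 * q" and r: "reg s' 22 = j"
    and fr: "frame (insert 22 (regs_of (Store 4 22 14))) (arrs_of (Store 4 22 14)) s s'"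
  have "reg s' 14 = 2 * q" using frame_reg[OF fr, of 14] assms by (simp add: env_def)
  then show "ends n lab (Store 4 22 14) s' 1 (\<lambda>s'. \<forall>i<Suc j. arr s' 4 i = 2 * q)"
    using I r by (intro ends_loop_free) (auto simp: set_arr_def less_Suc_eq)
qed (use assms in \<open>auto simp: env_def set_reg_def\<close>)

lemma ends_amax_com:
  assumes s: "env s"
  shows "ends n lab amax_com s (k * 11 + 10) (\<lambda>s'. reg s' 30 = fst (amax (arr s 4) k))"
  unfolding amax_com_def
proof (intro ends_Seq_loop_free)
  let ?c = "Seq (Load 28 4 22) (Cond (Less 29 28) (Seq (Move 29 28) (Move 30 22)) Skip)"
  let ?s = "exec n lab (Const 30 0) (exec n lab (Const 29 0) s)"
  show "ends n lab (For 22 13 ?c) ?s (k * 11 + 3) (\<lambda>s'. reg s' 30 = fst (amax (arr s 4) k))"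
  proof (rule ends_For[where I = "\<lambda>i s'. (reg s' 30, reg s' 29) = amax (arr s 4) i" and tb = 7 and m = k])
    fix j s' assume I: "(reg s' 30, reg s' 29) = amax (arr s 4) j" and r: "reg s' 22 = j"
      and fr: "frame (insert 22 (regs_of ?c)) (arrs_of ?c) ?s s'"
    have "arr s' 4 = arr s 4" using frame_arr[OF fr, of 4] by (simp add: set_reg_def)
    moreover have "reg s' 29 = snd (amax (arr s 4) j)" using I by (metis snd_conv)
    ultimately show "ends n lab ?c s' 7 (\<lambda>s'. (reg s' 30, reg s' 29) = amax (arr s 4) (Suc j))"
      using I r by (intro ends_loop_free) (auto simp: set_reg_def)
  next
    show "reg s' 30 = fst (amax (arr s 4) k)" if "(reg s' 30, reg s' 29) = amax (arr s 4) k" for s'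
      by (metis that fst_conv)
  qed (use s in \<open>auto simp: env_def set_reg_def\<close>)
qed auto

lemma greedy_less: "u < v \<Longrightarrow> greedy n lab k q W g v u < k"
  using k by (induction v) (auto simp: fst_amax_less less_Suc_eq)

lemma ends_place_com:
  assumes s: "inputs g (greedy n lab k q W g v) v s" and g: "\<And>i. i < q \<Longrightarrow> g i < k" and v: "v < n"
  shows "ends n lab place_com s (k * 16 + q * 36 + 30)
    (\<lambda>s'. env s' \<and> reg s' 23 = (Suc v + 1) * q \<and> (\<forall>u<Suc v. arr s' 5 u = greedy n lab k q W g (Suc v) u))"
proof -
  let ?y = "greedy n lab k q W g v"
  let ?f = "\<lambda>j. nat (2 * int q + score n lab q W g ?y v q j)"
  let ?Q = "\<lambda>s'. env s' \<and> reg s' 23 = (Suc v + 1) * q \<and>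
    (\<forall>u<Suc v. arr s' 5 u = greedy n lab k q W g (Suc v) u)"
  have 4: "ends n lab (Seq (Store 5 21 30) (Add 23 23 7)) s' 3 ?Q"
    if s': "inputs g ?y v s'" "reg s' 30 = fst (amax ?f k)" for s'
    using s' by (intro ends_loop_free)
      (auto simp: inputs_def env_def set_arr_def set_reg_def less_Suc_eq)
  have 3: "ends n lab (Seq amax_com (Seq (Store 5 21 30) (Add 23 23 7))) s' (k * 11 + 14) ?Q"
    if s': "inputs g ?y v s'" "\<forall>j<k. arr s' 4 j = ?f j" for s'
  proof (rule ends_Seq[OF ends_weaken[OF ends_amax_com order.refl]])
    show "env s'" using s' by (simp add: inputs_def)
    fix t assume t: "reg t 30 = fst (amax (arr s' 4) k)"
      and fr: "frame (regs_of amax_com) (arrs_of amax_com) s' t"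
    have "inputs g ?y v t"
      using s'(1) fr by (rule inputs_frame) (auto simp: regs_of_coms arrs_of_coms)
    moreover have "reg t 30 = fst (amax ?f k)"
      using t s'(2) amax_cong[of k "arr s' 4" ?f] by simp
    ultimately show "ends n lab (Seq (Store 5 21 30) (Add 23 23 7)) t 3 ?Q"
      by (rule 4)
  qed simp
  have 2: "ends n lab (Seq scores_com (Seq amax_com (Seq (Store 5 21 30) (Add 23 23 7)))) s'
      (q * 36 + k * 11 + 18) ?Q"
    if s': "inputs g ?y v s'" "\<forall>j<k. arr s' 4 j = 2 * q" for s'
  proof (rule ends_Seq[OF ends_weaken[OF ends_scores_com[OF s'(1) g _ s'(2)] order.refl]])
    fix t assume t: "\<forall>j<k. arr t 4 j = ?f j"
      and fr: "frame (regs_of scores_com) (arrs_of scores_com) s' t"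
    have "inputs g ?y v t"
      using s'(1) fr by (rule inputs_frame) (auto simp: regs_of_coms arrs_of_coms)
    then show "ends n lab (Seq amax_com (Seq (Store 5 21 30) (Add 23 23 7))) t (k * 11 + 14) ?Q"
      using t by (rule 3)
  qed (auto simp: greedy_less)
  show ?thesis unfolding place_com_def
  proof (rule ends_Seq[OF ends_weaken[OF ends_clear_com order.refl]])
    show "env s" using s by (simp add: inputs_def)
    fix t assume t: "\<forall>j<k. arr t 4 j = 2 * q"
      and fr: "frame (regs_of clear_com) (arrs_of clear_com) s t"
    have "inputs g ?y v t"
      using s fr by (rule inputs_frame) (auto simp: regs_of_coms arrs_of_coms)
    then show "ends n lab (Seq scores_com (Seq amax_com (Seq (Store 5 21 30) (Add 23 23 7)))) t
      (q * 36 + k * 11 + 18) ?Q"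
      using t by (rule 2)
  qed simp
qed

definition ready :: "(nat \<Rightarrow> nat) \<Rightarrow> memory \<Rightarrow> bool" where
  "ready g s \<longleftrightarrow> env s \<and> (\<forall>i<q. arr s 3 i = g i)"

lemma ready_frame:
  assumes "ready g s" "frame R A s s'" "R \<inter> {0, 1, 7, 9, 11, 13, 14, 15, 39} = {}" "A \<inter> {1, 2, 3} = {}"
  shows "ready g s'"
proof -
  have "env s'"
    using assms by (intro env_frame[of s R A s']) (auto simp: ready_def)
  moreover have "arr s' 3 = arr s 3"
    using assms(2,4) by (auto simp only: frame_def)
  ultimately show ?thesis
    using assms(1) by (simp add: ready_def)
qed

lemma ends_greedy_com:
  assumes s: "ready g s" and g: "\<And>i. i < q \<Longrightarrow> g i < k"
  shows "ends n lab greedy_com s (n * (k * 16 + q * 36 + 34) + 5)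
    (\<lambda>s'. \<forall>u<n. arr s' 5 u = greedy n lab k q W g n u)"
  unfolding greedy_com_def
proof (intro ends_Seq_loop_free)
  let ?s = "exec n lab (Move 23 7) s"
  have s0: "ready g ?s"
    using s by (simp add: ready_def env_def set_reg_def)
  show "ends n lab (For 21 0 place_com) ?s (n * (k * 16 + q * 36 + 34) + 3)
    (\<lambda>s'. \<forall>u<n. arr s' 5 u = greedy n lab k q W g n u)"
  proof (rule ends_For[where I = "\<lambda>v s'. reg s' 23 = (v + 1) * q \<and>
        (\<forall>u<v. arr s' 5 u = greedy n lab k q W g v u)" and tb = "k * 16 + q * 36 + 30" and m = n])
    fix v s' assume v: "v < n" and I: "reg s' 23 = (v + 1) * q \<and>
        (\<forall>u<v. arr s' 5 u = greedy n lab k q W g v u)" and r: "reg s' 21 = v"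
      and fr: "frame (insert 21 (regs_of place_com)) (arrs_of place_com) ?s s'"
    have "ready g s'"
      using s0 fr by (rule ready_frame) (auto simp: regs_of_coms arrs_of_coms)
    then have "inputs g (greedy n lab k q W g v) v s'"
      using I r by (simp add: inputs_def ready_def)
    from ends_place_com[OF this g v]
    show "ends n lab place_com s' (k * 16 + q * 36 + 30) (\<lambda>s'. reg s' 23 = (Suc v + 1) * q \<and>
        (\<forall>u<Suc v. arr s' 5 u = greedy n lab k q W g (Suc v) u))"
      by (rule ends_weaken) auto
  qed (use s0 s in \<open>auto simp: regs_of_coms ready_def env_def set_reg_def\<close>)
qed auto

text \<open>The contents of array 5 are only known below \<open>n\<close>; sampled vertices never
  leave this range.\<close>

lemma hits_cong: "(\<And>u. u < n \<Longrightarrow> y u = y' u) \<Longrightarrow> hits n lab E W W' y m = hits n lab E W W' y' m"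
  using W W' by (simp add: hits_def agree_def)

lemma ends_hits_com:
  assumes s: "ready g s"
  shows "ends n lab hits_com s (M * 30 + 5) (\<lambda>s'. reg s' 31 = hits n lab E W W' (arr s 5) M)"
  unfolding hits_com_def
proof (intro ends_Seq_loop_free)
  let ?s = "exec n lab (Const 31 0) s"
  show "ends n lab (For 22 9 hit_com) ?s (M * 30 + 3)
    (\<lambda>s'. reg s' 31 = hits n lab E W W' (arr s 5) M)"
  proof (rule ends_For[where I = "\<lambda>i s'. reg s' 31 = hits n lab E W W' (arr s 5) i"
        and tb = 26 and m = M])
    fix i s' assume i: "i < M" and I: "reg s' 31 = hits n lab E W W' (arr s 5) i"
      and r: "reg s' 22 = i"
      and fr: "frame (insert 22 (regs_of hit_com)) (arrs_of hit_com) ?s s'"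
    have "ready g ?s"
      using s by (simp add: ready_def env_def set_reg_def)
    then have "ready g s'"
      using fr by (rule ready_frame) (auto simp: regs_of_coms arrs_of_coms)
    define B where "B = E"
    have e: "reg s' 11 = B" "arr s' 1 = W" "arr s' 2 = W'" "reg s' 1 = 1"
      using \<open>ready g s'\<close> by (auto simp: ready_def env_def B_def)
    have a5: "arr s' 5 = arr s 5"
      using frame_arr[OF fr, of 5] by (simp add: arrs_of_coms set_reg_def)
    define u w where "u = W (B + i)" and "w = W' (B + i)"
    show "ends n lab hit_com s' 26 (\<lambda>s'. reg s' 31 = hits n lab E W W' (arr s 5) (Suc i))"
    proof (rule ends_loop_free)
      show "reg (exec n lab hit_com s') 31 = hits n lab E W W' (arr s 5) (Suc i)"
        using query_01[of u w] e I[folded B_def] r a5 unfolding B_def[symmetric]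
        by (auto simp: hit_com_def hits_def agree_def set_reg_def u_def[symmetric] w_def[symmetric])
    qed (auto simp: hit_com_def)
  qed (use s in \<open>auto simp: regs_of_coms ready_def env_def set_reg_def hits_def\<close>)
qed auto

lemma ends_save_com:
  assumes s: "ready g s"
  shows "ends n lab save_com s (n * 7 + 8) (\<lambda>s'. (if reg s 31 < reg s 32
     then reg s' 32 = reg s 32 \<and> arr s' 0 = arr s 0
     else reg s' 32 = reg s 31 \<and> (\<forall>u<n. arr s' 0 u = arr s 5 u)))"
  unfolding save_com_def
proof (rule ends_Cond[of n lab])
  let ?Q = "\<lambda>s'. (if reg s 31 < reg s 32 then reg s' 32 = reg s 32 \<and> arr s' 0 = arr s 0
     else reg s' 32 = reg s 31 \<and> (\<forall>u<n. arr s' 0 u = arr s 5 u))"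
  let ?c = "Seq (Load 28 5 22) (Store 0 22 28)"
  let ?s = "exec n lab (Move 32 31) s"
  have "ends n lab (Seq (Move 32 31) (For 22 0 ?c)) s (n * 7 + 7) ?Q" if ge: "\<not> reg s 31 < reg s 32"
  proof (intro ends_Seq_loop_free)
    show "ends n lab (For 22 0 ?c) ?s (n * 7 + 3) ?Q"
    proof (rule ends_For[where I = "\<lambda>i s'. \<forall>u<i. arr s' 0 u = arr s 5 u" and tb = 3 and m = n])
      fix i s' assume "i < n" "\<forall>u<i. arr s' 0 u = arr s 5 u" "reg s' 22 = i"
        and fr: "frame (insert 22 (regs_of ?c)) (arrs_of ?c) ?s s'"
      moreover have "arr s' 5 = arr s 5"
        using frame_arr[OF fr, of 5] by (simp add: set_reg_def)
      ultimately show "ends n lab ?c s' 3 (\<lambda>s'. \<forall>u<Suc i. arr s' 0 u = arr s 5 u)"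
        by (intro ends_loop_free) (auto simp: set_reg_def set_arr_def less_Suc_eq)
    next
      fix s' assume "\<forall>u<n. arr s' 0 u = arr s 5 u"
        and fr: "frame (insert 22 (regs_of ?c)) (arrs_of ?c) ?s s'"
      then show "?Q s'" using frame_reg[OF fr, of 32] ge by (simp add: set_reg_def)
    qed (use s in \<open>auto simp: ready_def env_def set_reg_def\<close>)
  qed auto
  moreover have "ends n lab Skip s (n * 7 + 7) ?Q" if "reg s 31 < reg s 32"
    using that by (intro ends_loop_free) auto
  ultimately show "ends n lab (if test_val (Less 31 32) s then Skip
      else Seq (Move 32 31) (For 22 0 ?c)) s (n * 7 + 7) ?Q"
    by simp
qed simp

section \<open>Counting through the guesses in base \<open>k\<close>\<close>

lemma digits_less: "digits k j i < k"
  using k by (simp add: digits_def)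

lemma Suc_div_power:
  "Suc j div k ^ i = (if k ^ i dvd Suc j then Suc (j div k ^ i) else j div k ^ i)"
  by (simp add: div_Suc dvd_eq_mod_eq_0)

text \<open>\<open>k ^ i dvd Suc j\<close> says that incrementing \<open>j\<close> carries into
  position \<open>i\<close>, all lower digits of \<open>j\<close> being \<open>k - 1\<close>. The
  carry moves on exactly if digit \<open>i\<close> is maximal too.\<close>

lemma dvd_Suc_power:
  "k ^ Suc i dvd Suc j \<longleftrightarrow> k ^ i dvd Suc j \<and> Suc (digits k j i) = k"
proof (cases "k ^ i dvd Suc j")
  case True
  then obtain c where c: "Suc j = k ^ i * c" by blast
  have "c > 0" using c by (cases c) auto
  have "Suc (j div k ^ i) = c"
    using Suc_div_power[of j i] True c k by simp
  moreover have "k ^ Suc i dvd Suc j \<longleftrightarrow> k dvd c"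
    using c k by (simp add: mult.commute)
  moreover have "k dvd Suc m \<longleftrightarrow> Suc (m mod k) = k" for m
    using k by (auto simp: dvd_eq_mod_eq_0 mod_Suc)
  ultimately show ?thesis using True by (metis digits_def)
next
  case False
  then show ?thesis by (meson dvd_mult_right dvd_trans le_imp_power_dvd lessI less_imp_le)
qed

lemma digits_Suc:
  "digits k (Suc j) i =
     (if k ^ i dvd Suc j then if Suc (digits k j i) < k then Suc (digits k j i) else 0 else digits k j i)"
  using digits_less[of j i]
  by (auto simp: digits_def Suc_div_power mod_Suc)

lemma ends_incr_com:
  assumes s: "ready (digits k j) s"
  shows "ends n lab incr_com s (q * 14 + 5) (ready (digits k (Suc j)))"
  unfolding incr_com_def
proof (intro ends_Seq_loop_free)
  let ?s = "exec n lab (Const 33 1) s"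
  have e: "env ?s"
    using s by (simp add: ready_def env_def set_reg_def)
  show "ends n lab (For 22 7 carry_com) ?s (q * 14 + 3) (ready (digits k (Suc j)))"
  proof (rule ends_For[where I = "\<lambda>i s'. reg s' 33 = (if k ^ i dvd Suc j then 1 else 0) \<and>
        (\<forall>h<i. arr s' 3 h = digits k (Suc j) h) \<and> (\<forall>h. i \<le> h \<and> h < q \<longrightarrow> arr s' 3 h = digits k j h)"
        and tb = 10 and m = q])
    fix i s' assume i: "i < q" and I: "reg s' 33 = (if k ^ i dvd Suc j then 1 else 0) \<and>
        (\<forall>h<i. arr s' 3 h = digits k (Suc j) h) \<and> (\<forall>h. i \<le> h \<and> h < q \<longrightarrow> arr s' 3 h = digits k j h)"
      and r: "reg s' 22 = i"
      and fr: "frame (insert 22 (regs_of carry_com)) (arrs_of carry_com) ?s s'"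
    have "env s'"
      using e fr by (rule env_frame) (auto simp: regs_of_coms arrs_of_coms)
    then have r13: "reg s' 13 = k" "arr s' 3 i = digits k j i"
      using I i by (auto simp: env_def)
    define d where "d = digits k j i"
    show "ends n lab carry_com s' 10 (\<lambda>s'. reg s' 33 = (if k ^ Suc i dvd Suc j then 1 else 0) \<and>
        (\<forall>h<Suc i. arr s' 3 h = digits k (Suc j) h) \<and>
        (\<forall>h. Suc i \<le> h \<and> h < q \<longrightarrow> arr s' 3 h = digits k j h))"
    proof (rule ends_loop_free)
      have "exec n lab carry_com s' = set_arr 3 i (digits k (Suc j) i)
          (set_reg 33 (if k ^ Suc i dvd Suc j then 1 else 0) (set_reg 28 (digits k (Suc j) i) s'))"
        using I r r13 digits_less[of j i] unfolding dvd_Suc_power digits_Suc[of j i] d_def[symmetric]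
        by (auto simp: carry_com_def set_reg_def set_arr_def fun_eq_iff)
      then show "reg (exec n lab carry_com s') 33 = (if k ^ Suc i dvd Suc j then 1 else 0) \<and>
        (\<forall>h<Suc i. arr (exec n lab carry_com s') 3 h = digits k (Suc j) h) \<and>
        (\<forall>h. Suc i \<le> h \<and> h < q \<longrightarrow> arr (exec n lab carry_com s') 3 h = digits k j h)"
        using I by (simp add: set_reg_def set_arr_def less_Suc_eq)
    qed (auto simp: carry_com_def)
  next
    fix s' assume "reg s' 33 = (if k ^ q dvd Suc j then 1 else 0) \<and>
        (\<forall>h<q. arr s' 3 h = digits k (Suc j) h) \<and> (\<forall>h. q \<le> h \<and> h < q \<longrightarrow> arr s' 3 h = digits k j h)"
      and fr: "frame (insert 22 (regs_of carry_com)) (arrs_of carry_com) ?s s'"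
    moreover have "env s'"
      using e fr by (rule env_frame) (auto simp: regs_of_coms arrs_of_coms)
    ultimately show "ready (digits k (Suc j)) s'"
      by (simp add: ready_def)
  qed (use s in \<open>auto simp: regs_of_coms ready_def env_def set_reg_def\<close>)
qed auto

section \<open>The best guess so far\<close>

abbreviation "lbl j \<equiv> greedy n lab k q W (digits k j) n"
abbreviation "hit_count j \<equiv> hits n lab E W W' (lbl j) M"

text \<open>Before the first guess only the record 0 is known. The existential \<open>h\<close>
  hides how ties are resolved.\<close>

definition best_until :: "nat \<Rightarrow> memory \<Rightarrow> bool" where
  "best_until j s \<longleftrightarrow> (if j = 0 then reg s 32 = 0 else
     \<exists>h<j. (\<forall>u<n. arr s 0 u = lbl h u) \<and> reg s 32 = hit_count h \<and> (\<forall>i<j. hit_count i \<le> hit_count h))"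

lemma ends_guess_com:
  assumes s: "ready (digits k j) s" "best_until j s"
  shows "ends n lab guess_com s (n * (k * 16 + q * 36 + 41) + M * 30 + q * 14 + 26)
     (\<lambda>s'. ready (digits k (Suc j)) s' \<and> best_until (Suc j) s')"
proof -
  let ?g = "digits k j"
  let ?Q = "\<lambda>s'. ready (digits k (Suc j)) s' \<and> best_until (Suc j) s'"
  have 4: "ends n lab incr_com s' (q * 14 + 5) ?Q"
    if s': "ready ?g s'" "best_until (Suc j) s'" for s'
    using ends_incr_com[OF s'(1)]
  proof (rule ends_weaken)
    fix t assume "ready (digits k (Suc j)) t" "frame (regs_of incr_com) (arrs_of incr_com) s' t"
    then show "?Q t"
      using s'(2) frame_reg[of _ _ s' t 32] frame_arr[of _ _ s' t 0]
      by (auto simp: best_until_def regs_of_coms arrs_of_coms)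
  qed simp
  have 3: "ends n lab (Seq save_com incr_com) s' (n * 7 + q * 14 + 14) ?Q"
    if s': "ready ?g s'" "best_until j s'" "\<forall>u<n. arr s' 5 u = lbl j u" "reg s' 31 = hit_count j" for s'
  proof (rule ends_Seq[OF ends_weaken[OF ends_save_com[OF s'(1)] order.refl]])
    fix t
    assume t: "if reg s' 31 < reg s' 32 then reg t 32 = reg s' 32 \<and> arr t 0 = arr s' 0
       else reg t 32 = reg s' 31 \<and> (\<forall>u<n. arr t 0 u = arr s' 5 u)"
      and fr: "frame (regs_of save_com) (arrs_of save_com) s' t"
    have "ready ?g t"
      using s'(1) fr by (rule ready_frame) (auto simp: regs_of_coms arrs_of_coms)
    moreover have "best_until (Suc j) t"
    proof (cases "reg s' 31 < reg s' 32")
      case True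
      \<comment> \<open>Something lies below the record, so the record is positive and some guess
        has been saved.\<close>
      then have "j \<noteq> 0" using s'(2) by (cases "j = 0") (auto simp: best_until_def)
      then obtain h where "h < j" "\<forall>u<n. arr s' 0 u = lbl h u" "reg s' 32 = hit_count h"
        "\<forall>i<j. hit_count i \<le> hit_count h"
        using s'(2) by (auto simp: best_until_def)
      then show ?thesis
        using True t s'(4) unfolding best_until_def by (auto simp: less_Suc_eq intro!: exI[of _ h])
    next
      case False
      have "hit_count i \<le> hit_count j" if "i < j" for i
        using s'(2) that False s'(4) by (fastforce simp: best_until_def)
      then show ?thesis
        using False t s'(3,4) unfolding best_until_def by (auto simp: less_Suc_eq intro!: exI[of _ j])
    qed
    ultimately show "ends n lab incr_com t (q * 14 + 5) ?Q"
      by (rule 4)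
  qed simp
  have 2: "ends n lab (Seq hits_com (Seq save_com incr_com)) s' (n * 7 + M * 30 + q * 14 + 20) ?Q"
    if s': "ready ?g s'" "best_until j s'" "\<forall>u<n. arr s' 5 u = lbl j u" for s'
  proof (rule ends_Seq[OF ends_weaken[OF ends_hits_com[OF s'(1)] order.refl]])
    fix t assume t: "reg t 31 = hits n lab E W W' (arr s' 5) M"
      and fr: "frame (regs_of hits_com) (arrs_of hits_com) s' t"
    have "ready ?g t"
      using s'(1) fr by (rule ready_frame) (auto simp: regs_of_coms arrs_of_coms)
    moreover have "best_until j t" "\<forall>u<n. arr t 5 u = lbl j u"
      using s'(2,3) frame_reg[OF fr, of 32] frame_arr[OF fr, of 0] frame_arr[OF fr, of 5]
      by (auto simp: best_until_def regs_of_coms arrs_of_coms)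
    moreover have "reg t 31 = hit_count j"
      using t hits_cong[of "arr s' 5" "lbl j"] s'(3) by simp
    ultimately show "ends n lab (Seq save_com incr_com) t (n * 7 + q * 14 + 14) ?Q"
      by (rule 3)
  qed simp
  show ?thesis unfolding guess_com_def
  proof (rule ends_Seq[OF ends_weaken[OF ends_greedy_com[OF s(1) digits_less] order.refl]])
    fix t assume t: "\<forall>u<n. arr t 5 u = lbl j u"
      and fr: "frame (regs_of greedy_com) (arrs_of greedy_com) s t"
    have "ready ?g t"
      using s(1) fr by (rule ready_frame) (auto simp: regs_of_coms arrs_of_coms)
    moreover have "best_until j t"
      using s(2) frame_reg[OF fr, of 32] frame_arr[OF fr, of 0]
      by (auto simp: best_until_def regs_of_coms arrs_of_coms)
    ultimately show "ends n lab (Seq hits_com (Seq save_com incr_com)) t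
        (n * 7 + M * 30 + q * 14 + 20) ?Q"
      using t by (intro 2)
  qed (simp add: algebra_simps)
qed

lemma ends_search_com:
  assumes s: "env s" "arr s 3 = (\<lambda>_. 0)"
  shows "ends n lab search_com s (k ^ q * (n * (k * 16 + q * 36 + 41) + M * 30 + q * 14 + 30) + 5)
    (best_until (k ^ q))"
  unfolding search_com_def
proof (intro ends_Seq_loop_free)
  let ?s = "exec n lab (Const 32 0) s"
  let ?t = "n * (k * 16 + q * 36 + 41) + M * 30 + q * 14 + 26"
  \<comment> \<open>The initially zero array 3 is the digit sequence of guess 0.\<close>
  have e: "ready (digits k 0) ?s"
    using s by (simp add: ready_def env_def set_reg_def digits_def)
  have "ends n lab (For 20 15 guess_com) ?s (k ^ q * (?t + 4) + 3) (best_until (k ^ q))"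
  proof (rule ends_For[where I = "\<lambda>j s'. ready (digits k j) s' \<and> best_until j s'" and tb = ?t
        and m = "k ^ q"])
    fix j s' assume "ready (digits k j) s' \<and> best_until j s'"
    then show "ends n lab guess_com s' ?t (\<lambda>s'. ready (digits k (Suc j)) s' \<and> best_until (Suc j) s')"
      by (intro ends_guess_com) auto
  next
    fix j s' x assume "ready (digits k j) s' \<and> best_until j s'"
    then show "ready (digits k j) (set_reg 20 x s') \<and> best_until j (set_reg 20 x s')"
      by (auto simp: ready_def env_def best_until_def set_reg_def)
  qed (use e in \<open>auto simp: regs_of_coms ready_def env_def best_until_def set_reg_def\<close>)
  then show "ends n lab (For 20 15 guess_com) ?s
      (k ^ q * (n * (k * 16 + q * 36 + 41) + M * 30 + q * 14 + 30) + 3) (best_until (k ^ q))"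
    by (simp add: add.assoc)
qed auto

end

section \<open>Choice of the parameters and random sampling\<close>

definition pends :: "nat \<Rightarrow> labeling \<Rightarrow> com \<Rightarrow> memory \<Rightarrow> nat \<Rightarrow> real \<Rightarrow> (memory \<Rightarrow> bool) \<Rightarrow> bool" where
  "pends n lab c s t p Q \<longleftrightarrow> (\<exists>D. runs n lab c s t D \<and> measure_pmf.prob D {s. Q s} \<ge> p)"

lemma prob_bind_ge:
  assumes "\<And>x. x \<in> set_pmf D \<Longrightarrow> measure_pmf.prob (K x) A \<ge> f x" "\<And>x. f x \<ge> 0"
  shows "ennreal (measure_pmf.prob (bind_pmf D K) A) \<ge> (\<integral>\<^sup>+x. ennreal (f x) \<partial>measure_pmf D)"
proof -
  have "ennreal (measure_pmf.prob (bind_pmf D K) A) = emeasure (measure_pmf (bind_pmf D K)) A"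
    by (simp add: measure_pmf.emeasure_eq_measure ennreal_indicator)
  also have "\<dots> = (\<integral>\<^sup>+x. emeasure (measure_pmf (K x)) A \<partial>measure_pmf D)"
    by (rule emeasure_bind_pmf)
  also have "\<dots> \<ge> (\<integral>\<^sup>+x. ennreal (f x) \<partial>measure_pmf D)"
    using assms by (intro nn_integral_mono_AE AE_pmfI)
      (auto simp: measure_pmf.emeasure_eq_measure intro!: ennreal_leI)
  finally show ?thesis .
qed

text \<open>For the phases before the drawing of the samples, which succeed with certainty;
  \<open>pends_Seq_runs\<close> treats the drawing together with the search after it.\<close>

lemma pends_Seq_ends:
  assumes "ends n lab c1 s t1 (\<lambda>s'. pends n lab c2 s' t2 p Q)"
  shows "pends n lab (Seq c1 c2) s (t1 + 1 + t2) p Q"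
proof -
  obtain D1 where D1: "runs n lab c1 s t1 D1" "\<forall>s'\<in>set_pmf D1. pends n lab c2 s' t2 p Q"
    using assms by (auto simp: ends_def)
  then obtain D2 where D2: "\<And>s'. s' \<in> set_pmf D1 \<Longrightarrow>
      runs n lab c2 s' t2 (D2 s') \<and> measure_pmf.prob (D2 s') {s. Q s} \<ge> p"
    unfolding pends_def by metis
  \<comment> \<open>\<open>p\<close> will be \<open>1 - \<delta>\<close> with \<delta> possibly
    above 1, so its non-negative part is what enters the integral.\<close>
  have "(\<integral>\<^sup>+x. ennreal (max 0 p) \<partial>measure_pmf D1) \<le> ennreal (measure_pmf.prob (bind_pmf D1 D2) {s. Q s})"
    using D2 by (intro prob_bind_ge) (auto simp: max_def)
  then have "max 0 p \<le> measure_pmf.prob (bind_pmf D1 D2) {s. Q s}"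
    by (simp add: measure_pmf.emeasure_space_1)
  moreover have "runs n lab (Seq c1 c2) s (t1 + 1 + t2) (bind_pmf D1 D2)"
    using D1 D2 by (intro runs_Seq) auto
  ultimately show ?thesis by (auto simp: pends_def)
qed

lemma pends_Seq_runs:
  assumes "runs n lab c1 s t1 D1" "measure_pmf.prob D1 {s'. G s'} \<ge> p"
    "\<And>s'. s' \<in> set_pmf D1 \<Longrightarrow> ends n lab c2 s' t2 (\<lambda>s''. G s' \<longrightarrow> Q s'')"
  shows "pends n lab (Seq c1 c2) s (t1 + 1 + t2) p Q"
proof -
  obtain D2 where D2: "\<And>s'. s' \<in> set_pmf D1 \<Longrightarrow>
      runs n lab c2 s' t2 (D2 s') \<and> (\<forall>s''\<in>set_pmf (D2 s'). G s' \<longrightarrow> Q s'')"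
    using assms(3) unfolding ends_def by metis
  have "(\<integral>\<^sup>+x. ennreal (indicator {s'. G s'} x) \<partial>measure_pmf D1) \<le>
      ennreal (measure_pmf.prob (bind_pmf D1 D2) {s. Q s})"
  proof (rule prob_bind_ge)
    fix x assume x: "x \<in> set_pmf D1"
    have "measure_pmf.prob (D2 x) {s. Q s} = 1" if "G x"
      using D2[OF x] that by (subst measure_pmf.prob_eq_1) (auto simp: AE_measure_pmf_iff)
    then show "indicator {s'. G s'} x \<le> measure_pmf.prob (D2 x) {s. Q s}"
      by (auto simp: indicator_def)
  qed auto
  then have "measure_pmf.prob D1 {s'. G s'} \<le> measure_pmf.prob (bind_pmf D1 D2) {s. Q s}"
    by (simp add: measure_pmf.emeasure_eq_measure ennreal_indicator)
  moreover have "runs n lab (Seq c1 c2) s (t1 + 1 + t2) (bind_pmf D1 D2)"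
    using assms(1) D2 by (intro runs_Seq) auto
  ultimately show ?thesis using assms(2) by (fastforce simp: pends_def)
qed

section \<open>Computing the parameters with additions only\<close>

definition Mul :: "nat \<Rightarrow> nat \<Rightarrow> nat \<Rightarrow> com" where
  "Mul x y z = Seq (Const x 0) (For 16 y (Add x x z))"

lemma regs_of_Mul [simp]: "regs_of (Mul x y z) = {x, 16}" and arrs_of_Mul [simp]: "arrs_of (Mul x y z) = {}"
  by (auto simp: Mul_def)

text \<open>The time is linear in the first factor. Hence \<open>dims_com\<close> multiplies the
  growing power of \<open>k\<close> in \<open>k\<close> rounds, not in as many as the power
  itself.\<close>

lemma ends_Mul:
  assumes "reg s 1 = 1" "x \<notin> {1, 16, y, z}" "16 \<notin> {y, z}" "reg s y * 5 + 5 \<le> t"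
    and Q: "\<And>s'. reg s' x = reg s y * reg s z \<Longrightarrow> frame {x, 16} {} s s' \<Longrightarrow> Q s'"
  shows "ends n lab (Mul x y z) s t Q"
  unfolding Mul_def
proof (rule ends_Seq_loop_free)
  let ?s = "exec n lab (Const x 0) s"
  show "ends n lab (For 16 y (Add x x z)) ?s (reg s y * 5 + 3) Q"
  proof (rule ends_For[where I = "\<lambda>i s'. reg s' x = i * reg s z" and tb = 1 and m = "reg s y"])
    fix i s' assume "reg s' x = i * reg s z"
      and fr: "frame (insert 16 (regs_of (Add x x z))) (arrs_of (Add x x z)) ?s s'"
    moreover have "reg s' z = reg s z"
      using frame_reg[OF fr, of z] assms by (auto simp: set_reg_def)
    ultimately show "ends n lab (Add x x z) s' 1 (\<lambda>s'. reg s' x = Suc i * reg s z)"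
      by (intro ends_loop_free) (auto simp: set_reg_def)
  next
    fix s' assume "reg s' x = reg s y * reg s z"
      and fr: "frame (insert 16 (regs_of (Add x x z))) (arrs_of (Add x x z)) ?s s'"
    moreover have "frame {x, 16} {} s s'"
      using fr by (auto simp: frame_def set_reg_def)
    ultimately show "Q s'" using Q by blast
  qed (use assms in \<open>auto simp: set_reg_def\<close>)
qed (use assms in auto)

text \<open>Counting replaces division and logarithm: multiples of \<epsilon> until they reach 1,
  then doublings of \<delta> until they reach \<open>80 * k * a\<close>, a number accumulated along
  with the multiples.\<close>

definition "prec_com k = Seq (Const 1 1) (Seq (Const 2 2) (Seq (RAdd 2 0 0) (Seq (RConst 3 1)
  (Seq (RConst 5 (80 * k)) (Seq (RAdd 4 5 5)
  (Seq (While (RLess 2 3) (Seq (Add 2 2 1) (Seq (RAdd 2 2 0) (RAdd 4 4 5))))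
  (Seq (Const 3 0) (While (RLess 1 4) (Seq (RAdd 1 1 1) (Add 3 3 1))))))))))"

text \<open>Register 12 gets the number of all sample indices. The factor 800 comes from Hoeffding's
  inequality with error \<open>1 / (20 * a)\<close>, the factor \<open>k + 3\<close> from the union
  bound over the guesses; see \<open>prob_good\<close>.\<close>

definition "dims_com k = Seq (Mul 4 2 2) (Seq (Mul 5 4 3) (Seq (Const 6 800) (Seq (Mul 7 6 5)
  (Seq (Mul 8 7 7) (Seq (Const 6 (k + 3)) (Seq (Mul 9 6 8)
  (Seq (Add 10 0 1) (Seq (Mul 11 10 7) (Seq (Add 12 11 9) (Seq (Const 13 k) (Seq (Add 14 7 7)
  (Seq (Const 15 1) (For 17 7 (Seq (Mul 18 13 15) (Move 15 18)))))))))))))))"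

definition "draw_body =
  Seq (Uniform 24 0) (Seq (Store 1 22 24) (Seq (Uniform 24 0) (Store 2 22 24)))"

definition "draw_com = For 22 12 draw_body"

definition "program k = Seq (prec_com k) (Seq (dims_com k) (Seq draw_com search_com))"

text \<open>\<open>a\<close> plays the role of \<open>1 / \<epsilon>\<close>, and \<open>L\<close> that of the logarithm of \<open>80 * k * a / \<delta>\<close>.\<close>

definition precision :: "nat \<Rightarrow> real \<Rightarrow> real \<Rightarrow> nat \<Rightarrow> nat \<Rightarrow> bool" where
  "precision k \<epsilon> \<delta> a L \<longleftrightarrow> 2 \<le> a \<and> 1 \<le> real a * \<epsilon> \<and> (\<forall>i<a. 2 \<le> i \<longrightarrow> real i * \<epsilon> < 1) \<and>
     80 * real k * real a \<le> 2 ^ L * \<delta> \<and> (\<forall>l<L. 2 ^ l * \<delta> < 80 * real k * real a)"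

definition scaling :: "nat \<Rightarrow> nat \<Rightarrow> real \<Rightarrow> real \<Rightarrow> nat \<Rightarrow> memory \<Rightarrow> bool" where
  "scaling n k \<epsilon> \<delta> i s \<longleftrightarrow> reg s 0 = n \<and> reg s 1 = 1 \<and> reg s 2 = i + 2 \<and> reg s 39 = 0 \<and>
     arr s = (\<lambda>_ _. 0) \<and> rreg s 0 = \<epsilon> \<and> rreg s 1 = \<delta> \<and> rreg s 2 = real (i + 2) * \<epsilon> \<and> rreg s 3 = 1 \<and>
     rreg s 5 = real (80 * k) \<and> rreg s 4 = real (80 * k) * real (i + 2)"

definition doubling :: "nat \<Rightarrow> nat \<Rightarrow> real \<Rightarrow> nat \<Rightarrow> nat \<Rightarrow> memory \<Rightarrow> bool" where
  "doubling n k \<delta> a l s \<longleftrightarrow> reg s 0 = n \<and> reg s 1 = 1 \<and> reg s 2 = a \<and> reg s 3 = l \<and> reg s 39 = 0 \<and>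
     arr s = (\<lambda>_ _. 0) \<and> rreg s 1 = 2 ^ l * \<delta> \<and> rreg s 4 = real (80 * k) * real a"

text \<open>Minimality of \<open>L\<close> in \<open>precision\<close> keeps the test true in every
  earlier round, so the count stops exactly at \<open>L\<close>. The same minimality later bounds
  \<open>L\<close> from above in \<open>precision_bounds\<close>.\<close>

lemma ends_doubling:
  assumes prec: "precision k \<epsilon> \<delta> a L" and s: "scaling n k \<epsilon> \<delta> (a - 2) s"
  shows "ends n lab (Seq (Const 3 0) (While (RLess 1 4) (Seq (RAdd 1 1 1) (Add 3 3 1)))) s
      (L * 5 + 3) (doubling n k \<delta> a L)"
proof (rule ends_Seq_loop_free)
  have "2 \<le> a" using prec unfolding precision_def by blast
  then have a: "a - 2 + 2 = a" by (rule le_add_diff_inverse2)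
  show "ends n lab (While (RLess 1 4) (Seq (RAdd 1 1 1) (Add 3 3 1))) (exec n lab (Const 3 0) s)
    (L * 5 + 1) (doubling n k \<delta> a L)"
  proof (rule ends_While[where tb = 3])
    show "doubling n k \<delta> a 0 (exec n lab (Const 3 0) s)"
      using s unfolding scaling_def doubling_def a by (simp add: set_reg_def)
    fix l s' assume l: "l < L" and J: "doubling n k \<delta> a l s'"
    have "2 ^ l * \<delta> < 80 * real k * real a"
      using prec l unfolding precision_def by blast
    then have "test_val (RLess 1 4) s'"
      using J by (simp add: doubling_def)
    moreover have "ends n lab (Seq (RAdd 1 1 1) (Add 3 3 1)) s' 3 (doubling n k \<delta> a (Suc l))"
      using J by (intro ends_loop_free) (auto simp: doubling_def set_reg_def set_rreg_def)
    ultimately show "test_val (RLess 1 4) s' \<and>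
        ends n lab (Seq (RAdd 1 1 1) (Add 3 3 1)) s' 3 (doubling n k \<delta> a (Suc l))"
      by blast
  next
    fix s' assume J: "doubling n k \<delta> a L s'"
    have "80 * real k * real a \<le> 2 ^ L * \<delta>"
      using prec unfolding precision_def by blast
    then show "\<not> test_val (RLess 1 4) s'"
      using J by (simp add: doubling_def)
  qed simp
qed auto

lemma ends_scaling:
  assumes prec: "precision k \<epsilon> \<delta> a L" and s: "scaling n k \<epsilon> \<delta> 0 s"
  shows "ends n lab (While (RLess 2 3) (Seq (Add 2 2 1) (Seq (RAdd 2 2 0) (RAdd 4 4 5)))) s
      (a * 7 + 1) (scaling n k \<epsilon> \<delta> (a - 2))"
proof (rule ends_While[where tb = 5])
  have "2 \<le> a" using prec unfolding precision_def by blast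
  then have a: "a - 2 + 2 = a" by (rule le_add_diff_inverse2)
  {
    fix i s' assume i: "i < a - 2" and I: "scaling n k \<epsilon> \<delta> i s'"
    then have "i + 2 < a" by simp
    then have "real (i + 2) * \<epsilon> < 1"
      using prec unfolding precision_def by (metis le_add2)
    then have "test_val (RLess 2 3) s'"
      using I unfolding scaling_def by simp
    moreover have "ends n lab (Seq (Add 2 2 1) (Seq (RAdd 2 2 0) (RAdd 4 4 5))) s' 5
        (scaling n k \<epsilon> \<delta> (Suc i))"
      using I by (intro ends_loop_free)
        (auto simp: scaling_def set_reg_def set_rreg_def algebra_simps)
    ultimately show "test_val (RLess 2 3) s' \<and>
        ends n lab (Seq (Add 2 2 1) (Seq (RAdd 2 2 0) (RAdd 4 4 5))) s' 5 (scaling n k \<epsilon> \<delta> (Suc i))"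
      by blast
  }
  fix s' assume I: "scaling n k \<epsilon> \<delta> (a - 2) s'"
  have "real a * \<epsilon> \<ge> 1"
    using prec unfolding precision_def by blast
  then show "\<not> test_val (RLess 2 3) s'"
    using I unfolding scaling_def a by simp
qed (use s in auto)

lemma ends_prec_com:
  assumes prec: "precision k \<epsilon> \<delta> a L" and t: "t \<ge> a * 10 + L * 10 + 20"
  shows "ends n lab (prec_com k) (init_memory n \<epsilon> \<delta>) t (doubling n k \<delta> a L)"
  unfolding prec_com_def
  apply (rule ends_mono[OF _ t])
  apply (rule ends_Seq_loop_free[where ?t2.0 = "a * 10 + L * 10 + 18"], simp)
   apply (rule ends_Seq_loop_free[where ?t2.0 = "a * 10 + L * 10 + 16"], simp)
    apply (rule ends_Seq_loop_free[where ?t2.0 = "a * 10 + L * 10 + 14"], simp)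
     apply (rule ends_Seq_loop_free[where ?t2.0 = "a * 10 + L * 10 + 12"], simp)
      apply (rule ends_Seq_loop_free[where ?t2.0 = "a * 10 + L * 10 + 10"], simp)
       apply (rule ends_Seq_loop_free[where ?t2.0 = "a * 10 + L * 10 + 8"], simp)
        apply (rule ends_Seq[OF ends_weaken[OF ends_scaling[OF prec] order.refl]])
          apply (simp add: scaling_def init_memory_def set_reg_def set_rreg_def)
         apply (erule ends_doubling[OF prec])
  by auto

definition ready_to_draw :: "nat \<Rightarrow> nat \<Rightarrow> nat \<Rightarrow> nat \<Rightarrow> memory \<Rightarrow> bool" where
  "ready_to_draw n k q M s \<longleftrightarrow> reg s 0 = n \<and> reg s 1 = 1 \<and> reg s 7 = q \<and> reg s 9 = M \<and>
     reg s 11 = (n + 1) * q \<and> reg s 12 = (n + 1) * q + M \<and> reg s 13 = k \<and> reg s 14 = 2 * q \<and>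
     reg s 15 = k ^ q \<and> reg s 39 = 0 \<and> arr s = (\<lambda>_ _. 0)"

lemma frame_arr_empty: "frame R {} s s' \<Longrightarrow> arr s' = arr s"
  by (auto simp: frame_def)

lemma ends_dims_com:
  assumes s: "reg s 0 = n" "reg s 1 = 1" "reg s 2 = a" "reg s 3 = L" "reg s 39 = 0" "arr s = (\<lambda>_ _. 0)"
    and q: "q = 800 * (a * a * L)" and M: "M = (k + 3) * (q * q)"
    and t: "t \<ge> 5 * (a + a * a + q + k + n) + q * (k * 5 + 11) + 6000"
  shows "ends n lab (dims_com k) s t (ready_to_draw n k q M)"
proof -
  let ?c = "Seq (Mul 18 13 15) (Move 15 18)"
  have loop: "ends n lab (For 17 7 ?c) s (q * (k * 5 + 11) + 3) (ready_to_draw n k q M)"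
    if s: "reg s 15 = 1" "reg s 0 = n" "reg s 1 = 1" "reg s 7 = q" "reg s 9 = M"
     "reg s 11 = (n + 1) * q" "reg s 12 = (n + 1) * q + M" "reg s 13 = k" "reg s 14 = 2 * q"
     "reg s 39 = 0" "arr s = (\<lambda>_ _. 0)" for s
  proof (rule ends_For[where I = "\<lambda>i s. reg s 15 = k ^ i" and tb = "k * 5 + 7" and m = q])
    fix i s' assume I: "reg s' 15 = k ^ i"
      and fr: "frame (insert 17 (regs_of ?c)) (arrs_of ?c) s s'"
    have r: "reg s' 13 = k" "reg s' 1 = 1"
      using frame_reg[OF fr, of 13] frame_reg[OF fr, of 1] s by auto
    show "ends n lab ?c s' (k * 5 + 7) (\<lambda>s. reg s 15 = k ^ Suc i)"
    proof (rule ends_Seq)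
      show "ends n lab (Mul 18 13 15) s' (k * 5 + 5) (\<lambda>s'. ends n lab (Move 15 18) s' 1 (\<lambda>s. reg s 15 = k ^ Suc i))"
        using I r by (intro ends_Mul ends_loop_free) (auto simp: set_reg_def)
    qed simp
  next
    fix s' assume "reg s' 15 = k ^ q" and fr: "frame (insert 17 (regs_of ?c)) (arrs_of ?c) s s'"
    moreover have "reg s' x = reg s x" if "x \<in> {0, 1, 7, 9, 11, 12, 13, 14, 39}" for x
      using that by (intro frame_reg[OF fr]) auto
    moreover have "arr s' = arr s"
      using fr by (intro frame_arr_empty) simp
    ultimately show "ready_to_draw n k q M s'"
      using s by (simp add: ready_to_draw_def)
  qed (use s in \<open>auto simp: set_reg_def\<close>)
  let ?T = "q * (k * 5 + 11)"
  show ?thesis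
    unfolding dims_com_def
    apply (rule ends_mono[OF _ t])
    apply (rule ends_Seq[where ?t1.0 = "a * 5 + 5" and ?t2.0 = "5 * (a * a + q + k + n) + ?T + 5990"])
     apply (rule ends_Mul)
         apply (use s in simp_all)[4]
     apply (rule ends_Seq[where ?t1.0 = "a * a * 5 + 5" and ?t2.0 = "5 * (q + k + n) + ?T + 5980"])
      apply (rule ends_Mul)
          apply (use s in \<open>simp_all add: frame_reg\<close>)[4]
      apply (rule ends_Seq_loop_free[where ?t2.0 = "5 * (q + k + n) + ?T + 5970"])
        apply simp
       apply (rule ends_Seq[where ?t1.0 = "4005" and ?t2.0 = "5 * (q + k + n) + ?T + 1960"])
        apply (rule ends_Mul)
            apply (use s in \<open>simp_all add: frame_reg set_reg_def\<close>)[4]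
        apply (rule ends_Seq[where ?t1.0 = "q * 5 + 5" and ?t2.0 = "5 * (k + n) + ?T + 1950"])
         apply (rule ends_Mul)
             apply (use s in \<open>simp_all add: frame_reg set_reg_def q\<close>)[4]
         apply (rule ends_Seq_loop_free[where ?t2.0 = "5 * (k + n) + ?T + 1940"])
           apply simp
          apply (rule ends_Seq[where ?t1.0 = "k * 5 + 20" and ?t2.0 = "5 * n + ?T + 1900"])
           apply (rule ends_Mul)
               apply (use s in \<open>simp_all add: frame_reg set_reg_def\<close>)[4]
           apply (rule ends_Seq_loop_free[where ?t2.0 = "5 * n + ?T + 1890"])
             apply simp
            apply (rule ends_Seq[where ?t1.0 = "n * 5 + 10" and ?t2.0 = "?T + 1870"])
             apply (rule ends_Mul)
                 apply (use s in \<open>simp_all add: frame_reg set_reg_def\<close>)[4]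
             apply (rule ends_Seq_loop_free[where ?t2.0 = "?T + 1860"])
               apply simp
              apply (rule ends_Seq_loop_free[where ?t2.0 = "?T + 1850"])
                apply simp
               apply (rule ends_Seq_loop_free[where ?t2.0 = "?T + 1840"])
                 apply simp
                apply (rule ends_Seq_loop_free[where ?t2.0 = "?T + 1830"])
                  apply simp
                 apply (rule ends_mono[OF loop])
                 apply (use s q M in \<open>simp_all add: frame_reg frame_arr_empty set_reg_def\<close>)
    done
qed

section \<open>Distribution of the samples\<close>

definition samples :: "memory \<Rightarrow> nat \<Rightarrow> nat \<times> nat" where
  "samples s i = (arr s 1 i, arr s 2 i)"

text \<open>A pair is drawn at every index, so that the whole sample is one product of identical
  factors, as the concentration lemmas expect.\<close>

definition sample_pmf :: "nat \<Rightarrow> (nat \<times> nat) pmf" where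
  "sample_pmf n = pair_pmf (pmf_of_set {..<n}) (pmf_of_set {..<n})"

definition drawn :: "memory \<Rightarrow> nat \<times> nat \<Rightarrow> memory" where
  "drawn s = (\<lambda>(x, y). set_arr 2 (reg s 22) y (set_reg 24 y (set_arr 1 (reg s 22) x (set_reg 24 x s))))"

lemma runs_draw_body:
  assumes "reg s 0 = n" "n \<ge> 1"
  shows "runs n lab draw_body s 7 (map_pmf (drawn s) (sample_pmf n))"
proof -
  let ?U = "pmf_of_set {..<n}"
  have U: "runs n lab (Uniform 24 0) s' 1 (map_pmf (\<lambda>x. set_reg 24 x s') ?U)" if "reg s' 0 = n" for s'
    using that assms(2) by (auto intro!: runs_atomic simp: uniform_below_def pmf.map_comp o_def)
  have S: "runs n lab (Store b i y) s' 1 (return_pmf (set_arr b (reg s' i) (reg s' y) s'))" for b i y s'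
    by (auto intro!: runs_atomic)
  have "runs n lab draw_body s (1 + 1 + (1 + 1 + (1 + 1 + 1)))
    (bind_pmf (map_pmf (\<lambda>x. set_reg 24 x s) ?U) (\<lambda>s1.
     bind_pmf (return_pmf (set_arr 1 (reg s1 22) (reg s1 24) s1)) (\<lambda>s2.
     bind_pmf (map_pmf (\<lambda>x. set_reg 24 x s2) ?U) (\<lambda>s3.
     return_pmf (set_arr 2 (reg s3 22) (reg s3 24) s3)))))"
    unfolding draw_body_def
    by (intro runs_Seq U S) (use assms in \<open>auto simp: set_reg_def set_arr_def\<close>)
  also have "bind_pmf (map_pmf (\<lambda>x. set_reg 24 x s) ?U) (\<lambda>s1.
     bind_pmf (return_pmf (set_arr 1 (reg s1 22) (reg s1 24) s1)) (\<lambda>s2.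
     bind_pmf (map_pmf (\<lambda>x. set_reg 24 x s2) ?U) (\<lambda>s3.
     return_pmf (set_arr 2 (reg s3 22) (reg s3 24) s3)))) = map_pmf (drawn s) (sample_pmf n)"
    by (simp add: sample_pmf_def pair_pmf_def map_bind_pmf bind_map_pmf bind_return_pmf drawn_def
       map_pmf_def bind_assoc_pmf) (simp add: set_reg_def set_arr_def)
  finally show ?thesis by (simp add: numeral_eq_Suc)
qed

text \<open>Only the image of \<open>D\<close> under \<open>samples\<close> is described, which
  leaves counter and scratch registers out of the picture. The induction goes down from
  \<open>N\<close>, because the first draw of the loop is the coordinate \<open>j\<close> split off
  the product over \<open>{j..<N}\<close>.\<close>

lemma runs_draw_loop:
  assumes "j \<le> N" "n \<ge> 1" "reg s 0 = n" "reg s 1 = 1" "reg s 12 = N" "reg s 22 = j"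
  shows "\<exists>D. runs n lab (While (Less 22 12) (Seq draw_body (Add 22 22 1))) s ((N - j) * 11 + 1) D \<and>
     map_pmf samples D = map_pmf (\<lambda>\<omega> i. if i \<in> {j..<N} then \<omega> i else samples s i)
       (Pi_pmf {j..<N} (0, 0) (\<lambda>_. sample_pmf n))"
  using assms
proof (induction j arbitrary: s rule: inc_induct)
  case base
  then have "runs n lab (While (Less 22 12) (Seq draw_body (Add 22 22 1))) s (Suc 0) (return_pmf s)"
    by (intro runs_While_False) auto
  then show ?case by auto
next
  case (step j)
  let ?L = "While (Less 22 12) (Seq draw_body (Add 22 22 1))"
  let ?P = "sample_pmf n"
  define st where "st = (\<lambda>z. set_reg 22 (Suc j) (drawn s z))"
  have "runs n lab (Seq draw_body (Add 22 22 1)) s (7 + 1 + 1)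
      (bind_pmf (map_pmf (drawn s) ?P) (\<lambda>s'. return_pmf (set_reg 22 (reg s' 22 + reg s' 1) s')))"
    by (intro runs_Seq runs_draw_body runs_atomic[unfolded One_nat_def[symmetric]]) (use step in auto)
  also have "bind_pmf (map_pmf (drawn s) ?P) (\<lambda>s'. return_pmf (set_reg 22 (reg s' 22 + reg s' 1) s')) =
      map_pmf st ?P"
    using step.prems
    by (simp add: bind_map_pmf)
      (auto simp: map_pmf_def st_def drawn_def set_reg_def set_arr_def intro!: bind_pmf_cong split: prod.split)
  finally have body: "runs n lab (Seq draw_body (Add 22 22 1)) s 9 (map_pmf st ?P)" by simp
  \<comment> \<open>Reading \<open>D\<close> off the run makes it a function on all memories, the
    form in which \<open>runs_Seq\<close> wants the continuation.\<close>
  define D where "D s' = map_pmf snd (run n lab ((N - Suc j) * 11 + 1) (?L, s'))" for s'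
  have D: "runs n lab ?L (st z) ((N - Suc j) * 11 + 1) (D (st z)) \<and>
     map_pmf samples (D (st z)) = map_pmf (\<lambda>\<omega> i. if i \<in> {Suc j..<N} then \<omega> i else samples (st z) i)
       (Pi_pmf {Suc j..<N} (0, 0) (\<lambda>_. ?P))" for z
  proof -
    have "reg (st z) 22 = Suc j \<and> (\<forall>x\<in>{0, 1, 12}. reg (st z) x = reg s x)"
      by (cases z) (simp add: st_def drawn_def set_reg_def set_arr_def)
    then have "reg (st z) 0 = n" "reg (st z) 1 = 1" "reg (st z) 12 = N" "reg (st z) 22 = Suc j"
      using step.prems by auto
    from step.IH[OF step.prems(1) this] obtain D' where D': "runs n lab ?L (st z) ((N - Suc j) * 11 + 1) D'"
      "map_pmf samples D' = map_pmf (\<lambda>\<omega> i. if i \<in> {Suc j..<N} then \<omega> i else samples (st z) i)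
       (Pi_pmf {Suc j..<N} (0, 0) (\<lambda>_. ?P))"
      by blast
    have "D (st z) = D'"
      unfolding D_def D'(1)[unfolded runs_def] by (simp add: pmf.map_comp o_def)
    then show ?thesis using D' by blast
  qed
  have "runs n lab (Seq (Seq draw_body (Add 22 22 1)) ?L) s (9 + 1 + ((N - Suc j) * 11 + 1))
      (bind_pmf (map_pmf st ?P) D)"
    using D by (intro runs_Seq body) auto
  then have "runs n lab ?L s (Suc (9 + 1 + ((N - Suc j) * 11 + 1))) (bind_pmf (map_pmf st ?P) D)"
    using step.prems step.hyps by (intro runs_While_True) auto
  then have "runs n lab ?L s ((N - j) * 11 + 1) (bind_pmf (map_pmf st ?P) D)"
    by (rule runs_mono) (use step.hyps in \<open>simp add: Suc_diff_Suc[symmetric]\<close>)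
  moreover have "map_pmf samples (bind_pmf (map_pmf st ?P) D) =
      map_pmf (\<lambda>\<omega> i. if i \<in> {j..<N} then \<omega> i else samples s i) (Pi_pmf {j..<N} (0, 0) (\<lambda>_. ?P))"
  proof -
    have ins: "{j..<N} = insert j {Suc j..<N}" using step.hyps by auto
    have "map_pmf samples (bind_pmf (map_pmf st ?P) D) = bind_pmf ?P (\<lambda>z.
        map_pmf (\<lambda>\<omega> i. if i \<in> {Suc j..<N} then \<omega> i else samples (st z) i)
       (Pi_pmf {Suc j..<N} (0, 0) (\<lambda>_. ?P)))"
      by (simp add: map_bind_pmf bind_map_pmf D)
    \<comment> \<open>Later draws leave index \<open>j\<close> alone, so the value \<open>z\<close>
      stored there can be counted as a coordinate of the product.\<close>
    also have "\<dots> = bind_pmf ?P (\<lambda>z.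
        map_pmf (\<lambda>\<omega> i. if i \<in> {j..<N} then fun_upd \<omega> j z i else samples s i)
       (Pi_pmf {Suc j..<N} (0, 0) (\<lambda>_. ?P)))"
      using step.hyps step.prems
      by (intro bind_pmf_cong map_pmf_cong refl)
        (auto simp: st_def drawn_def samples_def set_reg_def set_arr_def fun_eq_iff split: prod.split)
    also have "\<dots> = map_pmf (\<lambda>\<omega> i. if i \<in> {j..<N} then \<omega> i else samples s i)
        (Pi_pmf {j..<N} (0, 0) (\<lambda>_. ?P))"
      unfolding ins by (subst Pi_pmf_insert') (simp_all add: map_bind_pmf map_pmf_def bind_assoc_pmf bind_return_pmf)
    finally show ?thesis .
  qed
  ultimately show ?case by blast
qed

lemma runs_draw_com:
  assumes "n \<ge> 1" "reg s 0 = n" "reg s 1 = 1" "reg s 12 = N" "arr s = (\<lambda>_ _. 0)"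
  obtains D where "runs n lab draw_com s (N * 11 + 3) D"
    "map_pmf samples D = Pi_pmf {..<N} (0, 0) (\<lambda>_. sample_pmf n)"
proof -
  let ?s = "set_reg 22 0 s"
  obtain D where D: "runs n lab (While (Less 22 12) (Seq draw_body (Add 22 22 1))) ?s (N * 11 + 1) D"
    "map_pmf samples D = map_pmf (\<lambda>\<omega> i. if i \<in> {0..<N} then \<omega> i else samples ?s i)
       (Pi_pmf {0..<N} (0, 0) (\<lambda>_. sample_pmf n))"
    using runs_draw_loop[of 0 N n ?s lab] assms by (auto simp: set_reg_def)
  have "runs n lab draw_com s (1 + 1 + (N * 11 + 1)) (bind_pmf (return_pmf ?s) (\<lambda>_. D))"
    unfolding draw_com_def For_def
    by (intro runs_Seq runs_atomic[unfolded One_nat_def[symmetric]]) (use D(1) in auto)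
  then have "runs n lab draw_com s (N * 11 + 3) D"
    by (simp add: bind_return_pmf numeral_eq_Suc)
  moreover have "map_pmf samples D = Pi_pmf {..<N} (0, 0) (\<lambda>_. sample_pmf n)"
  proof -
    have "map_pmf samples D = map_pmf (\<lambda>\<omega>. \<omega>) (Pi_pmf {..<N} (0, 0) (\<lambda>_. sample_pmf n))"
      unfolding D(2) atLeast0LessThan
    proof (intro map_pmf_cong refl)
      fix \<omega> assume "\<omega> \<in> set_pmf (Pi_pmf {..<N} (0, 0) (\<lambda>_. sample_pmf n))"
      \<comment> \<open>The default \<open>(0, 0)\<close> of the product agrees with the initially
        zero arrays.\<close>
      then have "\<forall>i. i \<notin> {..<N} \<longrightarrow> \<omega> i = (0, 0)"
        using set_Pi_pmf_subset[of "{..<N}"] by fastforce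
      then show "(\<lambda>i. if i \<in> {..<N} then \<omega> i else samples ?s i) = \<omega>"
        using assms(5) by (auto simp: fun_eq_iff samples_def set_reg_def)
    qed
    then show ?thesis by simp
  qed
  ultimately show thesis by (rule that)
qed

section \<open>From an event about the samples to the whole program\<close>

definition time_of :: "nat \<Rightarrow> nat \<Rightarrow> nat \<Rightarrow> nat \<Rightarrow> nat \<Rightarrow> nat \<Rightarrow> nat" where
  "time_of k n a L q M =
     (a * 10 + L * 10 + 20) + 1 + ((5 * (a + a * a + q + k + n) + q * (k * 5 + 11) + 6000) + 1 +
     ((((n + 1) * q + M) * 11 + 3) + 1 +
     (k ^ q * (n * (k * 16 + q * 36 + 41) + M * 30 + q * 14 + 30) + 5)))"

text \<open>Separates execution from analysis: what remains is the probability of an event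
  \<open>G\<close> about independent samples and a deterministic implication from \<open>G\<close>
  to success.\<close>

lemma pends_program:
  assumes k: "k \<ge> 2" and n: "n \<ge> 1" and prec: "precision k \<epsilon> \<delta> a L"
    and q: "q = 800 * (a * a * L)" and M: "M = (k + 3) * (q * q)"
    and G: "measure_pmf.prob (Pi_pmf {..<(n + 1) * q + M} (0, 0) (\<lambda>_. sample_pmf n)) {\<omega>. G \<omega>} \<ge> p"
    and Q: "\<And>\<omega> s. \<forall>i. fst (\<omega> i) < n \<and> snd (\<omega> i) < n \<Longrightarrow> G \<omega> \<Longrightarrow>
       search.best_until n lab k q M (fst \<circ> \<omega>) (snd \<circ> \<omega>) (k ^ q) s \<Longrightarrow> Q s"
  shows "pends n lab (program k) (init_memory n \<epsilon> \<delta>) (time_of k n a L q M) p Q"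
proof -
  let ?N = "(n + 1) * q + M"
  let ?t = "k ^ q * (n * (k * 16 + q * 36 + 41) + M * 30 + q * 14 + 30) + 5"
  let ?d = "5 * (a + a * a + q + k + n) + q * (k * 5 + 11) + 6000"
  have draw: "pends n lab (Seq draw_com search_com) s (?N * 11 + 3 + 1 + ?t) p Q"
    if s: "ready_to_draw n k q M s" for s
  proof -
    obtain D where D: "runs n lab draw_com s (?N * 11 + 3) D"
      "map_pmf samples D = Pi_pmf {..<?N} (0, 0) (\<lambda>_. sample_pmf n)"
      using runs_draw_com[of n s ?N] s n unfolding ready_to_draw_def by metis
    show ?thesis
    proof (rule pends_Seq_runs[OF D(1), where G = "\<lambda>s'. G (samples s')"])
      have "measure_pmf.prob D {s'. G (samples s')} = measure_pmf.prob (map_pmf samples D) {\<omega>. G \<omega>}"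
        by (simp add: vimage_def)
      then show "measure_pmf.prob D {s'. G (samples s')} \<ge> p"
        using G by (simp add: D(2))
    next
      fix s' assume s': "s' \<in> set_pmf D"
      let ?\<omega> = "samples s'"
      have "samples s' \<in> set_pmf (Pi_pmf {..<?N} (0, 0) (\<lambda>_. sample_pmf n))"
        by (metis D(2) imageI s' set_map_pmf)
      then have "samples s' \<in> PiE_dflt {..<?N} (0, 0) (\<lambda>_. {..<n} \<times> {..<n})"
        using n by (subst (asm) set_Pi_pmf) (auto simp: sample_pmf_def o_def lessThan_empty_iff)
      then have dflt: "if i < ?N then samples s' i \<in> {..<n} \<times> {..<n} else samples s' i = (0, 0)" for i
        unfolding PiE_dflt_def mem_Collect_eq by (meson lessThan_iff)
      \<comment> \<open>\<open>search\<close> asks this of all indices; beyond the drawn range the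
        entries are 0, which is below \<open>n\<close> as \<open>n \<ge> 1\<close>.\<close>
      have \<omega>: "\<forall>i. fst (samples s' i) < n \<and> snd (samples s' i) < n"
      proof
        show "fst (samples s' i) < n \<and> snd (samples s' i) < n" for i
          using dflt[of i] n by (cases "i < ?N") (auto simp: mem_Times_iff)
      qed
      then interpret search n lab k q M "fst \<circ> ?\<omega>" "snd \<circ> ?\<omega>"
        using k n by unfold_locales auto
      have fr: "frame {22, 24} {1, 2} s s'"
        using runs_frame[OF D(1) s'] by (simp add: draw_com_def draw_body_def insert_commute)
      have "reg s' x = reg s x" if "x \<in> {0, 1, 7, 9, 11, 13, 14, 15, 39}" for x
        using that by (intro frame_reg[OF fr]) auto
      then have "env s'"
        using s unfolding env_def by (simp add: ready_to_draw_def samples_def o_def)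
      moreover have "arr s' 3 = (\<lambda>_. 0)"
        using frame_arr[OF fr, of 3] s by (simp add: ready_to_draw_def)
      ultimately have "ends n lab search_com s' ?t (best_until (k ^ q))"
        by (rule ends_search_com)
      then show "ends n lab search_com s' ?t (\<lambda>s''. G (samples s') \<longrightarrow> Q s'')"
        by (rule ends_weaken) (use \<omega> Q in auto)
    qed
  qed
  have dims: "pends n lab (Seq (dims_com k) (Seq draw_com search_com)) s
      (?d + 1 + (?N * 11 + 3 + 1 + ?t)) p Q"
    if s: "doubling n k \<delta> a L s" for s
  proof (rule pends_Seq_ends)
    have "ends n lab (dims_com k) s ?d (ready_to_draw n k q M)"
      using s by (intro ends_dims_com[OF _ _ _ _ _ _ q M]) (auto simp: doubling_def)
    then show "ends n lab (dims_com k) s ?d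
        (\<lambda>s'. pends n lab (Seq draw_com search_com) s' (?N * 11 + 3 + 1 + ?t) p Q)"
      by (rule ends_weaken) (use draw in auto)
  qed
  show ?thesis
    unfolding program_def time_of_def
  proof (rule pends_Seq_ends)
    show "ends n lab (prec_com k) (init_memory n \<epsilon> \<delta>) (a * 10 + L * 10 + 20)
      (\<lambda>s'. pends n lab (Seq (dims_com k) (Seq draw_com search_com)) s'
      (?d + 1 + (?N * 11 + 3 + 1 + ?t)) p Q)"
      by (rule ends_weaken[OF ends_prec_com[OF prec order.refl] order.refl]) (use dims in auto)
  qed
qed

section \<open>Labels, clusterings and the hybrid argument\<close>

lemma query_commute: "query n lab u w = query n lab w u"
  by (simp add: query_def insert_commute)

lemma query_eq_1_iff: "query n lab u w = 1 \<longleftrightarrow> u < n \<and> w < n \<and> u \<noteq> w \<and> lab {u, w} = Plus"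
  unfolding query_def edges_def by (auto simp: doubleton_eq_iff)

lemma agree_commute: "agree n lab y u w \<longleftrightarrow> agree n lab y w u"
  unfolding agree_def by (subst query_commute) auto

text \<open>On the diagonal the labels are equal but the query yields 0. So a sampled pair with
  equal components is never a hit, and the expected fraction of hits is exactly
  \<open>agree_pairs\<close> divided by \<open>n^2\<close>.\<close>

lemma not_agree_refl: "\<not> agree n lab y u u"
  by (simp add: agree_def query_def edges_def)

text \<open>Ordered pairs, to match the uniformly drawn test pairs; hence the factors 2 from here
  on.\<close>

definition agree_pairs :: "nat \<Rightarrow> labeling \<Rightarrow> (nat \<Rightarrow> nat) \<Rightarrow> int" where
  "agree_pairs n lab y = (\<Sum>u<n. \<Sum>w<n. of_bool (agree n lab y u w))"

lemma agree_pairs_eq_card: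
  "agree_pairs n lab y = 2 * int (card {(u, w). u < w \<and> w < n \<and> agree n lab y u w})"
proof -
  let ?A = "{(u, w). u < w \<and> w < n \<and> agree n lab y u w}"
  let ?B = "{(u, w). w < u \<and> u < n \<and> agree n lab y u w}"
  have "?A \<subseteq> {..<n} \<times> {..<n}" "?B \<subseteq> {..<n} \<times> {..<n}" by auto
  then have fin: "finite ?A" "finite ?B" by (auto intro: finite_subset)
  have "?B = prod.swap ` ?A"
    by (auto simp: image_iff agree_commute[of n lab y])
  then have B: "card ?B = card ?A"
    by (simp add: card_image)
  have "agree_pairs n lab y = (\<Sum>(u, w)\<in>{..<n} \<times> {..<n}. of_bool (agree n lab y u w))"
    unfolding agree_pairs_def by (rule sum.cartesian_product)
  also have "\<dots> = int (card (({..<n} \<times> {..<n}) \<inter> {(u, w). agree n lab y u w}))"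
    unfolding case_prod_unfold by (subst sum_of_bool_eq) auto
  also have "({..<n} \<times> {..<n}) \<inter> {(u, w). agree n lab y u w} = ?A \<union> ?B"
    (is "?L = _")
  proof (intro equalityI subsetI)
    fix z assume "z \<in> ?L"
    then obtain u w where z: "z = (u, w)" "u < n" "w < n" "agree n lab y u w" by auto
    then have "u \<noteq> w" using not_agree_refl by blast
    then show "z \<in> ?A \<union> ?B" using z by (cases "u < w") auto
  qed auto
  also have "card \<dots> = card ?A + card ?B"
    using fin by (intro card_Un_disjoint) auto
  finally show ?thesis using B by simp
qed

lemma two_agreements:
  assumes "\<And>u w. u < n \<Longrightarrow> w < n \<Longrightarrow> same_cluster P u w \<longleftrightarrow> y u = y w"
    and "\<And>u w. u < n \<Longrightarrow> w < n \<Longrightarrow> diff_cluster P u w \<longleftrightarrow> y u \<noteq> y w"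
  shows "2 * int (agreements lab {..<n} P) = agree_pairs n lab y"
proof -
  let ?A = "{(u, w). u < w \<and> w < n \<and> agree n lab y u w}"
  have edge: "{u, w} \<in> edges {..<n} \<longleftrightarrow> u < n \<and> w < n \<and> u \<noteq> w" for u w
    unfolding edges_def by (auto simp: doubleton_eq_iff)
  have *: "(lab {u, w} = Plus \<and> same_cluster P u w \<or> lab {u, w} = Minus \<and> diff_cluster P u w) \<longleftrightarrow>
      agree n lab y u w" if "u < n" "w < n" "u \<noteq> w" for u w
    using assms that query_eq_1_iff[of n lab u w] unfolding agree_def by (cases "lab {u, w}") auto
  have "agreement_edges lab {..<n} P = {{u, w} | u w. u < n \<and> w < n \<and> u \<noteq> w \<and> agree n lab y u w}"
    unfolding agreement_edges_def edge using * by blast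
  also have "\<dots> = (\<lambda>(u, w). {u, w}) ` ?A"
  proof (intro equalityI subsetI)
    fix e assume "e \<in> {{u, w} | u w. u < n \<and> w < n \<and> u \<noteq> w \<and> agree n lab y u w}"
    then obtain u w where e: "e = {u, w}" "u < n" "w < n" "u \<noteq> w" "agree n lab y u w" by blast
    show "e \<in> (\<lambda>(u, w). {u, w}) ` ?A"
    proof (cases "u < w")
      case True
      then show ?thesis using e by (auto intro!: image_eqI[of _ _ "(u, w)"])
    next
      case False
      then show ?thesis using e agree_commute[of n lab y u w]
        by (auto intro!: image_eqI[of _ _ "(w, u)"])
    qed
  next
    fix e assume "e \<in> (\<lambda>(u, w). {u, w}) ` ?A"
    then obtain u w where "e = {u, w}" "u < w" "w < n" "agree n lab y u w" by auto
    then show "e \<in> {{u, w} | u w. u < n \<and> w < n \<and> u \<noteq> w \<and> agree n lab y u w}"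
      by (intro CollectI exI[of _ u] exI[of _ w]) auto
  qed
  finally have "agreement_edges lab {..<n} P = (\<lambda>(u, w). {u, w}) ` ?A" .
  moreover have "inj_on (\<lambda>(u, w). {u, w}) ?A"
  proof (rule inj_onI, clarify)
    fix u w u' w' :: nat assume "u < w" "u' < w'" "{u, w} = {u', w'}"
    then have "u = u' \<and> w = w' \<or> u = w' \<and> w = u'" by (simp only: doubleton_eq_iff)
    with \<open>u < w\<close> \<open>u' < w'\<close> show "u = u' \<and> w = w'" by linarith
  qed
  ultimately have "agreements lab {..<n} P = card ?A"
    unfolding agreements_def by (simp only: card_image)
  then show ?thesis by (simp add: agree_pairs_eq_card)
qed

lemma clustering_labels:
  assumes "k_clustering k {..<n} P"
  obtains y where "\<And>u. u < n \<Longrightarrow> y u < k"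
    "2 * int (agreements lab {..<n} P) = agree_pairs n lab y"
proof -
  have P: "\<Union>P = {..<n}" "disjoint P" "card P \<le> k"
    using assms by (auto simp: k_clustering_def partition_on_def)
  have fin: "finite P" using P(1) by (metis finite_UnionD finite_lessThan)
  \<comment> \<open>An injection of the at most \<open>k\<close> clusters into \<open>{..<k}\<close>
    serves as their naming by labels.\<close>
  then obtain f where f: "inj_on f P" "f ` P \<subseteq> {..<k}"
    using P(3) card_le_inj[of P "{..<k}"] by auto
  have "\<exists>A\<in>P. u \<in> A" if "u < n" for u
    using that P(1) by blast
  then obtain cl where cl: "\<And>u. u < n \<Longrightarrow> cl u \<in> P \<and> u \<in> cl u"
    by metis
  have uniq: "A = cl u" if "u < n" "A \<in> P" "u \<in> A" for u A
    using disjointD[OF P(2) that(2), of "cl u"] cl[OF that(1)] that(3) by auto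
  define y where "y u = f (cl u)" for u
  have y: "y u = y w \<longleftrightarrow> cl u = cl w" if "u < n" "w < n" for u w
    using inj_on_eq_iff[OF f(1), of "cl u" "cl w"] cl that by (simp add: y_def)
  show thesis
  proof
    show "y u < k" if "u < n" for u
      using f(2) cl[OF that] by (auto simp: y_def)
    show "2 * int (agreements lab {..<n} P) = agree_pairs n lab y"
    proof (rule two_agreements)
      fix u w assume uw: "u < n" "w < n"
      have u: "A \<in> P \<and> u \<in> A \<longleftrightarrow> A = cl u" and w: "A \<in> P \<and> w \<in> A \<longleftrightarrow> A = cl w" for A
        using uniq[OF uw(1), of A] uniq[OF uw(2), of A] cl[OF uw(1)] cl[OF uw(2)] by auto
      show "same_cluster P u w \<longleftrightarrow> y u = y w"
        unfolding same_cluster_def y[OF uw] using u w by blast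
      show "diff_cluster P u w \<longleftrightarrow> y u \<noteq> y w"
        unfolding diff_cluster_def y[OF uw] using u w by blast
    qed
  qed
qed

lemma output_clustering_labels:
  assumes y: "\<And>u. u < n \<Longrightarrow> arr s 0 u = y u" "\<And>u. u < n \<Longrightarrow> y u < k"
  shows "k_clustering k {..<n} (output_clustering n s)"
    and "2 * int (agreements lab {..<n} (output_clustering n s)) = agree_pairs n lab y"
proof -
  let ?P = "output_clustering n s"
  have P: "?P = (\<lambda>c. {u \<in> {..<n}. y u = c}) ` (y ` {..<n})"
    using y(1) unfolding output_clustering_def image_image by (intro image_cong refl) auto
  have "card ?P \<le> card (y ` {..<n})"
    unfolding P by (rule card_image_le) simp
  also have "\<dots> \<le> card {..<k}"
    using y(2) by (intro card_mono) auto
  finally have "card ?P \<le> k" by simp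
  moreover have "partition_on {..<n} ?P"
    unfolding P by (auto simp: partition_on_def disjoint_def)
  ultimately show "k_clustering k {..<n} ?P"
    by (simp add: k_clustering_def)
  show "2 * int (agreements lab {..<n} ?P) = agree_pairs n lab y"
    by (rule two_agreements) (auto simp: P same_cluster_def diff_cluster_def)
qed

lemma OPT_labels:
  assumes "n \<ge> 1" "k \<ge> 1"
  obtains y where "\<And>u. u < n \<Longrightarrow> y u < k" "2 * int (OPT k lab {..<n}) = agree_pairs n lab y"
proof -
  let ?S = "{agreements lab {..<n} P | P. k_clustering k {..<n} P}"
  have "k_clustering k {..<n} P \<Longrightarrow> P \<in> Pow (Pow {..<n})" for P
    unfolding k_clustering_def partition_on_def by blast
  then have "{P. k_clustering k {..<n} P} \<subseteq> Pow (Pow {..<n})"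
    by blast
  then have "finite {P. k_clustering k {..<n} P}"
    by (rule finite_subset) simp
  then have fin: "finite ?S" by (simp add: Setcompr_eq_image)
  \<comment> \<open>The parts of a partition are non-empty, hence the appeal to
    \<open>n \<ge> 1\<close>.\<close>
  have "partition_on {..<n} {{..<n}}"
    using assms by (auto simp: partition_on_def disjoint_def set_eq_iff intro!: exI[of _ 0])
  then have "k_clustering k {..<n} {{..<n}}"
    using assms by (simp add: k_clustering_def)
  then have "?S \<noteq> {}" by blast
  with fin have "OPT k lab {..<n} \<in> ?S"
    unfolding OPT_def by (rule Max_in)
  then obtain P where "k_clustering k {..<n} P" "OPT k lab {..<n} = agreements lab {..<n} P"
    by auto
  then show thesis using clustering_labels[of k n P lab] that by metis
qed

section \<open>Relabeling one vertex, and hybrids of two labelings\<close>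

definition gain :: "nat \<Rightarrow> labeling \<Rightarrow> (nat \<Rightarrow> nat) \<Rightarrow> nat \<Rightarrow> nat \<Rightarrow> int" where
  "gain n lab y v j = (\<Sum>u\<in>{..<n} - {v}. if y u = j then sgn_edge n lab v u else 0)"

text \<open>Pairs that avoid \<open>v\<close> do not see \<open>j\<close>. A pair with
  \<open>v\<close> has a base value, that for different labels, corrected by \<open>sgn_edge\<close>
  if the labels are equal; row and column of \<open>v\<close> contribute the same. So only
  \<open>gain\<close> depends on \<open>j\<close>.\<close>

lemma agree_pairs_upd:
  assumes v: "v < n"
  shows "agree_pairs n lab (y(v := j)) =
    (\<Sum>u\<in>{..<n} - {v}. \<Sum>w\<in>{..<n} - {v}. of_bool (agree n lab y u w)) +
    2 * ((\<Sum>u\<in>{..<n} - {v}. of_bool (query n lab v u \<noteq> 1)) + gain n lab y v j)"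
proof -
  let ?y = "y(v := j)" and ?V = "{..<n} - {v}"
  let ?a = "\<lambda>u w. of_bool (agree n lab ?y u w) :: int"
  have split: "(\<Sum>u<n. f u) = f v + (\<Sum>u\<in>?V. f u)" for f :: "nat \<Rightarrow> int"
    using v by (subst sum.remove[of _ v]) auto
  have row: "(\<Sum>u\<in>?V. ?a v u) = (\<Sum>u\<in>?V. of_bool (query n lab v u \<noteq> 1)) + gain n lab y v j"
    unfolding gain_def sum.distrib[symmetric]
    by (intro sum.cong) (auto simp: agree_def sgn_edge_def)
  have "agree_pairs n lab ?y = ?a v v + (\<Sum>w\<in>?V. ?a v w) + (\<Sum>u\<in>?V. ?a u v + (\<Sum>w\<in>?V. ?a u w))"
    unfolding agree_pairs_def split ..
  also have "\<dots> = 2 * (\<Sum>u\<in>?V. ?a v u) + (\<Sum>u\<in>?V. \<Sum>w\<in>?V. ?a u w)"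
    using agree_commute[of n lab ?y _ v] by (simp add: not_agree_refl sum.distrib del: fun_upd_apply)
  also have "(\<Sum>u\<in>?V. \<Sum>w\<in>?V. ?a u w) = (\<Sum>u\<in>?V. \<Sum>w\<in>?V. of_bool (agree n lab y u w))"
    by (intro sum.cong) (auto simp: agree_def)
  finally show ?thesis unfolding row by (rule trans) (rule add.commute)
qed

lemma agree_pairs_cong:
  "(\<And>u. u < n \<Longrightarrow> y u = y' u) \<Longrightarrow> agree_pairs n lab y = agree_pairs n lab y'"
  unfolding agree_pairs_def by (intro sum.cong) (auto simp: agree_def)

text \<open>Telescoping over the hybrids with \<open>y\<close> below \<open>v\<close> and
  \<open>x\<close> from \<open>v\<close> on: consecutive ones differ only at \<open>v\<close>, where
  by \<open>agree_pairs_upd\<close> the change is twice a difference of gains.\<close>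

lemma agree_pairs_diff:
  fixes loss :: "nat \<Rightarrow> real"
  assumes "\<And>v. v < n \<Longrightarrow>
    real_of_int (gain n lab (\<lambda>u. if u < v then y u else x u) v (x v)) \<le>
    real_of_int (gain n lab (\<lambda>u. if u < v then y u else x u) v (y v)) + loss v"
  shows "real_of_int (agree_pairs n lab x) \<le> real_of_int (agree_pairs n lab y) + 2 * (\<Sum>v<n. loss v)"
proof -
  define h where "h v = (\<lambda>u. if u < v then y u else x u)" for v :: nat
  have "real_of_int (agree_pairs n lab x) \<le> real_of_int (agree_pairs n lab (h v)) + 2 * (\<Sum>u<v. loss u)"
    if "v \<le> n" for v
    using that
  proof (induction v)
    case 0
    then show ?case by (simp add: h_def)
  next
    case (Suc v)
    have "h v = (h v)(v := x v)" "h (Suc v) = (h v)(v := y v)"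
      by (auto simp: h_def fun_eq_iff less_Suc_eq)
    then have "agree_pairs n lab (h (Suc v)) - agree_pairs n lab (h v) =
        2 * (gain n lab (h v) v (y v) - gain n lab (h v) v (x v))"
      using agree_pairs_upd[of v n lab "h v" "x v"] agree_pairs_upd[of v n lab "h v" "y v"] Suc.prems
      by simp
    then have "real_of_int (agree_pairs n lab (h (Suc v))) - real_of_int (agree_pairs n lab (h v)) =
        2 * (real_of_int (gain n lab (h v) v (y v)) - real_of_int (gain n lab (h v) v (x v)))"
      by (metis of_int_diff of_int_mult of_int_numeral)
    moreover have "real_of_int (gain n lab (h v) v (x v)) \<le> real_of_int (gain n lab (h v) v (y v)) + loss v"
      using assms[of v] Suc.prems by (simp add: h_def)
    moreover have "real_of_int (agree_pairs n lab x) \<le> real_of_int (agree_pairs n lab (h v)) + 2 * (\<Sum>u<v. loss u)"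
      using Suc by simp
    ultimately show ?case by simp
  qed
  from this[of n] show ?thesis
    using agree_pairs_cong[of n "h n" y lab] by (simp add: h_def)
qed

text \<open>Both terms vanish at \<open>u = v\<close>, so the sum may run over all vertices, and its
  mean is what uniform sampling estimates.\<close>

lemma gain_hybrid:
  "gain n lab (\<lambda>u. if u < v then y u else x u) v j =
     (\<Sum>u<n. late_term n lab v j (x u) u + early_term n lab v j y u)"
proof -
  have "gain n lab (\<lambda>u. if u < v then y u else x u) v j =
      (\<Sum>u\<in>{..<n} - {v}. late_term n lab v j (x u) u + early_term n lab v j y u)"
    unfolding gain_def by (intro sum.cong) (auto simp: late_term_def early_term_def)
  also have "\<dots> = (\<Sum>u<n. late_term n lab v j (x u) u + early_term n lab v j y u)"
    by (intro sum.mono_neutral_left) (auto simp: late_term_def early_term_def)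
  finally show ?thesis .
qed

lemma abs_gain_le: "\<bar>gain n lab y v j\<bar> \<le> int n"
proof -
  have "\<bar>gain n lab y v j\<bar> \<le> (\<Sum>u\<in>{..<n} - {v}. 1)"
    unfolding gain_def by (rule order_trans[OF sum_abs sum_mono]) (auto simp: sgn_edge_def)
  also have "\<dots> \<le> (\<Sum>u<n. 1)"
    by (intro sum_mono2) auto
  finally show ?thesis by simp
qed

section \<open>Optimality and locality of the greedy choice\<close>

lemma amax_ge: "j < k \<Longrightarrow> f j \<le> snd (amax f k)"
  by (induction k) (auto simp: less_Suc_eq)

lemma snd_amax: "snd (amax f k) = 0 \<or> snd (amax f k) = f (fst (amax f k))"
  by (induction k) auto

text \<open>\<open>amax\<close> starts from index 0 with value 0. The maximum stays 0 only if all
  values are 0, and then any index will do.\<close>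

lemma amax_max: "j < k \<Longrightarrow> f j \<le> f (fst (amax f k))"
  using amax_ge[of j k f] snd_amax[of f k] by auto

lemma greedy_stable: "u < v \<Longrightarrow> v \<le> w \<Longrightarrow> greedy n lab k q W g w u = greedy n lab k q W g v u"
  by (induction w) (auto simp: le_Suc_eq)

text \<open>By \<open>abs_score\<close> the offset makes all arguments of \<open>nat\<close>
  non-negative, so maximizing natural numbers maximizes the integer scores.\<close>

lemma score_greedy_ge:
  assumes "v < n" "j < k"
  shows "score n lab q W g (greedy n lab k q W g v) v q j \<le>
     score n lab q W g (greedy n lab k q W g v) v q (greedy n lab k q W g n v)"
proof -
  let ?y = "greedy n lab k q W g v"
  let ?f = "\<lambda>j. nat (2 * int q + score n lab q W g ?y v q j)"
  have "greedy n lab k q W g n v = fst (amax ?f k)"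
    using greedy_stable[of v "Suc v" n n lab k q W g] assms(1) by simp
  then have "?f j \<le> ?f (greedy n lab k q W g n v)"
    using amax_max[OF assms(2), of ?f] by simp
  then show ?thesis
    using abs_score[of n lab q W g ?y v q j] abs_score[of n lab q W g ?y v q "greedy n lab k q W g n v"]
    by linarith
qed

text \<open>The source of all independence: when \<open>v\<close> is to be placed, its private block
  has not been looked at, and for \<open>v = n\<close> neither has the test block.\<close>

lemma greedy_cong:
  assumes "\<And>i. i < (v + 1) * q \<Longrightarrow> W i = W' i" "\<And>i. i < q \<Longrightarrow> g i = g' i"
  shows "greedy n lab k q W g v = greedy n lab k q W' g' v"
  using assms(1)
proof (induction v)
  case (Suc v)
  have 1: "W i = W' i" if "i < q" for i
    using Suc.prems[of i] that by auto
  have 2: "W ((v + 1) * q + h) = W' ((v + 1) * q + h)" if "h < q" for h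
    using Suc.prems[of "(v + 1) * q + h"] that by simp
  have "greedy n lab k q W g v = greedy n lab k q W' g' v"
    using Suc.prems by (intro Suc.IH) (simp add: trans_less_add2)
  moreover have "score n lab q W g y v q j = score n lab q W' g' y v q j" for y j
    unfolding score_def using 1 2 assms(2) by (intro sum.cong) auto
  ultimately show ?case by simp
qed simp

text \<open>In particular the optimal labels of the sample occur among the guesses. The induction
  strips off the least significant digit.\<close>

lemma ex_digits:
  assumes "\<And>i. i < q \<Longrightarrow> g i < k"
  shows "\<exists>j<k ^ q. \<forall>i<q. digits k j i = g i"
  using assms
proof (induction q arbitrary: g)
  case (Suc q)
  obtain j where j: "j < k ^ q" "\<forall>i<q. digits k j i = g (Suc i)"
    using Suc.IH[of "\<lambda>i. g (Suc i)"] Suc.prems by auto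
  have g0: "g 0 < k" using Suc.prems by simp
  have div: "(g 0 + k * j) div k = j" using g0 by simp
  have "digits k (g 0 + k * j) i = g i" if "i < Suc q" for i
  proof (cases i)
    case 0
    then show ?thesis using g0 by (simp add: digits_def)
  next
    case (Suc h)
    then show ?thesis using that j(2) div by (simp add: digits_def div_mult2_eq)
  qed
  moreover have "g 0 + k * j < k ^ Suc q"
  proof -
    have "g 0 + k * j < k * Suc j" using g0 by simp
    also have "\<dots> \<le> k * k ^ q" using j(1) by (intro mult_le_mono2) simp
    finally show ?thesis by simp
  qed
  ultimately show ?case by blast
qed simp

section \<open>Concentration\<close>

lemma prob_bind_le:
  assumes "\<And>x. x \<in> set_pmf D \<Longrightarrow> measure_pmf.prob (K x) A \<le> c"
  shows "measure_pmf.prob (bind_pmf D K) A \<le> c"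
proof -
  obtain x where "x \<in> set_pmf D" using set_pmf_not_empty by fast
  then have c: "0 \<le> c" using assms[of x] measure_nonneg order_trans by blast
  have "ennreal (measure_pmf.prob (bind_pmf D K) A) = emeasure (measure_pmf (bind_pmf D K)) A"
    by (simp add: measure_pmf.emeasure_eq_measure)
  also have "\<dots> = (\<integral>\<^sup>+x. emeasure (measure_pmf (K x)) A \<partial>measure_pmf D)"
    by (rule emeasure_bind_pmf)
  also have "\<dots> \<le> (\<integral>\<^sup>+x. ennreal c \<partial>measure_pmf D)"
    using assms by (intro nn_integral_mono_AE AE_pmfI)
      (auto simp: measure_pmf.emeasure_eq_measure intro!: ennreal_leI)
  finally show ?thesis using c by (simp add: measure_pmf.emeasure_space_1)
qed

text \<open>The summands range over an interval of length 2, so the squared lengths in Hoeffding's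
  inequality add up to \<open>4 * card B\<close>.\<close>

lemma Hoeffding_Pi_pmf:
  fixes \<phi> :: "'a \<Rightarrow> real" and t :: real
  assumes B: "finite B" "B \<noteq> {}" and \<phi>: "\<And>z. \<bar>\<phi> z\<bar> \<le> 1" and t: "t \<ge> 0"
  shows "measure_pmf.prob (Pi_pmf B d (\<lambda>_. p))
      {f. \<bar>(\<Sum>i\<in>B. \<phi> (f i)) - card B * measure_pmf.expectation p \<phi>\<bar> \<ge> t * card B}
    \<le> 2 * exp (- (card B * t\<^sup>2 / 2))"
proof -
  let ?M = "Pi_pmf B d (\<lambda>_. p)"
  have indep: "prob_space.indep_vars (measure_pmf ?M) (\<lambda>_. borel) (\<lambda>i f. \<phi> (f i)) B"
    using B(1) by (intro prob_space.indep_vars_compose2[OF _ indep_vars_Pi_pmf])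
      (auto simp: measure_pmf.prob_space_axioms)
  have E: "measure_pmf.expectation ?M (\<lambda>f. \<phi> (f i)) = measure_pmf.expectation p \<phi>" if "i \<in> B" for i
  proof -
    have "measure_pmf.expectation ?M (\<lambda>f. \<phi> (f i)) =
        measure_pmf.expectation (map_pmf (\<lambda>f. f i) ?M) \<phi>" by simp
    then show ?thesis using B that by (simp add: Pi_pmf_component)
  qed
  interpret Hoeffding_ineq "measure_pmf ?M" B "\<lambda>i f. \<phi> (f i)" "\<lambda>_. - 1" "\<lambda>_. 1"
      "\<Sum>i\<in>B. measure_pmf.expectation ?M (\<lambda>f. \<phi> (f i))"
    using B indep \<phi> by unfold_locales (auto simp: abs_le_iff minus_le_iff)
  have c: "card B > 0" using B by (simp add: card_gt_0_iff)
  have "measure_pmf.prob ?M {f. \<bar>(\<Sum>i\<in>B. \<phi> (f i)) - card B * measure_pmf.expectation p \<phi>\<bar> \<ge> t * card B}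
      \<le> 2 * exp (- 2 * (t * card B)\<^sup>2 / (\<Sum>i\<in>B. (1 - - 1)\<^sup>2))"
    using Hoeffding_ineq_abs_ge[of "t * card B"] t c E by simp
  also have "- 2 * (t * card B)\<^sup>2 / (\<Sum>i\<in>B. (1 - - 1)\<^sup>2) = - (card B * t\<^sup>2 / 2)"
    using c by (simp add: power2_eq_square field_simps)
  finally show ?thesis .
qed

text \<open>The summand may depend on the coordinates outside the block, which are conditioned on.\<close>

lemma Hoeffding_block:
  fixes F :: "(nat \<Rightarrow> 'a) \<Rightarrow> 'a \<Rightarrow> real" and t :: real
  assumes A: "finite A" "B \<subseteq> A" "B \<noteq> {}" and F: "\<And>\<omega> z. \<bar>F \<omega> z\<bar> \<le> 1" and t: "t \<ge> 0"
    and dep: "\<And>\<omega> \<omega>'. (\<And>i. i \<notin> B \<Longrightarrow> \<omega> i = \<omega>' i) \<Longrightarrow> F \<omega> = F \<omega>'"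
  shows "measure_pmf.prob (Pi_pmf A d (\<lambda>_. p))
      {\<omega>. \<bar>(\<Sum>i\<in>B. F \<omega> (\<omega> i)) - card B * measure_pmf.expectation p (F \<omega>)\<bar> \<ge> t * card B}
    \<le> 2 * exp (- (card B * t\<^sup>2 / 2))" (is "measure_pmf.prob _ ?E \<le> ?c")
proof -
  have fin: "finite B" "finite (A - B)" using A finite_subset by auto
  let ?m = "\<lambda>g f x. if x \<in> B then f x else g x"
  have "Pi_pmf A d (\<lambda>_. p) = Pi_pmf (B \<union> (A - B)) d (\<lambda>_. p)"
    using A by (simp add: Un_absorb1)
  also have "\<dots> = map_pmf (\<lambda>(f, g). ?m g f) (pair_pmf (Pi_pmf B d (\<lambda>_. p)) (Pi_pmf (A - B) d (\<lambda>_. p)))"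
    using fin by (intro Pi_pmf_union) auto
  also have "\<dots> = bind_pmf (Pi_pmf (A - B) d (\<lambda>_. p)) (\<lambda>g. map_pmf (?m g) (Pi_pmf B d (\<lambda>_. p)))"
    by (subst pair_commute_pmf) (simp add: pair_pmf_def map_bind_pmf bind_assoc_pmf map_pmf_def bind_return_pmf)
  finally have eq: "Pi_pmf A d (\<lambda>_. p) =
      bind_pmf (Pi_pmf (A - B) d (\<lambda>_. p)) (\<lambda>g. map_pmf (?m g) (Pi_pmf B d (\<lambda>_. p)))" .
  show ?thesis unfolding eq
  proof (rule prob_bind_le)
    fix g
    have Fm: "F (?m g f) = F g" for f
      by (rule dep) auto
    have "measure_pmf.prob (map_pmf (?m g) (Pi_pmf B d (\<lambda>_. p))) ?E =
        measure_pmf.prob (Pi_pmf B d (\<lambda>_. p))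
          {f. \<bar>(\<Sum>i\<in>B. F g (f i)) - card B * measure_pmf.expectation p (F g)\<bar> \<ge> t * card B}"
      by (simp add: vimage_def Fm cong: sum.cong)
    also have "\<dots> \<le> ?c"
      using fin A F t by (intro Hoeffding_Pi_pmf) auto
    finally show "measure_pmf.prob (map_pmf (?m g) (Pi_pmf B d (\<lambda>_. p))) ?E \<le> ?c" .
  qed
qed

lemma expectation_sample_fst:
  fixes f :: "nat \<Rightarrow> real"
  assumes "n \<ge> 1"
  shows "measure_pmf.expectation (sample_pmf n) (\<lambda>z. f (fst z)) = (\<Sum>u<n. f u) / n"
proof -
  have "measure_pmf.expectation (sample_pmf n) (\<lambda>z. f (fst z)) =
      measure_pmf.expectation (map_pmf fst (sample_pmf n)) f" by simp
  also have "\<dots> = (\<Sum>u<n. f u) / n"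
    using assms unfolding sample_pmf_def map_fst_pair_pmf
    by (subst integral_pmf_of_set) (auto simp: lessThan_empty_iff)
  finally show ?thesis .
qed

lemma expectation_sample:
  fixes f :: "nat \<Rightarrow> nat \<Rightarrow> real"
  assumes "n \<ge> 1"
  shows "measure_pmf.expectation (sample_pmf n) (\<lambda>z. f (fst z) (snd z)) = (\<Sum>u<n. \<Sum>w<n. f u w) / n\<^sup>2"
proof -
  have ne: "{..<n} \<noteq> {}" using assms by (auto simp: lessThan_empty_iff)
  have "sample_pmf n = pmf_of_set ({..<n} \<times> {..<n})"
    unfolding sample_pmf_def using ne
    by (intro pmf_eqI) (auto simp: pmf_pair pmf_of_set[OF ne] pmf_of_set indicator_def)
  then show ?thesis
    using ne by (simp add: integral_pmf_of_set sum.cartesian_product case_prod_unfold power2_eq_square)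
qed

text \<open>Markov's inequality for the number of events that occur. The events may be dependent, as
  the bad vertices are through the first sample.\<close>

lemma prob_many_le:
  fixes b c :: real and n :: nat
  assumes "\<And>v. v < n \<Longrightarrow> measure_pmf.prob P (A v) \<le> b" "c > 0"
  shows "measure_pmf.prob P {\<omega>. c \<le> real (card {v. v < n \<and> \<omega> \<in> A v})} \<le> n * b / c"
proof -
  let ?X = "\<lambda>\<omega>. \<Sum>v<n. indicator (A v) \<omega> :: real"
  have X: "?X \<omega> = real (card {v. v < n \<and> \<omega> \<in> A v})" for \<omega>
    unfolding indicator_def by (simp add: sum_of_bool_eq[OF finite_lessThan] Int_def)
  have int: "integrable (measure_pmf P) (indicator (A v) :: _ \<Rightarrow> real)" for v
    by (intro measure_pmf.integrable_const_bound[where B = 1]) (auto simp: indicator_def)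
  have "measure_pmf.prob P {\<omega> \<in> space (measure_pmf P). c \<le> ?X \<omega>} \<le>
      measure_pmf.expectation P ?X / c"
    using assms(2) int by (intro integral_Markov_inequality_measure[where A = "{}"])
      (auto intro!: sum_nonneg)
  also have "measure_pmf.expectation P ?X = (\<Sum>v<n. measure_pmf.prob P (A v))"
    using int by (subst Bochner_Integration.integral_sum) auto
  also have "\<dots> \<le> n * b"
    using sum_bounded_above[of "{..<n}" "\<lambda>v. measure_pmf.prob P (A v)" b] assms(1) by simp
  finally show ?thesis using assms(2) by (simp add: X divide_right_mono)
qed

section \<open>Deviations of the estimates from their means\<close>

definition late_dev ::
  "nat \<Rightarrow> labeling \<Rightarrow> nat \<Rightarrow> (nat \<Rightarrow> nat) \<Rightarrow> (nat \<Rightarrow> nat \<times> nat) \<Rightarrow> nat \<Rightarrow> nat \<Rightarrow> real" where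
  "late_dev n lab q x \<omega> v j =
     \<bar>(\<Sum>i<q. real_of_int (late_term n lab v j (x (fst (\<omega> i))) (fst (\<omega> i)))) -
      real q * ((\<Sum>u<n. real_of_int (late_term n lab v j (x u) u)) / n)\<bar>"

definition early_dev ::
  "nat \<Rightarrow> labeling \<Rightarrow> nat \<Rightarrow> (nat \<Rightarrow> nat) \<Rightarrow> (nat \<Rightarrow> nat \<times> nat) \<Rightarrow> nat \<Rightarrow> nat \<Rightarrow> real" where
  "early_dev n lab q y \<omega> v j =
     \<bar>(\<Sum>i<q. real_of_int (early_term n lab v j y (fst (\<omega> ((v + 1) * q + i))))) -
      real q * ((\<Sum>u<n. real_of_int (early_term n lab v j y u)) / n)\<bar>"

definition hits_dev ::
  "nat \<Rightarrow> labeling \<Rightarrow> nat \<Rightarrow> nat \<Rightarrow> (nat \<Rightarrow> nat) \<Rightarrow> (nat \<Rightarrow> nat \<times> nat) \<Rightarrow> real" where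
  "hits_dev n lab q M y \<omega> =
     \<bar>real (hits n lab ((n + 1) * q) (fst \<circ> \<omega>) (snd \<circ> \<omega>) y M) -
      real M * (real_of_int (agree_pairs n lab y) / n\<^sup>2)\<bar>"

text \<open>The labeling for the guess that is right on the first sample. The algorithm does not
  know \<open>x\<close>, but by \<open>ex_digits\<close> it tries this guess among the
  others.\<close>

abbreviation guided :: "nat \<Rightarrow> labeling \<Rightarrow> nat \<Rightarrow> nat \<Rightarrow> (nat \<Rightarrow> nat) \<Rightarrow> (nat \<Rightarrow> nat \<times> nat) \<Rightarrow> nat \<Rightarrow> nat \<Rightarrow> nat" where
  "guided n lab k q x \<omega> \<equiv> greedy n lab k q (fst \<circ> \<omega>) (x \<circ> fst \<circ> \<omega>)"

definition bad :: "nat \<Rightarrow> labeling \<Rightarrow> nat \<Rightarrow> nat \<Rightarrow> real \<Rightarrow> (nat \<Rightarrow> nat) \<Rightarrow> (nat \<Rightarrow> nat \<times> nat) \<Rightarrow> nat \<Rightarrow> bool" where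
  "bad n lab k q t x \<omega> v \<longleftrightarrow> (\<exists>j<k. late_dev n lab q x \<omega> v j \<ge> t * q \<or>
     early_dev n lab q (guided n lab k q x \<omega> v) \<omega> v j \<ge> t * q)"

lemma sum_shift: "(\<Sum>i<q. f (m + i)) = (\<Sum>i\<in>{m..<m + q}. f i)"
  for f :: "nat \<Rightarrow> 'a :: comm_monoid_add"
  using sum.shift_bounds_nat_ivl[of f 0 m q] by (simp add: add.commute atLeast0LessThan)

lemma abs_late_term: "\<bar>real_of_int (late_term n lab v j c u)\<bar> \<le> 1"
  and abs_early_term: "\<bar>real_of_int (early_term n lab v j y u)\<bar> \<le> 1"
  by (auto simp: late_term_def early_term_def sgn_edge_def)

text \<open>\<open>x\<close> is fixed before the drawing, so the same \<open>q\<close> samples can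
  serve all vertices and clusters.\<close>

lemma prob_late_dev:
  fixes t :: real
  assumes "n \<ge> 1" "q \<ge> 1" "t \<ge> 0" "q \<le> N"
  shows "measure_pmf.prob (Pi_pmf {..<N} d (\<lambda>_. sample_pmf n)) {\<omega>. late_dev n lab q x \<omega> v j \<ge> t * q}
    \<le> 2 * exp (- (q * t\<^sup>2 / 2))"
proof -
  let ?f = "\<lambda>z :: nat \<times> nat. real_of_int (late_term n lab v j (x (fst z)) (fst z))"
  have "{..<q} \<noteq> {}" using assms by (auto simp: lessThan_empty_iff)
  then have "measure_pmf.prob (Pi_pmf {..<N} d (\<lambda>_. sample_pmf n))
      {\<omega>. \<bar>(\<Sum>i\<in>{..<q}. ?f (\<omega> i)) - card {..<q} * measure_pmf.expectation (sample_pmf n) ?f\<bar>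
         \<ge> t * card {..<q}} \<le> 2 * exp (- (card {..<q} * t\<^sup>2 / 2))"
    using assms by (intro Hoeffding_block[where F = "\<lambda>_. ?f" and B = "{..<q}"] abs_late_term) auto
  then show ?thesis
    using expectation_sample_fst[OF assms(1), of "\<lambda>u. real_of_int (late_term n lab v j (x u) u)"]
    by (simp add: late_dev_def)
qed

text \<open>The labels being estimated are random here, but by \<open>greedy_cong\<close> they are
  determined by the samples in front of the block of \<open>v\<close>, so conditioning on the rest
  makes them constant.\<close>

lemma prob_early_dev:
  fixes t :: real
  assumes "n \<ge> 1" "q \<ge> 1" "t \<ge> 0" "(v + 2) * q \<le> N"
  shows "measure_pmf.prob (Pi_pmf {..<N} d (\<lambda>_. sample_pmf n))
      {\<omega>. early_dev n lab q (guided n lab k q x \<omega> v) \<omega> v j \<ge> t * q} \<le> 2 * exp (- (q * t\<^sup>2 / 2))"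
proof -
  let ?F = "\<lambda>\<omega> (z :: nat \<times> nat). real_of_int (early_term n lab v j (guided n lab k q x \<omega> v) (fst z))"
  let ?B = "{(v + 1) * q..<(v + 1) * q + q}"
  have "measure_pmf.prob (Pi_pmf {..<N} d (\<lambda>_. sample_pmf n))
      {\<omega>. \<bar>(\<Sum>i\<in>?B. ?F \<omega> (\<omega> i)) - card ?B * measure_pmf.expectation (sample_pmf n) (?F \<omega>)\<bar>
         \<ge> t * card ?B} \<le> 2 * exp (- (card ?B * t\<^sup>2 / 2))"
  proof (rule Hoeffding_block[where F = ?F and B = ?B])
    show "\<bar>?F \<omega> z\<bar> \<le> 1" for \<omega> z by (rule abs_early_term)
    show "?B \<subseteq> {..<N}" using assms(4) by auto
    show "?B \<noteq> {}" using assms(2) by simp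
    fix \<omega> \<omega>' :: "nat \<Rightarrow> nat \<times> nat" assume eq: "\<And>i. i \<notin> ?B \<Longrightarrow> \<omega> i = \<omega>' i"
    have "\<omega> i = \<omega>' i" if "i < (v + 1) * q" for i
      using that by (intro eq) simp
    then have "guided n lab k q x \<omega> v = guided n lab k q x \<omega>' v"
      by (intro greedy_cong) (auto simp: trans_less_add1)
    then show "?F \<omega> = ?F \<omega>'" by simp
  qed (use assms in auto)
  moreover have "early_dev n lab q (guided n lab k q x \<omega> v) \<omega> v j =
      \<bar>(\<Sum>i\<in>?B. ?F \<omega> (\<omega> i)) - card ?B * measure_pmf.expectation (sample_pmf n) (?F \<omega>)\<bar>" for \<omega>
    using sum_shift[of "\<lambda>i. ?F \<omega> (\<omega> i)" "(v + 1) * q" q]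
      expectation_sample_fst[OF assms(1),
        of "\<lambda>u. real_of_int (early_term n lab v j (guided n lab k q x \<omega> v) u)"]
    unfolding early_dev_def by (simp only: card_atLeastLessThan add_diff_cancel_left')
  ultimately show ?thesis by simp
qed

lemma real_hits:
  "real (hits n lab E W W' y m) = (\<Sum>i<m. of_bool (agree n lab y (W (E + i)) (W' (E + i))))"
  unfolding hits_def of_nat_sum by (intro sum.cong) auto

text \<open>The guess \<open>g\<close> is fixed: a labeling selected by its hits would not be
  independent of the test block. Hence the union bound over all guesses in
  \<open>prob_good\<close>.\<close>

lemma prob_hits_dev:
  fixes t :: real
  assumes "n \<ge> 1" "M \<ge> 1" "t \<ge> 0" "(n + 1) * q + M \<le> N"
  shows "measure_pmf.prob (Pi_pmf {..<N} d (\<lambda>_. sample_pmf n))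
      {\<omega>. hits_dev n lab q M (greedy n lab k q (fst \<circ> \<omega>) g n) \<omega> \<ge> t * M} \<le> 2 * exp (- (M * t\<^sup>2 / 2))"
proof -
  let ?y = "\<lambda>\<omega>. greedy n lab k q (fst \<circ> \<omega>) g n"
  let ?F = "\<lambda>\<omega> z. of_bool (agree n lab (?y \<omega>) (fst z) (snd z)) :: real"
  let ?B = "{(n + 1) * q..<(n + 1) * q + M}"
  have "measure_pmf.prob (Pi_pmf {..<N} d (\<lambda>_. sample_pmf n))
      {\<omega>. \<bar>(\<Sum>i\<in>?B. ?F \<omega> (\<omega> i)) - card ?B * measure_pmf.expectation (sample_pmf n) (?F \<omega>)\<bar>
         \<ge> t * card ?B} \<le> 2 * exp (- (card ?B * t\<^sup>2 / 2))"
  proof (rule Hoeffding_block[where F = ?F and B = ?B])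
    show "?B \<subseteq> {..<N}" using assms(4) by auto
    show "?B \<noteq> {}" using assms(2) by simp
    fix \<omega> \<omega>' :: "nat \<Rightarrow> nat \<times> nat" assume eq: "\<And>i. i \<notin> ?B \<Longrightarrow> \<omega> i = \<omega>' i"
    have "\<omega> i = \<omega>' i" if "i < (n + 1) * q" for i
      using that by (intro eq) simp
    then have "?y \<omega> = ?y \<omega>'"
      by (intro greedy_cong) auto
    then show "?F \<omega> = ?F \<omega>'" by simp
  qed (use assms in auto)
  moreover have "hits_dev n lab q M (?y \<omega>) \<omega> =
      \<bar>(\<Sum>i\<in>?B. ?F \<omega> (\<omega> i)) - card ?B * measure_pmf.expectation (sample_pmf n) (?F \<omega>)\<bar>" for \<omega>
    using sum_shift[of "\<lambda>i. ?F \<omega> (\<omega> i)" "(n + 1) * q" M]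
      expectation_sample[OF assms(1), of "\<lambda>u w. of_bool (agree n lab (?y \<omega>) u w)"]
    unfolding hits_dev_def real_hits agree_pairs_def
    by (simp only: card_atLeastLessThan add_diff_cancel_left' o_apply of_int_sum of_int_of_bool)
  ultimately show ?thesis by simp
qed

lemma prob_bad:
  fixes t :: real
  assumes "n \<ge> 1" "q \<ge> 1" "t \<ge> 0" "(v + 2) * q \<le> N"
  shows "measure_pmf.prob (Pi_pmf {..<N} d (\<lambda>_. sample_pmf n)) {\<omega>. bad n lab k q t x \<omega> v}
    \<le> 4 * real k * exp (- (q * t\<^sup>2 / 2))"
proof -
  let ?P = "Pi_pmf {..<N} d (\<lambda>_. sample_pmf n)"
  let ?L = "\<lambda>j. {\<omega>. late_dev n lab q x \<omega> v j \<ge> t * q}"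
  let ?E = "\<lambda>j. {\<omega>. early_dev n lab q (guided n lab k q x \<omega> v) \<omega> v j \<ge> t * q}"
  have N: "q \<le> N" using assms(4) by simp
  have "measure_pmf.prob ?P (?L j \<union> ?E j) \<le> 2 * exp (- (q * t\<^sup>2 / 2)) + 2 * exp (- (q * t\<^sup>2 / 2))" for j
    by (rule order_trans[OF measure_Un_le add_mono[OF prob_late_dev[OF assms(1-3) N] prob_early_dev[OF assms]]])
      auto
  then have "(\<Sum>j<k. measure_pmf.prob ?P (?L j \<union> ?E j)) \<le> k * (4 * exp (- (q * t\<^sup>2 / 2)))"
    using sum_bounded_above[of "{..<k}" "\<lambda>j. measure_pmf.prob ?P (?L j \<union> ?E j)"] by simp
  moreover have "{\<omega>. bad n lab k q t x \<omega> v} = (\<Union>j<k. ?L j \<union> ?E j)"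
    by (auto simp: bad_def)
  moreover have "measure_pmf.prob ?P (\<Union>j<k. ?L j \<union> ?E j) \<le> (\<Sum>j<k. measure_pmf.prob ?P (?L j \<union> ?E j))"
    by (intro measure_pmf.finite_measure_subadditive_finite) auto
  ultimately show ?thesis by simp
qed

definition good :: "nat \<Rightarrow> labeling \<Rightarrow> nat \<Rightarrow> nat \<Rightarrow> nat \<Rightarrow> nat \<Rightarrow> (nat \<Rightarrow> nat) \<Rightarrow> (nat \<Rightarrow> nat \<times> nat) \<Rightarrow> bool" where
  "good n lab k q M a x \<omega> \<longleftrightarrow>
     real (card {v. v < n \<and> bad n lab k q (1 / (20 * real a)) x \<omega> v}) < n / (10 * real a) \<and>
     (\<forall>h<k ^ q. hits_dev n lab q M (greedy n lab k q (fst \<circ> \<omega>) (digits k h) n) \<omega> < 1 / (10 * real a) * M)"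

text \<open>Half of \<delta> pays for too many bad vertices, by Hoeffding and then Markov, the other
  half for a misleading test of some guess.\<close>

lemma prob_good:
  assumes n: "n \<ge> 1" and k: "k \<ge> 2" and a: "a \<ge> 2" and L: "L \<ge> 1"
    and q: "q = 800 * (a * a * L)" and M: "M = (k + 3) * (q * q)"
    and \<delta>: "80 * real k * real a \<le> 2 ^ L * \<delta>"
  shows "measure_pmf.prob (Pi_pmf {..<(n + 1) * q + M} d (\<lambda>_. sample_pmf n)) {\<omega>. good n lab k q M a x \<omega>}
    \<ge> 1 - \<delta>"
proof -
  let ?P = "Pi_pmf {..<(n + 1) * q + M} d (\<lambda>_. sample_pmf n)"
  let ?t = "1 / (20 * real a)" and ?c = "n / (10 * real a)"
  let ?B = "{\<omega>. ?c \<le> real (card {v. v < n \<and> \<omega> \<in> {\<omega>. bad n lab k q ?t x \<omega> v}})}"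
  let ?H = "\<lambda>h. {\<omega>. hits_dev n lab q M (greedy n lab k q (fst \<circ> \<omega>) (digits k h) n) \<omega> \<ge> 1 / (10 * real a) * M}"
  have q1: "q \<ge> 1" and M1: "M \<ge> 1" using a L by (auto simp: q M)
  \<comment> \<open>\<open>L\<close> counts doublings, whereas Hoeffding's inequality has base e;
    the passage from 2 to e only helps.\<close>
  have eL: "exp (- real L) \<le> \<delta> / (80 * real k * real a)"
  proof -
    have "(2::real) ^ L \<le> exp 1 ^ L"
      using exp_ge_add_one_self[of 1] by (intro power_mono) auto
    then have "2 ^ L \<le> exp (real L)" by (simp add: exp_of_nat_mult[symmetric])
    then have "exp (- real L) \<le> 1 / 2 ^ L"
      by (simp add: exp_minus field_simps)
    also have "\<dots> \<le> \<delta> / (80 * real k * real a)"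
      using \<delta> a k by (simp add: field_simps)
    finally show ?thesis .
  qed
  have "measure_pmf.prob ?P ?B \<le> n * (4 * real k * exp (- (q * ?t\<^sup>2 / 2))) / ?c"
  proof (rule prob_many_le[where A = "\<lambda>v. {\<omega>. bad n lab k q ?t x \<omega> v}"])
    fix v assume "v < n"
    then have "(v + 2) * q \<le> (n + 1) * q" by (intro mult_right_mono) auto
    then show "measure_pmf.prob ?P {\<omega>. bad n lab k q ?t x \<omega> v} \<le> 4 * real k * exp (- (q * ?t\<^sup>2 / 2))"
      using n q1 by (intro prob_bad) auto
  qed (use n a in auto)
  \<comment> \<open>The origin of 800: it makes this exponent exactly \<open>L\<close>.\<close>
  also have "q * ?t\<^sup>2 / 2 = L"
    using a by (simp add: q power2_eq_square)
  also have "n * (4 * real k * exp (- real L)) / ?c = 40 * real k * real a * exp (- real L)"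
    using n a by (simp add: field_simps)
  also have "\<dots> \<le> 40 * real k * real a * (\<delta> / (80 * real k * real a))"
    using eL by (intro mult_left_mono) auto
  also have "\<dots> = \<delta> / 2"
    using k a by (simp add: field_simps)
  finally have B: "measure_pmf.prob ?P ?B \<le> \<delta> / 2" .
  have "measure_pmf.prob ?P (?H h) \<le> 2 * exp (- (M * (1 / (10 * real a))\<^sup>2 / 2))" for h
    using n M1 by (intro prob_hits_dev) auto
  then have "(\<Sum>h<k ^ q. measure_pmf.prob ?P (?H h)) \<le> real (k ^ q) * (2 * exp (- (M * (1 / (10 * real a))\<^sup>2 / 2)))"
    using sum_bounded_above[of "{..<k ^ q}" "\<lambda>h. measure_pmf.prob ?P (?H h)"] by simp
  \<comment> \<open>The origin of \<open>M\<close>: the exponent must outweigh the number of guesses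
    and leave \<open>L\<close> over. By \<open>k \<le> exp k\<close> there are at most
    \<open>exp (k * q)\<close> guesses, and \<open>4 * L * (k + 3) * q\<close> is at least
    \<open>k * q + L\<close>.\<close>
  also have "M * (1 / (10 * real a))\<^sup>2 / 2 = 4 * real L * (k + 3) * q"
    using a by (simp add: M power2_eq_square) (simp add: q)
  also have "real (k ^ q) * (2 * exp (- (4 * real L * (k + 3) * q))) \<le>
      exp (real k * q) * (2 * exp (- (real k * q + real L)))"
  proof (rule mult_mono)
    have "real k \<le> exp (real k)"
      using exp_ge_add_one_self[of "real k"] by linarith
    then have "real k ^ q \<le> exp (real k) ^ q" by (rule power_mono) simp
    then show "real (k ^ q) \<le> exp (real k * q)" by (simp add: exp_of_nat2_mult)
    have "k * q + L \<le> (k + 3) * q * L"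
    proof -
      have "k * q \<le> k * q * L" "L \<le> q * L" using L q1 by simp_all
      moreover have "(k + 3) * q * L = k * q * L + 3 * (q * L)" by (simp add: algebra_simps)
      ultimately show ?thesis by linarith
    qed
    then have "real (k * q + L) \<le> real ((k + 3) * q * L)" by (simp only: of_nat_le_iff)
    moreover have "0 \<le> real ((k + 3) * q * L)" by simp
    moreover have "4 * real L * (k + 3) * q = 4 * real ((k + 3) * q * L)"
      by (simp add: mult_ac)
    moreover have "real k * q + L = real (k * q + L)" by simp
    ultimately have "real k * q + L \<le> 4 * real L * (k + 3) * q" by linarith
    then show "2 * exp (- (4 * real L * (k + 3) * q)) \<le> 2 * exp (- (real k * q + real L))" by simp
  qed auto
  also have "\<dots> = 2 * exp (- real L)"
    by (simp add: exp_add[symmetric])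
  also have "\<dots> \<le> 2 * (\<delta> / (80 * real k * real a))"
    using eL by (rule mult_left_mono) simp
  also have "\<dots> \<le> \<delta> / 2"
  proof -
    have "0 < 80 * real k * real a" using k a by simp
    then have "0 < 2 ^ L * \<delta>" using \<delta> by linarith
    then have "0 < \<delta>" by (simp add: zero_less_mult_iff)
    moreover have "1 * 1 \<le> real k * real a" using k a by (intro mult_mono) auto
    ultimately show ?thesis by (simp add: field_simps)
  qed
  finally have "(\<Sum>h<k ^ q. measure_pmf.prob ?P (?H h)) \<le> \<delta> / 2" .
  moreover have "measure_pmf.prob ?P (\<Union>h<k ^ q. ?H h) \<le> (\<Sum>h<k ^ q. measure_pmf.prob ?P (?H h))"
    by (intro measure_pmf.finite_measure_subadditive_finite) auto
  ultimately have H: "measure_pmf.prob ?P (\<Union>h<k ^ q. ?H h) \<le> \<delta> / 2" by simp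
  have le: "measure_pmf.prob ?P (?B \<union> (\<Union>h<k ^ q. ?H h)) \<le> \<delta> / 2 + \<delta> / 2"
    by (rule order_trans[OF measure_Un_le add_mono[OF B H]]) auto
  have eq: "{\<omega>. good n lab k q M a x \<omega>} = space (measure_pmf ?P) - (?B \<union> (\<Union>h<k ^ q. ?H h))"
    by (auto simp: good_def not_le)
  have compl: "measure_pmf.prob ?P (space (measure_pmf ?P) - (?B \<union> (\<Union>h<k ^ q. ?H h))) =
      1 - measure_pmf.prob ?P (?B \<union> (\<Union>h<k ^ q. ?H h))"
    by (rule measure_pmf.prob_compl) simp
  show ?thesis unfolding eq compl using le by linarith
qed

section \<open>Correctness and running time\<close>

lemma le_of_estimates:
  fixes r r' f f' c :: real
  shows "r \<le> r' \<Longrightarrow> \<bar>r - f\<bar> \<le> c \<Longrightarrow> \<bar>r' - f'\<bar> \<le> c \<Longrightarrow> f \<le> f' + 2 * c"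
  by linarith

lemma abs_le_of_sum:
  fixes x y z c :: real
  shows "z = x + y \<Longrightarrow> \<bar>x\<bar> < c \<Longrightarrow> \<bar>y\<bar> < c \<Longrightarrow> \<bar>z\<bar> \<le> 2 * c"
  by linarith

lemma le_of_divide_le:
  fixes x y b c :: real
  shows "x / b \<le> y / b + 1 / c \<Longrightarrow> 0 < b \<Longrightarrow> x \<le> y + b / c"
  using mult_left_mono[of "x / b" "y / b + 1 / c" b] by (simp add: distrib_left)

text \<open>Both scores are within \<open>q / (10 * a)\<close> of \<open>q / n\<close> times the
  gains, so preferring the larger score costs at most twice this error, rescaled by
  \<open>n / q\<close>.\<close>

lemma gain_loss:
  assumes n: "n \<ge> 1" and a: "a \<ge> 1" and q: "q \<ge> 1" and v: "v < n"
    and x: "x v < k" and good: "\<not> bad n lab k q (1 / (20 * real a)) x \<omega> v"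
    and y_def: "y = guided n lab k q x \<omega> n" and y: "y v < k"
    and h_def: "h = (\<lambda>u. if u < v then y u else x u)"
  shows "real_of_int (gain n lab h v (x v)) \<le> real_of_int (gain n lab h v (y v)) + real n / (5 * real a)"
proof -
  let ?z = "guided n lab k q x \<omega> v"
  let ?L = "\<lambda>j. \<Sum>u<n. real_of_int (late_term n lab v j (x u) u)"
  let ?E = "\<lambda>j. \<Sum>u<n. real_of_int (early_term n lab v j ?z u)"
  let ?S = "\<lambda>j. score n lab q (fst \<circ> \<omega>) (x \<circ> fst \<circ> \<omega>) ?z v q j"
  \<comment> \<open>The label of a placed vertex never changes, so the final labels may replace
    those known when \<open>v\<close> was placed.\<close>
  have early: "early_term n lab v j y u = early_term n lab v j ?z u" for j u
  proof (cases "u < v")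
    case True
    then have "y u = ?z u"
      unfolding y_def using v by (intro greedy_stable) auto
    then show ?thesis by (simp add: early_term_def)
  qed (simp add: early_term_def)
  have T: "real_of_int (gain n lab h v j) = ?L j + ?E j" for j
    unfolding h_def gain_hybrid early by (simp add: sum.distrib)
  have S: "\<bar>real_of_int (?S j) - real q * ((?L j + ?E j) / n)\<bar> \<le> real q / (10 * real a)" if "j < k" for j
  proof -
    have "late_dev n lab q x \<omega> v j < 1 / (20 * real a) * q"
      "early_dev n lab q ?z \<omega> v j < 1 / (20 * real a) * q"
      using good that unfolding bad_def by (auto simp: not_le)
    moreover have "real_of_int (?S j) - real q * ((?L j + ?E j) / n) =
      ((\<Sum>i<q. real_of_int (late_term n lab v j (x (fst (\<omega> i))) (fst (\<omega> i)))) - real q * (?L j / n)) +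
      ((\<Sum>i<q. real_of_int (early_term n lab v j ?z (fst (\<omega> ((v + 1) * q + i))))) - real q * (?E j / n))"
      unfolding score_def by (simp add: sum.distrib add_divide_distrib distrib_left)
    ultimately have "\<bar>real_of_int (?S j) - real q * ((?L j + ?E j) / n)\<bar> \<le> 2 * (1 / (20 * real a) * q)"
      unfolding late_dev_def early_dev_def by (intro abs_le_of_sum)
    then show ?thesis by simp
  qed
  have "?S (x v) \<le> ?S (y v)"
    unfolding y_def using score_greedy_ge[OF v x] .
  then have "real_of_int (?S (x v)) \<le> real_of_int (?S (y v))" by simp
  then have "real q * ((?L (x v) + ?E (x v)) / n) \<le> real q * ((?L (y v) + ?E (y v)) / n) + 2 * (real q / (10 * real a))"
    using S[OF x] S[OF y] by (rule le_of_estimates)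
  then have "real q * ((?L (x v) + ?E (x v)) / n) \<le> real q * ((?L (y v) + ?E (y v)) / n + 1 / (5 * real a))"
    by (simp add: distrib_left)
  then have "(?L (x v) + ?E (x v)) / n \<le> (?L (y v) + ?E (y v)) / n + 1 / (5 * real a)"
    using q by (simp only: mult_le_cancel_left_pos of_nat_0_less_iff)
  then have "?L (x v) + ?E (x v) \<le> ?L (y v) + ?E (y v) + n / (5 * real a)"
    using le_of_divide_le n by fastforce
  then show ?thesis by (simp add: T)
qed

lemma good_guided:
  assumes n: "n \<ge> 1" and k: "k \<ge> 2" and a: "a \<ge> 1" and q: "q \<ge> 1"
    and x: "\<And>u. u < n \<Longrightarrow> x u < k" and good: "good n lab k q M a x \<omega>"
    and y: "\<And>u. u < n \<Longrightarrow> guided n lab k q x \<omega> n u < k"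
  shows "real_of_int (agree_pairs n lab x) \<le>
     real_of_int (agree_pairs n lab (guided n lab k q x \<omega> n)) + 4 * (real n)\<^sup>2 / (5 * real a)"
proof -
  let ?y = "guided n lab k q x \<omega> n"
  let ?bad = "bad n lab k q (1 / (20 * real a)) x \<omega>"
  \<comment> \<open>A bad vertex loses at most \<open>2 * n\<close>, because gains are at most
    \<open>n\<close> in absolute value.\<close>
  define loss where "loss v = (if ?bad v then 2 * real n else 0) + n / (5 * real a)" for v
  have "real_of_int (agree_pairs n lab x) \<le> real_of_int (agree_pairs n lab ?y) + 2 * (\<Sum>v<n. loss v)"
  proof (rule agree_pairs_diff)
    fix v assume v: "v < n"
    let ?h = "\<lambda>u. if u < v then ?y u else x u"
    show "real_of_int (gain n lab ?h v (x v)) \<le> real_of_int (gain n lab ?h v (?y v)) + loss v"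
    proof (cases "?bad v")
      case True
      have "\<bar>real_of_int (gain n lab ?h v j)\<bar> \<le> real n" for j
        using abs_gain_le[of n lab ?h v j] by linarith
      from this[of "x v"] this[of "?y v"]
      have "real_of_int (gain n lab ?h v (x v)) \<le> real_of_int (gain n lab ?h v (?y v)) + 2 * real n"
        by linarith
      also have "\<dots> \<le> real_of_int (gain n lab ?h v (?y v)) + loss v"
        using True by (simp add: loss_def)
      finally show ?thesis .
    next
      case False
      then have "loss v = n / (5 * real a)" by (simp add: loss_def)
      then show ?thesis
        using gain_loss[OF n a q v x[OF v] False refl y[OF v] refl] by (simp only:)
    qed
  qed
  also have "(\<Sum>v<n. loss v) = 2 * real n * real (card {v. v < n \<and> ?bad v}) + n * (n / (5 * real a))"
    by (simp add: loss_def sum.distrib sum.If_cases Int_def)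
  also have "\<dots> \<le> 2 * real n * (n / (10 * real a)) + n * (n / (5 * real a))"
    using good unfolding good_def by (intro add_right_mono mult_left_mono) auto
  also have "\<dots> = 2 * (real n)\<^sup>2 / (5 * real a)"
    using a by (simp add: field_simps power2_eq_square)
  finally show ?thesis by (simp add: o_def)
qed

lemma good_best_until:
  assumes n: "n \<ge> 1" and k: "k \<ge> 2" and a: "a \<ge> 1" and q: "q \<ge> 1" and M: "M \<ge> 1"
    and x: "\<And>u. u < n \<Longrightarrow> x u < k" and good: "good n lab k q M a x \<omega>"
    and \<omega>: "\<forall>i. fst (\<omega> i) < n \<and> snd (\<omega> i) < n"
    and best: "search.best_until n lab k q M (fst \<circ> \<omega>) (snd \<circ> \<omega>) (k ^ q) s"
  obtains y where "\<And>u. u < n \<Longrightarrow> arr s 0 u = y u" "\<And>u. u < n \<Longrightarrow> y u < k"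
    "real_of_int (agree_pairs n lab x) \<le> real_of_int (agree_pairs n lab y) + (real n)\<^sup>2 / real a"
proof -
  interpret search n lab k q M "fst \<circ> \<omega>" "snd \<circ> \<omega>"
    using \<omega> n k by unfold_locales auto
  have "k ^ q \<noteq> 0" using k by simp
  then obtain h where h: "h < k ^ q" "\<forall>u<n. arr s 0 u = lbl h u" "\<forall>i<k ^ q. hit_count i \<le> hit_count h"
    using best unfolding best_until_def by auto
  let ?y = "guided n lab k q x \<omega> n"
  obtain g where g: "g < k ^ q" "\<forall>i<q. digits k g i = (x \<circ> fst \<circ> \<omega>) i"
    using ex_digits[of q "x \<circ> fst \<circ> \<omega>" k] x \<omega> by auto
  have y: "lbl g = ?y"
    using g(2) by (intro greedy_cong) auto
  let ?F = "\<lambda>j. real_of_int (agree_pairs n lab (lbl j))"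
  have dev: "\<bar>real (hit_count j) - real M * (?F j / (real n)\<^sup>2)\<bar> < 1 / (10 * real a) * M" if "j < k ^ q" for j
    using good that unfolding good_def hits_dev_def by auto
  \<comment> \<open>\<open>h\<close> is the saved guess and \<open>g\<close> the right one; two test
    errors of \<open>M / (10 * a)\<close> use up the last fifth of the error allowed.\<close>
  have "real (hit_count g) \<le> real (hit_count h)" using h(3) g(1) by simp
  then have "real M * (?F g / (real n)\<^sup>2) \<le> real M * (?F h / (real n)\<^sup>2) + 2 * (1 / (10 * real a) * M)"
    using dev[OF g(1), THEN less_imp_le] dev[OF h(1), THEN less_imp_le] by (rule le_of_estimates)
  then have "real M * (?F g / (real n)\<^sup>2) \<le> real M * (?F h / (real n)\<^sup>2 + 1 / (5 * real a))"
    by (simp add: distrib_left)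
  then have "?F g / (real n)\<^sup>2 \<le> ?F h / (real n)\<^sup>2 + 1 / (5 * real a)"
    using M by (simp only: mult_le_cancel_left_pos of_nat_0_less_iff)
  then have sel: "?F g \<le> ?F h + (real n)\<^sup>2 / (5 * real a)"
    using n by (simp add: field_simps)
  have "real_of_int (agree_pairs n lab x) \<le> ?F g + 4 * (real n)\<^sup>2 / (5 * real a)"
    unfolding y by (rule good_guided[OF n k a q x good]) (simp_all add: greedy_less)
  also have "\<dots> \<le> ?F h + ((real n)\<^sup>2 / (5 * real a) + 4 * (real n)\<^sup>2 / (5 * real a))"
    using sel by simp
  also have "(real n)\<^sup>2 / (5 * real a) + 4 * (real n)\<^sup>2 / (5 * real a) = (real n)\<^sup>2 / real a"
    using a by (simp add: field_simps)
  finally have final: "real_of_int (agree_pairs n lab x) \<le> ?F h + (real n)\<^sup>2 / real a" .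
  show thesis
  proof (rule that[of "lbl h"])
    show "arr s 0 u = lbl h u" if "u < n" for u using h(2) that by blast
    show "lbl h u < k" if "u < n" for u using that by (rule greedy_less)
  qed (rule final)
qed

section \<open>Running time in terms of \<epsilon> and \<delta>\<close>

lemma ex_precision:
  assumes "\<epsilon> > 0" "\<delta> > 0"
  obtains a L where "precision k \<epsilon> \<delta> a L"
proof -
  obtain m where "1 < real m * \<epsilon>" using reals_Archimedean3[OF assms(1)] by blast
  then have "1 \<le> real (max 2 m) * \<epsilon>"
    using assms(1) by (smt (verit, best) max.cobounded2 mult_right_mono of_nat_mono)
  then have ex: "\<exists>a. 2 \<le> a \<and> 1 \<le> real a * \<epsilon>" by (intro exI[of _ "max 2 m"]) auto
  define a where "a = (LEAST a. 2 \<le> a \<and> 1 \<le> real a * \<epsilon>)"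
  have a: "2 \<le> a \<and> 1 \<le> real a * \<epsilon>"
    using LeastI_ex[OF ex] by (simp add: a_def)
  have a': "\<forall>i<a. 2 \<le> i \<longrightarrow> real i * \<epsilon> < 1"
  proof (intro allI impI)
    fix i assume "i < a" "2 \<le> i"
    then show "real i * \<epsilon> < 1"
      using not_less_Least[of i "\<lambda>a. 2 \<le> a \<and> 1 \<le> real a * \<epsilon>"] unfolding a_def by linarith
  qed
  obtain m where "80 * real k * real a / \<delta> < 2 ^ m"
    using real_arch_pow[of 2] by auto
  then have "80 * real k * real a \<le> 2 ^ m * \<delta>"
    using assms(2) by (simp add: field_simps)
  then have ex: "\<exists>l. 80 * real k * real a \<le> 2 ^ l * \<delta>" by blast
  define L where "L = (LEAST l. 80 * real k * real a \<le> 2 ^ l * \<delta>)"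
  have L: "80 * real k * real a \<le> 2 ^ L * \<delta>"
    using LeastI_ex[OF ex] by (simp add: L_def)
  have L': "\<forall>l<L. 2 ^ l * \<delta> < 80 * real k * real a"
    using not_less_Least[of _ "\<lambda>l. 80 * real k * real a \<le> 2 ^ l * \<delta>"] by (auto simp: L_def not_le)
  show thesis
    using a a' L L' by (intro that[of a L]) (simp only: precision_def simp_thms)
qed

text \<open>\<open>W\<close> dominates \<open>a\<close>, \<open>L\<close>, \<open>q\<close>,
  \<open>k\<close> and \<open>k ^ q\<close>, so each monomial of \<open>time_of\<close> is at most 4
  times \<open>n * W ^ 4\<close>. A fifth factor \<open>W\<close> absorbs the numerical
  coefficients, and \<open>5 * 800 = 4000\<close>.\<close>

lemma time_of_le:
  assumes n: "n \<ge> 1" and k: "k \<ge> 2" and a: "a \<ge> 2"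
    and q: "q = 800 * (a * a * L)" and M: "M = (k + 3) * (q * q)"
  shows "time_of k n a L q M \<le> n * k ^ (4000 * (a * a * (L + 1)))"
proof -
  \<comment> \<open>\<open>L + 1\<close> keeps \<open>Q\<close> at 13 or more even for
    \<open>L = 0\<close>, so that \<open>W\<close> is at least \<open>2 ^ 13 = 8192\<close>.\<close>
  define Q where "Q = 800 * (a * a * (L + 1))"
  define W where "W = k ^ Q"
  have "1 \<le> a * a" using a by (simp add: Suc_le_eq)
  have Q: "q \<le> Q" "a \<le> Q" "L \<le> Q" "13 \<le> Q"
  proof -
    show "q \<le> Q" by (simp add: q Q_def)
    have "a * 1 \<le> a * (a * (L + 1))" using a by (intro mult_le_mono2) (simp add: Suc_le_eq)
    then show "a \<le> Q" unfolding Q_def mult.assoc by linarith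
    have 1: "1 * (L + 1) \<le> a * a * (L + 1)" using \<open>1 \<le> a * a\<close> by (intro mult_le_mono1)
    have "Q = 800 * (a * a * (L + 1))" by (simp only: Q_def)
    with 1 have "800 * (L + 1) \<le> Q" by (simp only: mult_le_mono2 mult_1)
    then show "L \<le> Q" "13 \<le> Q" by simp_all
  qed
  have two: "2 ^ Q \<le> W" unfolding W_def using k by (rule power_mono) simp
  have "Q < 2 ^ Q" by (rule less_exp)
  then have W: "q \<le> W" "a \<le> W" "L \<le> W" using two Q by linarith+
  have "(2::nat) ^ 13 \<le> 2 ^ Q" using Q by (intro power_increasing) auto
  then have W13: "8192 \<le> W" using two by simp
  have kW: "k \<le> W" unfolding W_def using Q k by (metis One_nat_def Suc_leD le_trans one_le_numeral power_increasing power_one_right)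
  have kqW: "k ^ q \<le> W" unfolding W_def using Q k by (intro power_increasing) auto
  define X where "X = n * W ^ 4"
  have X: "1 \<le> X" "W \<le> X" "W * W \<le> X" "n \<le> X" "n * W \<le> X" "n * (W * W) \<le> X"
    "W * W * W \<le> X" "W * (W * W * W) \<le> X"
  proof -
    have p: "W ^ i \<le> W ^ 4" if "i \<le> 4" for i using that W13 by (intro power_increasing) auto
    have np: "n * W ^ i \<le> X" if "i \<le> 4" for i unfolding X_def using p[OF that] by simp
    have q: "W ^ i \<le> X" if "i \<le> 4" for i using np[OF that] n le_trans[of "1 * W ^ i" "n * W ^ i"] by simp
    show "1 \<le> X" "W \<le> X" "W * W \<le> X" "W * W * W \<le> X" "W * (W * W * W) \<le> X"
      using q[of 0] q[of 1] q[of 2] q[of 3] q[of 4] by (simp_all add: eval_nat_numeral mult.assoc)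
    show "n \<le> X" "n * W \<le> X" "n * (W * W) \<le> X"
      using np[of 0] np[of 1] np[of 2] by (simp_all add: eval_nat_numeral)
  qed
  have M': "M \<le> 4 * (W * W * W)"
  proof -
    have "(k + 3) * (q * q) \<le> (4 * W) * (W * W)"
      using kW W13 W by (intro mult_le_mono) auto
    then show ?thesis by (simp add: M mult.assoc)
  qed
  have b: "a * a \<le> X" "q * k \<le> X" "n * q \<le> X" "M \<le> 4 * X" "q \<le> X" "a \<le> X" "L \<le> X" "k \<le> X"
    using mult_le_mono[OF W(2) W(2)] mult_le_mono[OF W(1) kW] mult_le_mono2[OF W(1), of n] M' X W kW
    by linarith+
  have c: "k ^ q * (n * k) \<le> X" "k ^ q * (n * q) \<le> X" "k ^ q * n \<le> X" "k ^ q * M \<le> 4 * X"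
    "k ^ q * q \<le> X" "k ^ q \<le> X"
  proof -
    have "k ^ q * (n * k) \<le> W * (n * W)" using kqW kW by (intro mult_le_mono) auto
    then show "k ^ q * (n * k) \<le> X" using X(6) by (simp only: mult.left_commute[of W n W])
    have "k ^ q * (n * q) \<le> W * (n * W)" using kqW W by (intro mult_le_mono) auto
    then show "k ^ q * (n * q) \<le> X" using X(6) by (simp only: mult.left_commute[of W n W])
    have "k ^ q * n \<le> W * n" using kqW by (intro mult_le_mono) auto
    then show "k ^ q * n \<le> X" using X(5) by (simp only: mult.commute[of W n])
    \<comment> \<open>The term that calls for the fourth power: all guesses are tested, each on a
      number of pairs cubic in \<open>W\<close>.\<close>
    have "k ^ q * M \<le> W * (4 * (W * W * W))" using kqW M' by (intro mult_le_mono) auto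
    then show "k ^ q * M \<le> 4 * X" using X by simp
    have "k ^ q * q \<le> W * W" using kqW W by (intro mult_le_mono) auto
    then show "k ^ q * q \<le> X" using X by simp
    show "k ^ q \<le> X" using kqW X by simp
  qed
  have "time_of k n a L q M = 10 * a + 10 * L + 20 + 1 + (5 * a + 5 * (a * a) + 5 * q + 5 * k + 5 * n +
      5 * (q * k) + 11 * q + 6000 + 1 + (11 * (n * q) + 11 * q + 11 * M + 3 + 1 +
      (16 * (k ^ q * (n * k)) + 36 * (k ^ q * (n * q)) + 41 * (k ^ q * n) + 30 * (k ^ q * M) +
       14 * (k ^ q * q) + 30 * k ^ q + 5)))"
    by (simp add: time_of_def algebra_simps)
  also have "\<dots> \<le> 8192 * X"
    using b c X by linarith
  also have "\<dots> \<le> W * X" using W13 by simp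
  also have "\<dots> = n * W ^ 5" by (simp add: X_def eval_nat_numeral)
  also have "W ^ 5 = k ^ (4000 * (a * a * (L + 1)))"
    by (simp add: W_def Q_def power_mult[symmetric] mult_ac)
  finally show ?thesis .
qed

text \<open>Minimality in \<open>precision\<close> bounds both parameters. The caps make
  \<open>1 / (e * d)\<close> at least 2, so the base-2 logarithms \<open>u\<close> and
  \<open>w\<close> are at least 1 and their product absorbs their sum and the constants.\<close>

lemma precision_bounds:
  assumes prec: "precision k \<epsilon> \<delta> a L" and \<epsilon>: "\<epsilon> > 0" and \<delta>: "\<delta> > 0" and k: "k \<ge> 2"
  defines "e \<equiv> min \<epsilon> (1 / 2)" and "d \<equiv> min \<delta> 1"
  shows "real a \<le> 2 / e" "real L + 1 \<le> 48 * (ln (real k) * ln (1 / (e * d)))"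
proof -
  have e: "0 < e" "e \<le> 1 / 2" and d: "0 < d" "d \<le> 1"
    using \<epsilon> \<delta> by (auto simp: e_def d_def)
  have a2: "2 \<le> a" using prec unfolding precision_def by blast
  show a: "real a \<le> 2 / e"
  proof (cases "a = 2")
    case True
    then show ?thesis using e by (simp add: field_simps)
  next
    case False
    \<comment> \<open>Here \<open>a - 1\<close> failed the test of \<open>precision\<close>, which
      forces \<epsilon> below 1/2; so the cap is not active.\<close>
    then have "2 \<le> a - 1" "a - 1 < a" using a2 by auto
    then have *: "real (a - 1) * \<epsilon> < 1" using prec unfolding precision_def by blast
    have "2 * \<epsilon> \<le> real (a - 1) * \<epsilon>" using \<open>2 \<le> a - 1\<close> \<epsilon> by (intro mult_right_mono) auto
    then have "\<epsilon> < 1 / 2" using * by simp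
    then have "e = \<epsilon>" by (simp add: e_def)
    then have "real a * e \<le> 2" using * \<open>\<epsilon> < 1 / 2\<close> a2 by (simp add: of_nat_diff algebra_simps)
    then show ?thesis using e by (simp add: field_simps)
  qed
  define u where "u = ln (real k) / ln 2"
  define w where "w = ln (1 / (e * d)) / ln 2"
  have l2: "ln 2 \<ge> (1 / 2 :: real)" using ln2_ge_two_thirds by simp
  then have l2': "ln 2 > (0 :: real)" by simp
  have "e * d \<le> 1 / 2 * 1" using e d by (intro mult_mono) auto
  then have "2 \<le> 1 / (e * d)" using e d by (simp add: field_simps)
  then have w: "1 \<le> w" unfolding w_def using l2' e d by (simp add: field_simps del: ln_mult)
  have u: "1 \<le> u" unfolding u_def using l2' k by simp
  have "real L \<le> 9 + u + w"
  proof (cases L)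
    case 0
    then show ?thesis using u w by simp
  next
    case (Suc l)
    then have "l < L" by simp
    then have "2 ^ l * \<delta> < 80 * real k * real a"
      using prec unfolding precision_def by blast
    moreover have "2 ^ l * d \<le> 2 ^ l * \<delta>" by (simp add: d_def)
    moreover have "80 * real k * real a \<le> 80 * real k * (2 / e)"
      using a by (intro mult_left_mono) auto
    ultimately have "2 ^ l * d < 80 * real k * (2 / e)" by linarith
    then have "2 ^ l * d < 160 * real k / e" by simp
    then have "2 ^ l * d / d < 160 * real k / e / d"
      using d(1) by (rule divide_strict_right_mono)
    then have "2 ^ l < 160 * real k / e / d"
      using d by simp
    \<comment> \<open>160 is rounded up to a power of 2 so that it contributes 8 to the base-2
      logarithm.\<close>
    also have "160 * real k / e / d \<le> 2 ^ 8 * real k * (1 / (e * d))"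
      using e d by (simp add: divide_right_mono mult_right_mono)
    finally have "ln (2 ^ l) < ln (2 ^ 8 * real k * (1 / (e * d)))"
      using k e d by (subst ln_less_cancel_iff) auto
    also have "ln (2 ^ 8 * real k * (1 / (e * d))) = ln (2 ^ 8 * real k) + ln (1 / (e * d))"
      using k e d by (intro ln_mult_pos) auto
    also have "ln (2 ^ 8 * real k) = ln (2 ^ 8) + ln (real k)"
      using k by (intro ln_mult_pos) auto
    also have "ln (2 ^ 8 :: real) = 8 * ln 2" using ln_realpow[of 2 8] by simp
    also have "ln (2 ^ l :: real) = l * ln 2" by (simp add: ln_realpow)
    also have "8 * ln 2 + ln (real k) + ln (1 / (e * d)) = (8 + u + w) * ln 2"
      unfolding u_def w_def using l2' by (simp add: distrib_right)
    finally have "real l < 8 + u + w" using l2' by (simp add: mult_less_cancel_right_pos)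
    then show ?thesis using Suc by simp
  qed
  moreover have "1 \<le> u * w" "u \<le> u * w" "w \<le> u * w"
    using u w mult_mono[of 1 u 1 w] mult_left_mono[of 1 w u] mult_right_mono[of 1 u w] by auto
  \<comment> \<open>From \<open>10 + u + w\<close>, each summand being compared with the product.
    The factor 4 that turns 12 into 48 comes from using \<open>ln 2 \<ge> 1 / 2\<close>
    twice.\<close>
  ultimately have "real L + 1 \<le> 12 * (u * w)" by linarith
  also have "u * w \<le> 4 * (ln (real k) * ln (1 / (e * d)))"
  proof -
    have "1 / 4 \<le> ln 2 * (ln 2 :: real)" using mult_mono[OF l2 l2] by simp
    have "u * w * (1 / 4) \<le> u * w * (ln 2 * ln 2)"
      using u w \<open>1 / 4 \<le> ln 2 * ln 2\<close> by (intro mult_left_mono) auto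
    also have "\<dots> = ln (real k) * ln (1 / (e * d))"
      unfolding u_def w_def using l2' by simp
    finally show ?thesis by simp
  qed
  finally show "real L + 1 \<le> 48 * (ln (real k) * ln (1 / (e * d)))" by simp
qed

lemma time_bound_program:
  assumes prec: "precision k \<epsilon> \<delta> a L" and \<epsilon>: "\<epsilon> > 0" and \<delta>: "\<delta> > 0" and k: "k \<ge> 2" and n: "n \<ge> 1"
    and q: "q = 800 * (a * a * L)" and M: "M = (k + 3) * (q * q)"
  shows "real (time_of k n a L q M) \<le> time_bound 768000 k n (min \<epsilon> (1 / 2)) (min \<delta> 1)"
proof -
  define e d where "e = min \<epsilon> (1 / 2)" and "d = min \<delta> 1"
  have e: "0 < e" "e \<le> 1 / 2" using \<epsilon> by (auto simp: e_def)
  have a2: "2 \<le> a" using prec unfolding precision_def by blast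
  note b = precision_bounds[OF prec \<epsilon> \<delta> k, folded e_def d_def]
  have "real a * real a \<le> 2 / e * (2 / e)"
    using e by (intro mult_mono b(1)) auto
  then have "real a * real a * (real L + 1) \<le> 2 / e * (2 / e) * (48 * (ln (real k) * ln (1 / (e * d))))"
    using e by (intro mult_mono[OF _ b(2)]) auto
  then have "4000 * (real a * real a * (real L + 1)) \<le>
      4000 * (2 / e * (2 / e) * (48 * (ln (real k) * ln (1 / (e * d)))))"
    by (rule mult_left_mono) simp
  \<comment> \<open>The final constant is \<open>4000 * 2 * 2 * 48\<close>.\<close>
  also have "4000 * (2 / e * (2 / e) * (48 * (ln (real k) * ln (1 / (e * d))))) =
      768000 * (1 / e\<^sup>2 * ln (real k) * ln (1 / (e * d)))"
    by (simp add: power2_eq_square)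
  finally have exponent: "real (4000 * (a * a * (L + 1))) \<le> 768000 * (1 / e\<^sup>2 * ln (real k) * ln (1 / (e * d)))"
    by (simp only: of_nat_mult of_nat_add of_nat_numeral of_nat_1)
  have "real (time_of k n a L q M) \<le> real (n * k ^ (4000 * (a * a * (L + 1))))"
    using time_of_le[OF n k a2 q M] by (simp only: of_nat_le_iff)
  also have "\<dots> = real n * real k powr (real (4000 * (a * a * (L + 1))))"
    using k by (subst powr_realpow) auto
  also have "\<dots> \<le> real n / e * real k powr (768000 * (1 / e\<^sup>2 * ln (real k) * ln (1 / (e * d))))"
  proof (intro mult_mono)
    show "real n \<le> real n / e" using e n by (simp add: field_simps)
    show "real k powr real (4000 * (a * a * (L + 1))) \<le>
        real k powr (768000 * (1 / e\<^sup>2 * ln (real k) * ln (1 / (e * d))))"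
      using exponent k by (intro powr_mono) auto
  qed (use e in auto)
  finally show ?thesis by (simp add: time_bound_def e_def d_def)
qed

lemma pends_correct:
  assumes k: "k \<ge> 2" and n: "n \<ge> 1" and \<epsilon>: "\<epsilon> > 0" and \<delta>: "\<delta> > 0" and prec: "precision k \<epsilon> \<delta> a L"
    and q: "q = 800 * (a * a * L)" and M: "M = (k + 3) * (q * q)"
  shows "pends n lab (program k) (init_memory n \<epsilon> \<delta>) (time_of k n a L q M) (1 - \<delta>)
    (\<lambda>s. k_clustering k {..<n} (output_clustering n s) \<and>
       real (agreements lab {..<n} (output_clustering n s)) \<ge> real (OPT k lab {..<n}) - \<epsilon> * (real n)\<^sup>2 / 2)"
proof (cases "\<delta> \<ge> 1")
  case True
  \<comment> \<open>The probability claim is void here, but the program must still halt in time; the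
    impossible event serves as \<open>G\<close>.\<close>
  then show ?thesis
    by (intro pends_program[OF k n prec q M, where G = "\<lambda>_. False"]) auto
next
  case False
  have a2: "2 \<le> a" and ea: "1 \<le> real a * \<epsilon>" and L80: "80 * real k * real a \<le> 2 ^ L * \<delta>"
    using prec unfolding precision_def by blast+
  \<comment> \<open>With \<open>L = 0\<close> no samples would be drawn; this cannot happen for
    \<delta> below 1.\<close>
  have L: "L \<ge> 1"
  proof (rule ccontr)
    assume "\<not> L \<ge> 1"
    then have "L = 0" by simp
    then have "80 * real k * real a < 1" using L80 False by simp
    moreover have "1 * 1 \<le> real k * real a" using k a2 by (intro mult_mono) auto
    ultimately show False by simp
  qed
  have q1: "q \<ge> 1" and M1: "M \<ge> 1" using a2 L by (auto simp: q M)
  obtain x where x: "\<And>u. u < n \<Longrightarrow> x u < k" "2 * int (OPT k lab {..<n}) = agree_pairs n lab x"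
    using OPT_labels[of n k lab] n k by auto
  show ?thesis
  proof (rule pends_program[OF k n prec q M, where G = "good n lab k q M a x"])
    show "1 - \<delta> \<le> measure_pmf.prob (Pi_pmf {..<(n + 1) * q + M} (0, 0) (\<lambda>_. sample_pmf n))
      {\<omega>. good n lab k q M a x \<omega>}"
      by (rule prob_good[OF n k a2 L q M L80])
    fix \<omega> s assume \<omega>: "\<forall>i. fst (\<omega> i) < n \<and> snd (\<omega> i) < n" "good n lab k q M a x \<omega>"
      "search.best_until n lab k q M (fst \<circ> \<omega>) (snd \<circ> \<omega>) (k ^ q) s"
    obtain y where y: "\<And>u. u < n \<Longrightarrow> arr s 0 u = y u" "\<And>u. u < n \<Longrightarrow> y u < k"
      "real_of_int (agree_pairs n lab x) \<le> real_of_int (agree_pairs n lab y) + (real n)\<^sup>2 / real a"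
      using good_best_until[OF n k _ q1 M1 x(1) \<omega>(2,1,3)] a2 by auto
    have cl: "k_clustering k {..<n} (output_clustering n s)"
      by (rule output_clustering_labels(1)) (use y in auto)
    have ag: "2 * int (agreements lab {..<n} (output_clustering n s)) = agree_pairs n lab y"
      by (rule output_clustering_labels(2)) (use y in auto)
    \<comment> \<open>An error of \<open>n^2 / a\<close> ordered pairs is at most
      \<open>\<epsilon> * n^2\<close>, which is half as many edges.\<close>
    have "1 / real a \<le> \<epsilon>" using ea a2 by (simp add: field_simps)
    then have "(real n)\<^sup>2 * (1 / real a) \<le> (real n)\<^sup>2 * \<epsilon>" by (intro mult_left_mono) auto
    moreover have "real_of_int (agree_pairs n lab x) = 2 * real (OPT k lab {..<n})"
      "real_of_int (agree_pairs n lab y) = 2 * real (agreements lab {..<n} (output_clustering n s))"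
      unfolding x(2)[symmetric] ag[symmetric] by simp_all
    ultimately have "2 * real (OPT k lab {..<n}) \<le>
        2 * real (agreements lab {..<n} (output_clustering n s)) + \<epsilon> * (real n)\<^sup>2"
      using y(3) by (simp add: mult.commute)
    then show "k_clustering k {..<n} (output_clustering n s) \<and>
       real (agreements lab {..<n} (output_clustering n s)) \<ge> real (OPT k lab {..<n}) - \<epsilon> * (real n)\<^sup>2 / 2"
      using cl by simp
  qed
qed

(* The parameters are capped in the time bound (only there) because the formula is meaningful only
   for \<epsilon>\<delta> bounded away from 1: it tends to n as \<epsilon> and \<delta> tend to 1, and to 0 as \<epsilon> grows.
   For \<epsilon> \<le> 1/2 and \<delta> \<le> 1 the caps have no effect. *)
theorem theorem4:
  "\<exists>C::real. C > 0 \<and> (\<forall>k::nat. k \<ge> 2 \<longrightarrow> (\<exists>prog::com.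
     \<forall>(n::nat) (lab::labeling) (\<epsilon>::real) (\<delta>::real). n \<ge> 1 \<longrightarrow> \<epsilon> > 0 \<longrightarrow> \<delta> > 0 \<longrightarrow>
       (\<exists>t::nat. real t \<le> time_bound C k n (min \<epsilon> (1/2)) (min \<delta> 1) \<and>
          halts_within prog n lab \<epsilon> \<delta> t \<and>
          measure_pmf.prob (run_on_input prog n lab \<epsilon> \<delta> t)
            {(c, s). k_clustering k {..<n} (output_clustering n s) \<and>
               real (agreements lab {..<n} (output_clustering n s))
                 \<ge> real (OPT k lab {..<n}) - \<epsilon> * (real n)\<^sup>2 / 2} \<ge> 1 - \<delta>)))"
proof (intro exI[of _ 768000] conjI allI impI)
  fix k :: nat assume k: "k \<ge> 2"
  show "\<exists>prog. \<forall>n lab \<epsilon> \<delta>. n \<ge> 1 \<longrightarrow> \<epsilon> > 0 \<longrightarrow> \<delta> > 0 \<longrightarrow>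
       (\<exists>t. real t \<le> time_bound 768000 k n (min \<epsilon> (1/2)) (min \<delta> 1) \<and>
          halts_within prog n lab \<epsilon> \<delta> t \<and>
          measure_pmf.prob (run_on_input prog n lab \<epsilon> \<delta> t)
            {(c, s). k_clustering k {..<n} (output_clustering n s) \<and>
               real (agreements lab {..<n} (output_clustering n s))
                 \<ge> real (OPT k lab {..<n}) - \<epsilon> * (real n)\<^sup>2 / 2} \<ge> 1 - \<delta>)"
  proof (intro exI[of _ "program k"] allI impI)
    fix n :: nat and lab :: labeling and \<epsilon> \<delta> :: real
    assume n: "n \<ge> 1" and \<epsilon>: "\<epsilon> > 0" and \<delta>: "\<delta> > 0"
    obtain a L where prec: "precision k \<epsilon> \<delta> a L" using ex_precision[OF \<epsilon> \<delta>] .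
    define q where "q = 800 * (a * a * L)"
    define M where "M = (k + 3) * (q * q)"
    let ?t = "time_of k n a L q M"
    let ?ok = "\<lambda>s. k_clustering k {..<n} (output_clustering n s) \<and>
       real (agreements lab {..<n} (output_clustering n s)) \<ge> real (OPT k lab {..<n}) - \<epsilon> * (real n)\<^sup>2 / 2"
    obtain D where D: "run_on_input (program k) n lab \<epsilon> \<delta> ?t = map_pmf (Pair Skip) D"
      "measure_pmf.prob D {s. ?ok s} \<ge> 1 - \<delta>"
      using pends_correct[OF k n \<epsilon> \<delta> prec q_def M_def, of lab]
      unfolding pends_def runs_def run_on_input_def by blast
    have "measure_pmf.prob (run_on_input (program k) n lab \<epsilon> \<delta> ?t) {(c, s). ?ok s} =
        measure_pmf.prob D {s. ?ok s}"
      unfolding D(1) measure_map_pmf by (rule arg_cong[of _ _ "measure_pmf.prob D"]) auto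
    moreover have "halts_within (program k) n lab \<epsilon> \<delta> ?t"
      unfolding halts_within_def D(1) by auto
    ultimately show "\<exists>t. real t \<le> time_bound 768000 k n (min \<epsilon> (1/2)) (min \<delta> 1) \<and>
          halts_within (program k) n lab \<epsilon> \<delta> t \<and>
          measure_pmf.prob (run_on_input (program k) n lab \<epsilon> \<delta> t) {(c, s). ?ok s} \<ge> 1 - \<delta>"
      using D(2) time_bound_program[OF prec \<epsilon> \<delta> k n q_def M_def] by auto
  qed
qed simp

end
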